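(* Let $\varphi$ be a symmetric absolute normalized norm on $\mathbb R^2$ satisfying $\varphi(h,h+1)-\varphi(h,h)\ge\frac12$ for every $h\in\mathbb N$, and let $\alpha>0$ be such that $\alpha\notin\Lambda^\varphi$. Let $E\in\mathcal A^e_{\rm conv}$ be a set such that: (N) every $\mathbf i\in\partial^{\rm eff}E$ is non-degenerate; (M) $\theta(\boldsymbol\nu(\ell'),\boldsymbol\nu(\ell))<0$ for all discrete edges $\ell,\ell'$ of $E$ such that $\ell$ precedes $\ell'$ in clockwise order; (Sym) $E$ is symmetric with respect to the coordinate axes and the lines $x_2=\pm x_1$. Then there exists a unique solution $E_\alpha$ of the minimization problem $$\min\{\mathcal F_\alpha^\varphi(E',E): E'\in\mathcal D,\ E'\supset E\},$$ and it satisfies $$Z(E_\alpha)=\Big\{\mathbf i\in\mathbb Z_e^2: d^\varphi(\mathbf i,Z(E))<\frac4\alpha\Big\}.$$ In particular, $E_\alpha\in\mathcal A^e_{\rm conv}$.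
   Context: **Norms.** A norm $\varphi$ on $\mathbb R^2$ is absolute if $\varphi(\mathbf x)$ depends only on $|x_1|,|x_2|$; symmetric if $\varphi(x_1,x_2)=\varphi(x_2,x_1)$; normalized if $\varphi(1,0)=\varphi(0,1)=1$. For a set $S\subset\mathbb R^2$, $d^\varphi(\mathbf x,S)=\inf_{\mathbf y\in S}\varphi(\mathbf x-\mathbf y)$. **Admissible sets.** $q(\mathbf x)=\mathbf x+[-\frac12,\frac12]^2$. $\mathcal D$ is the class of sets $E(\mathcal I)=\bigcup_{\mathbf i\in\mathcal I}q(\mathbf i)$, $\mathcal I\subset\mathbb Z^2$, and $Z(E)=E\cap\mathbb Z^2$ for $E\in\mathcal D$. Energies are considered on sets of finite perimeter. $\mathbb Z_e^2=\{\mathbf i\in\mathbb Z^2:i_1+i_2\in2\mathbb Z\}$, $\Lambda^\varphi=\{4/\varphi(\mathbf i):\mathbf i\in\mathbb Z_e^2\setminus\{(0,0)\}\}$. $\mathcal A^e_{\rm conv}$ is the class of $E\in\mathcal D$ with $Z(E)\subset\mathbb Z_e^2$ and $\operatorname{conv}(Z(E))\cap\mathbb Z_e^2=Z(E)$. **Energy.** For $E',F\in\mathcal D$, $$\mathcal F_\alpha^\varphi(E',F)=-\mathcal H^1(\partial E')+\alpha\sum_{\mathbf i\in Z(E')\triangle Z(F)}d^\varphi(\mathbf i,\partial F),$$ where $d^\varphi(\mathbf i,\partial F)=\inf\{\varphi(\mathbf i-\mathbf j):\mathbf j\in Z(F)\}$ if $\mathbf i\notin Z(F)$ and $=\inf\{\varphi(\mathbf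 i-\mathbf j):\mathbf j\in\mathbb Z^2\setminus Z(F)\}$ if $\mathbf i\in Z(F)$. **Discrete boundary geometry.** For $E\in\mathcal A^e_{\rm conv}$, the effective boundary is $\partial^{\rm eff}E=\{\mathbf j\in Z(E):\exists\,\mathbf j_0\in\mathbb Z_e^2\setminus Z(E),\ |\mathbf j-\mathbf j_0|=\sqrt2\}$. A point $\mathbf i\in\partial^{\rm eff}E$ is non-degenerate if, with $\mathcal I=\{\mathbf j\in Z(E):\|\mathbf j-\mathbf i\|_1\le2\}$, the union of the segments $[\mathbf j_1,\mathbf j_2]$ over $\mathbf j_1,\mathbf j_2\in\mathcal I$ with $|\mathbf j_1-\mathbf j_2|\le2$ is the boundary of a triangulation of a simple polygon $\mathcal P$; then $\mathbf i^-,\mathbf i^+\in\partial^{\rm eff}E$ denote the vertices of $\mathcal P$ preceding, respectively following, $\mathbf i$ in the clockwise orientation of $\partial\mathcal P$. If every point of $\partial^{\rm eff}E$ is non-degenerate this orders $\partial^{\rm eff}E$ clockwise. For $\mathbf j\in\partial^{\rm eff}E$ let $\boldsymbol\nu^+(\mathbf j)=\frac{(j_2-j_2^+,\,j_1^+-j_1)}{|\mathbf j^+-\mathbf j|}$ and $\boldsymbol\nu^-(\mathbf j)=\frac{(j_2^--j_2,\,j_1-j_1^-)}{|\mathbf j-\mathbf j^-|}$. The signed angle of unit vectors $\mathbf v_1,\mathbf v_2$ with polar angles $\theta_1,\theta_2$ is $\theta(\mathbf v_2,\mathbf v_1)=\big(\theta_2-\theta_1+\pi\ (\mathrm{mod}\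 2\pi)\big)-\pi$. A point $\mathbf j$ is a discrete vertex if $\theta(\boldsymbol\nu^+(\mathbf j),\boldsymbol\nu^-(\mathbf j))<0$. A discrete edge is a set $\ell=\{\mathbf j^l\}_{l=0}^L$, $L\ge2$, of consecutive (clockwise) points of $\partial^{\rm eff}E$ with $\mathbf j^0,\mathbf j^L$ discrete vertices and no discrete vertex strictly between them; its outward normal is $\boldsymbol\nu(\ell)=\frac{(j_2^0-j_2^L,\,j_1^L-j_1^0)}{|\mathbf j^L-\mathbf j^0|}$. *)

theory Defs
  imports "HOL-Analysis.Analysis" "HOL-Library.Real_Mod"
begin

type_synonym plane = "real \<times> real"

section \<open>Norms and distances\<close>

text \<open>The Euclidean norm of the plane is \<open>norm\<close>; other norms are explicit functions.\<close>

definition is_norm :: "(plane \<Rightarrow> real) \<Rightarrow> bool" where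
  "is_norm \<phi> \<longleftrightarrow>
     (\<forall>x. 0 \<le> \<phi> x) \<and> (\<forall>x. \<phi> x = 0 \<longleftrightarrow> x = 0) \<and>
     (\<forall>c x. \<phi> (c *\<^sub>R x) = \<bar>c\<bar> * \<phi> x) \<and> (\<forall>x y. \<phi> (x + y) \<le> \<phi> x + \<phi> y)"

definition absolute_norm :: "(plane \<Rightarrow> real) \<Rightarrow> bool" where
  "absolute_norm \<phi> \<longleftrightarrow>
     (\<forall>x y. \<bar>fst x\<bar> = \<bar>fst y\<bar> \<and> \<bar>snd x\<bar> = \<bar>snd y\<bar> \<longrightarrow> \<phi> x = \<phi> y)"

definition symmetric_norm :: "(plane \<Rightarrow> real) \<Rightarrow> bool" where
  "symmetric_norm \<phi> \<longleftrightarrow> (\<forall>x1 x2. \<phi> (x1, x2) = \<phi> (x2, x1))"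

definition normalized_norm :: "(plane \<Rightarrow> real) \<Rightarrow> bool" where
  "normalized_norm \<phi> \<longleftrightarrow> \<phi> (1, 0) = 1 \<and> \<phi> (0, 1) = 1"

text \<open>Extended-real valued, so that the distance from the empty set is \<open>\<infinity>\<close>.\<close>

definition dist_phi :: "(plane \<Rightarrow> real) \<Rightarrow> plane \<Rightarrow> plane set \<Rightarrow> ereal" where
  "dist_phi \<phi> x S = (INF y\<in>S. ereal (\<phi> (x - y)))"

definition norm1 :: "plane \<Rightarrow> real" where
  "norm1 x = \<bar>fst x\<bar> + \<bar>snd x\<bar>"

section \<open>Lattice sets\<close>

definition lattice :: "plane set" where
  "lattice = \<int> \<times> \<int>"

definition even_lattice :: "plane set" where
  "even_lattice = {(of_int a, of_int b) | a b :: int. even (a + b)}"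

definition unit_square :: "plane \<Rightarrow> plane set" where
  "unit_square x = (+) x ` ({-1/2..1/2} \<times> {-1/2..1/2})"

definition cell_union :: "plane set \<Rightarrow> plane set" where
  "cell_union I = (\<Union>i\<in>I. unit_square i)"

definition admissible_sets :: "plane set set" where
  "admissible_sets = {cell_union I | I. I \<subseteq> lattice}"

definition centers :: "plane set \<Rightarrow> plane set" where
  "centers E = E \<inter> lattice"

definition Lambda_phi :: "(plane \<Rightarrow> real) \<Rightarrow> real set" where
  "Lambda_phi \<phi> = {4 / \<phi> i | i. i \<in> even_lattice - {(0, 0)}}"

definition even_convex_sets :: "plane set set" where
  "even_convex_sets =
     {E \<in> admissible_sets. centers E \<subseteq> even_lattice \<and>
        (convex hull (centers E)) \<inter> even_lattice = centers E}"

section \<open>One-dimensional Hausdorff measure\<close>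

text \<open>The bound on the diameters is paired with boundedness because \<open>diameter\<close> is not
  meaningful on unbounded sets.\<close>

definition hausdorff1_delta :: "real \<Rightarrow> 'a::metric_space set \<Rightarrow> ennreal" where
  "hausdorff1_delta \<delta> A =
     (INF U \<in> {U :: nat \<Rightarrow> 'a set. A \<subseteq> (\<Union>n. U n) \<and> (\<forall>n. bounded (U n) \<and> diameter (U n) \<le> \<delta>)}.
        \<Sum>n. ennreal (diameter (U n)))"

definition hausdorff1 :: "'a::metric_space set \<Rightarrow> ennreal" where
  "hausdorff1 A = (SUP \<delta>\<in>{0<..}. hausdorff1_delta \<delta> A)"

text \<open>For unions of unit squares the perimeter is the length of the topological boundary.\<close>

definition finite_perimeter :: "plane set \<Rightarrow> bool" where
  "finite_perimeter E \<longleftrightarrow> hausdorff1 (frontier E) < \<infinity>"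

section \<open>The energy\<close>

definition boundary_dist :: "(plane \<Rightarrow> real) \<Rightarrow> plane \<Rightarrow> plane set \<Rightarrow> ereal" where
  "boundary_dist \<phi> i F =
     (if i \<in> centers F then dist_phi \<phi> i (lattice - centers F) else dist_phi \<phi> i (centers F))"

text \<open>The sum has nonnegative terms and may be \<open>\<infinity>\<close>; the first term is finite for \<open>E'\<close> of
  finite perimeter, so \<open>-\<infinity> + \<infinity>\<close> does not occur there.\<close>

definition energy :: "(plane \<Rightarrow> real) \<Rightarrow> real \<Rightarrow> plane set \<Rightarrow> plane set \<Rightarrow> ereal" where
  "energy \<phi> \<alpha> E' F =
     - enn2ereal (hausdorff1 (frontier E')) +
     ereal \<alpha> * (\<Sum>\<^sub>\<infinity>i \<in> sym_diff (centers E') (centers F). boundary_dist \<phi> i F)"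

definition is_solution :: "(plane \<Rightarrow> real) \<Rightarrow> real \<Rightarrow> plane set \<Rightarrow> plane set \<Rightarrow> bool" where
  "is_solution \<phi> \<alpha> E E\<alpha> \<longleftrightarrow>
     is_arg_min (\<lambda>E'. energy \<phi> \<alpha> E' E)
       (\<lambda>E'. E' \<in> admissible_sets \<and> finite_perimeter E' \<and> E \<subseteq> E') E\<alpha>"

section \<open>Simple polygons\<close>

text \<open>A polygon is given by the cyclic list of its vertices; straight angles at vertices are
  allowed.\<close>

definition polygon_edge :: "plane list \<Rightarrow> nat \<Rightarrow> plane set" where
  "polygon_edge ps k = closed_segment (ps ! k) (ps ! (Suc k mod length ps))"

definition polygon_boundary :: "plane list \<Rightarrow> plane set" where
  "polygon_boundary ps = (\<Union>k<length ps. polygon_edge ps k)"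

definition polygon_region :: "plane list \<Rightarrow> plane set" where
  "polygon_region ps = polygon_boundary ps \<union> inside (polygon_boundary ps)"

definition simple_polygon :: "plane list \<Rightarrow> bool" where
  "simple_polygon ps \<longleftrightarrow> 3 \<le> length ps \<and> distinct ps \<and>
     (\<forall>k<length ps. \<forall>l<length ps. k \<noteq> l \<longrightarrow>
        polygon_edge ps k \<inter> polygon_edge ps l =
        {ps ! k, ps ! (Suc k mod length ps)} \<inter> {ps ! l, ps ! (Suc l mod length ps)})"

text \<open>Shoelace formula; positive for counterclockwise vertex lists.\<close>

definition signed_area :: "plane list \<Rightarrow> real" where
  "signed_area ps =
     (\<Sum>k<length ps. let p = ps ! k; p' = ps ! (Suc k mod length ps)
        in fst p * snd p' - fst p' * snd p) / 2"

definition clockwise :: "plane list \<Rightarrow> bool" where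
  "clockwise ps \<longleftrightarrow> signed_area ps < 0"

section \<open>Discrete boundary geometry\<close>

definition eff_boundary :: "plane set \<Rightarrow> plane set" where
  "eff_boundary E =
     {j \<in> centers E. \<exists>j0 \<in> even_lattice - centers E. norm (j - j0) = sqrt 2}"

definition nbhd :: "plane set \<Rightarrow> plane \<Rightarrow> plane set" where
  "nbhd E i = {j \<in> centers E. norm1 (j - i) \<le> 2}"

definition nbhd_segments :: "plane set \<Rightarrow> plane \<Rightarrow> plane set" where
  "nbhd_segments E i =
     \<Union> {closed_segment j1 j2 | j1 j2. j1 \<in> nbhd E i \<and> j2 \<in> nbhd E i \<and> norm (j1 - j2) \<le> 2}"

definition triangulates :: "plane set set \<Rightarrow> plane set \<Rightarrow> bool" where
  "triangulates \<T> P \<longleftrightarrow> triangulation \<T> \<and> (\<forall>T\<in>\<T>. 2 simplex T) \<and> \<Union>\<T> = P"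

text \<open>The polygon \<open>\<P>\<close> attached to a boundary point \<open>i\<close>, as a clockwise list. Its vertices
  are all the points of \<open>nbhd E i\<close> on its boundary, including those with a straight angle
  (otherwise \<open>i\<close> would not be a vertex in the middle of a flat piece of the boundary). The
  triangles need not have their vertices in \<open>nbhd E i\<close>: two segments of length \<open>2\<close> may cross.\<close>

definition local_polygon :: "plane set \<Rightarrow> plane \<Rightarrow> plane list \<Rightarrow> bool" where
  "local_polygon E i ps \<longleftrightarrow>
     simple_polygon ps \<and> clockwise ps \<and>
     set ps = nbhd E i \<inter> polygon_boundary ps \<and> i \<in> set ps \<and>
     (\<exists>\<T>. triangulates \<T> (polygon_region ps) \<and> (\<Union>T\<in>\<T>. frontier T) = nbhd_segments E i)"

definition nondegenerate :: "plane set \<Rightarrow> plane \<Rightarrow> bool" where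
  "nondegenerate E i \<longleftrightarrow> (\<exists>ps. local_polygon E i ps)"

definition next_pt :: "plane set \<Rightarrow> plane \<Rightarrow> plane" where
  "next_pt E i =
     (THE j. \<exists>ps k. local_polygon E i ps \<and> k < length ps \<and>
        ps ! k = i \<and> ps ! (Suc k mod length ps) = j)"

definition prev_pt :: "plane set \<Rightarrow> plane \<Rightarrow> plane" where
  "prev_pt E i =
     (THE j. \<exists>ps k. local_polygon E i ps \<and> k < length ps \<and>
        ps ! k = j \<and> ps ! (Suc k mod length ps) = i)"

text \<open>The unit vector obtained from \<open>b - a\<close> by a counterclockwise quarter turn; it points
  outwards when the boundary is run clockwise from \<open>a\<close> to \<open>b\<close>.\<close>

definition step_normal :: "plane \<Rightarrow> plane \<Rightarrow> plane" where
  "step_normal a b = (1 / norm (b - a)) *\<^sub>R (snd a - snd b, fst b - fst a)"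

definition nu_plus :: "plane set \<Rightarrow> plane \<Rightarrow> plane" where
  "nu_plus E j = step_normal j (next_pt E j)"

definition nu_minus :: "plane set \<Rightarrow> plane \<Rightarrow> plane" where
  "nu_minus E j = step_normal (prev_pt E j) j"

definition polar_angle :: "plane \<Rightarrow> real" where
  "polar_angle v = Arg (Complex (fst v) (snd v))"

definition signed_angle :: "plane \<Rightarrow> plane \<Rightarrow> real" where
  "signed_angle v2 v1 = ((polar_angle v2 - polar_angle v1 + pi) rmod (2 * pi)) - pi"

definition discrete_vertex :: "plane set \<Rightarrow> plane \<Rightarrow> bool" where
  "discrete_vertex E j \<longleftrightarrow>
     j \<in> eff_boundary E \<and> signed_angle (nu_plus E j) (nu_minus E j) < 0"

text \<open>A discrete edge is the list of its points in clockwise order.\<close>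

definition discrete_edge :: "plane set \<Rightarrow> plane list \<Rightarrow> bool" where
  "discrete_edge E js \<longleftrightarrow>
     3 \<le> length js \<and> distinct js \<and> set js \<subseteq> eff_boundary E \<and>
     (\<forall>l. Suc l < length js \<longrightarrow> js ! Suc l = next_pt E (js ! l)) \<and>
     discrete_vertex E (hd js) \<and> discrete_vertex E (last js) \<and>
     (\<forall>l. 0 < l \<and> Suc l < length js \<longrightarrow> \<not> discrete_vertex E (js ! l))"

definition edge_normal :: "plane list \<Rightarrow> plane" where
  "edge_normal js = step_normal (hd js) (last js)"

text \<open>\<open>ls'\<close> is the first discrete edge met when running clockwise from the final point of
  \<open>ls\<close>. The two need not share a vertex, as two discrete vertices can be adjacent and then
  there is no discrete edge between them.\<close>

definition edge_precedes :: "plane set \<Rightarrow> plane list \<Rightarrow> plane list \<Rightarrow> bool" where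
  "edge_precedes E ls ls' \<longleftrightarrow> discrete_edge E ls \<and> discrete_edge E ls' \<and>
     (\<exists>m. hd ls' = (next_pt E ^^ m) (last ls) \<and>
        (\<forall>k<m. \<not> (\<exists>js. discrete_edge E js \<and> hd js = (next_pt E ^^ k) (last ls))))"

section \<open>Symmetries\<close>

definition dihedral_symmetric :: "plane set \<Rightarrow> bool" where
  "dihedral_symmetric E \<longleftrightarrow>
     (\<lambda>(x1, x2). (- x1, x2)) ` E = E \<and> (\<lambda>(x1, x2). (x1, - x2)) ` E = E \<and>
     (\<lambda>(x1, x2). (x2, x1)) ` E = E \<and> (\<lambda>(x1, x2). (- x2, - x1)) ` E = E"

end

theory Submission
  imports Defs
begin

text \<open>
  Let \<open>I\<close> be the set of centers of \<open>E\<close>, let \<open>d\<close> be the \<open>\<phi>\<close>-distance from \<open>I\<close>, \<open>c = 4 / \<alpha>\<close> and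
  \<open>w = max 0 (c - d)\<close>. Counting the unit edges of the boundary turns the problem into maximizing,
  over finite \<open>X \<supseteq> I\<close>, the sum of \<open>c - d\<close> over \<open>X - I\<close> minus \<open>c / 2\<close> for every pair of neighbours
  in \<open>X\<close>. Without odd points the optimum is \<open>{d < c}\<close> within the even lattice. Odd points do not
  pay off because of a flow from odd points to neighbouring even points that uses each edge with
  at most \<open>c / 2\<close>, leaves each odd point \<open>p\<close> with at least \<open>w p\<close> and enters each even point
  \<open>a \<notin> I\<close> with at most \<open>w a\<close>.

  The flow is built in the sector \<open>0 \<le> y < x\<close>. Its shape is dictated by how the position of the
  nearest point of \<open>I\<close> changes between neighbouring odd points, which is monotone by exchange
  arguments: where the nearest point is the same for \<open>(x, y)\<close> and \<open>(x - 1, y + 1)\<close>,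
  submodularity of the norm controls the four distances around; elsewhere convexity of the norm
  suffices.

  If the gain were also optimal for some \<open>X\<close> with odd points, then it would be so for all
  parameters near \<open>c\<close>, as both sides are locally affine in \<open>c\<close>, and complementary slackness at the
  outermost odd point of \<open>X\<close> would be violated.
\<close>

section \<open>Symmetric absolute norms of the plane\<close>

text \<open>The flow is a dual certificate in the sense of linear programming, and complementary
  slackness is the source of uniqueness. The price c / 2 of a pair of neighbours comes from the
  perimeter: two adjacent cells hide two unit sides, and 2 = \<alpha> * (c / 2). The obstacle is the
  choice of the flow. A rule that sends out exactly the demanded amount is controlled by
  submodularity on a unit square, which needs two consecutive odd points of an antidiagonal to share
  their nearest point; equality of \<open>N\<close> suffices for that. But \<open>N\<close> is
  merely monotone along antidiagonals. Its regularization \<open>kap\<close> falls by 0 or 1 at each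
  step, which leaves five patterns of values around an even point inside the sector, and in each of
  them the rules chosen by the neighbours fit together. Of the shape of I the flow needs only the
  closure properties \<open>rect\<close> and \<open>anti\<close>. Lattice convexity itself returns
  in the proof that the optimal set is again lattice convex.\<close>

locale absolute_norm2 =
  fixes f :: "real \<Rightarrow> real \<Rightarrow> real"
  assumes tri: "f (x + x') (y + y') \<le> f x y + f x' y'"
    and hom: "0 \<le> t \<Longrightarrow> f (t * x) (t * y) = t * f x y"
    and refl1: "f (- x) y = f x y"
    and refl2: "f x (- y) = f x y"
begin

lemma comb_le:
  assumes "0 \<le> s" "0 \<le> t"
  shows "f (s * x + t * x') (s * y + t * y') \<le> s * f x y + t * f x' y'"
  using tri[of "s * x" "t * x'" "s * y" "t * y'"] hom[OF assms(1)] hom[OF assms(2)] by simp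

text \<open>The number x is a convex combination of x' and - x', and by reflection f has the same
  value at both.\<close>

lemma mono1: assumes "\<bar>x\<bar> \<le> \<bar>x'\<bar>" shows "f x y \<le> f x' y"
proof (cases "x' = 0")
  case True then show ?thesis using assms by simp
next
  case False
  define s where "s = (1 + x / x') / 2"
  have b: "-1 \<le> x / x'" "x / x' \<le> 1"
    using assms False by (auto simp: abs_le_iff divide_simps split: if_splits)
  have s: "0 \<le> s" "0 \<le> 1 - s" using b by (auto simp: s_def)
  have "s * x' + (1 - s) * (- x') = x" using False by (simp add: s_def field_simps)
  moreover have "s * y + (1 - s) * y = y" by (simp add: algebra_simps)
  ultimately show ?thesis
    using comb_le[OF s, of x' "- x'" y y] by (simp add: refl1 algebra_simps)
qed

lemma mono2: assumes "\<bar>y\<bar> \<le> \<bar>y'\<bar>" shows "f x y \<le> f x y'"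
proof -
  interpret s: absolute_norm2 "\<lambda>x y. f y x"
    by unfold_locales (auto simp: tri hom refl1 refl2)
  show ?thesis using s.mono1[OF assms] .
qed

lemma mono: "\<bar>x\<bar> \<le> \<bar>x'\<bar> \<Longrightarrow> \<bar>y\<bar> \<le> \<bar>y'\<bar> \<Longrightarrow> f x y \<le> f x' y'"
  using mono1[of x x' y] mono2[of y y' x'] by linarith

text \<open>The vector \<open>(a, b)\<close> lies in the cone spanned by \<open>(a, b + t)\<close> and \<open>(a + s, b)\<close>, with
  coefficients at most \<open>1\<close>; the complementary coefficients represent \<open>(a + s, b + t)\<close>.\<close>

lemma submodular:
  assumes "0 \<le> a" "0 \<le> b" "0 \<le> s" "0 \<le> t"
  shows "f a b + f (a + s) (b + t) \<le> f (a + s) b + f a (b + t)"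
proof (cases "s = 0 \<or> t = 0")
  case True then show ?thesis by auto
next
  case False
  then have st: "0 < s" "0 < t" using assms by auto
  define D where "D = b * s + a * t + s * t"
  have D: "0 < D" using st assms by (simp add: D_def add_nonneg_pos)
  define \<alpha> where "\<alpha> = b * s / D"
  define \<beta> where "\<beta> = a * t / D"
  have ab: "0 \<le> \<alpha>" "0 \<le> \<beta>" "0 \<le> 1 - \<alpha>" "0 \<le> 1 - \<beta>"
    using D st assms by (auto simp: \<alpha>_def \<beta>_def D_def divide_simps)
  have m: "\<alpha> * D = b * s" "\<beta> * D = a * t" using D by (auto simp: \<alpha>_def \<beta>_def)
  have "D * (\<alpha> * a + \<beta> * (a + s)) = (\<alpha> * D) * a + (\<beta> * D) * (a + s)"
    "D * (\<alpha> * (b + t) + \<beta> * b) = (\<alpha> * D) * (b + t) + (\<beta> * D) * b"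
    by (simp_all add: algebra_simps)
  then have "D * (\<alpha> * a + \<beta> * (a + s)) = D * a" "D * (\<alpha> * (b + t) + \<beta> * b) = D * b"
    unfolding m by (simp_all add: D_def algebra_simps)
  then have e: "\<alpha> * a + \<beta> * (a + s) = a" "\<alpha> * (b + t) + \<beta> * b = b"
    using D by auto
  have "f a b \<le> \<alpha> * f a (b + t) + \<beta> * f (a + s) b"
    using comb_le[OF ab(1,2), of a "a + s" "b + t" b] e by simp
  moreover have "(1 - \<alpha>) * a + (1 - \<beta>) * (a + s) = a + s"
    "(1 - \<alpha>) * (b + t) + (1 - \<beta>) * b = b + t"
    using e by (auto simp: algebra_simps)
  then have "f (a + s) (b + t) \<le> (1 - \<alpha>) * f a (b + t) + (1 - \<beta>) * f (a + s) b"
    using comb_le[OF ab(3,4), of a "a + s" "b + t" b] by simp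
  ultimately show ?thesis by (simp add: algebra_simps)
qed

text \<open>The points a + s and a' are complementary convex combinations of a and a' + s, so the
  weights cancel when the two estimates are added.\<close>

lemma convex1:
  assumes "a \<le> a'" "0 \<le> s"
  shows "f (a + s) b - f a b \<le> f (a' + s) b - f a' b"
proof (cases "a = a'")
  case False
  define T where "T = a' + s - a"
  have T: "0 < T" using False assms by (simp add: T_def)
  define l where "l = s / T"
  have l: "0 \<le> l" "0 \<le> 1 - l" using T assms by (auto simp: l_def T_def)
  have lT: "l * T = s" using T by (simp add: l_def)
  then have e: "(1 - l) * a + l * (a' + s) = a + s" "l * a + (1 - l) * (a' + s) = a'"
    by (auto simp: T_def algebra_simps)
  have c: "(1 - l) * b + l * b = b" "l * b + (1 - l) * b = b" by (auto simp: algebra_simps)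
  have "f (a + s) b \<le> (1 - l) * f a b + l * f (a' + s) b"
    "f a' b \<le> l * f a b + (1 - l) * f (a' + s) b"
    using comb_le[OF l(2,1), of a "a' + s" b b] comb_le[OF l, of a "a' + s" b b]
    unfolding e c by auto
  then show ?thesis by (simp add: algebra_simps)
qed simp

text \<open>Convexity moves a to A and submodularity lowers b to B. This is the exchange rule for
  comparing distances to two points of I from two base points.\<close>

lemma increment1:
  assumes "0 \<le> a" "a \<le> A" "0 \<le> B" "B \<le> b" "0 \<le> s"
  shows "f (a + s) b - f a b \<le> f (A + s) B - f A B"
  using convex1[OF assms(2,5), of b] submodular[of A B s "b - B"] assms by simp

end

section \<open>Norms of integer vectors, also in rotated coordinates\<close>

locale symmetric_norm2 = absolute_norm2 +
  assumes sym: "f x y = f y x" and f10: "f 1 0 = 1"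
begin

text \<open>In the coordinates s = x - y and t = x + y the norm is absolute again: negating s swaps
  x and y, negating t swaps and negates them. So monotonicity and increment bounds also hold along
  diagonals and antidiagonals.\<close>

sublocale rot: absolute_norm2 "\<lambda>s t. f ((t + s) / 2) ((t - s) / 2)"
proof
  fix x x' y y' t :: real
  show "f ((y + y' + (x + x')) / 2) ((y + y' - (x + x')) / 2)
    \<le> f ((y + x) / 2) ((y - x) / 2) + f ((y' + x') / 2) ((y' - x') / 2)"
    using tri[of "(y + x) / 2" "(y' + x') / 2" "(y - x) / 2" "(y' - x') / 2"]
    by (simp add: add_divide_distrib diff_divide_distrib algebra_simps)
  show "f ((t * y + t * x) / 2) ((t * y - t * x) / 2) = t * f ((y + x) / 2) ((y - x) / 2)"
    if "0 \<le> t"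
    using hom[OF that, of "(y + x) / 2" "(y - x) / 2"] by (simp add: field_simps)
  show "f ((y + - x) / 2) ((y - - x) / 2) = f ((y + x) / 2) ((y - x) / 2)"
    using sym[of "(y - x) / 2" "(y + x) / 2"] by simp
  show "f ((- y + x) / 2) ((- y - x) / 2) = f ((y + x) / 2) ((y - x) / 2)"
    using sym[of "(x - y) / 2" "- ((y + x) / 2)"] refl1[of "(y - x) / 2"] refl2[of "(y+x)/2" "(y - x) / 2"] refl1[of "(y + x) / 2" "(x - y) / 2"]
    by (simp add: minus_divide_left)
qed

definition n :: "int \<Rightarrow> int \<Rightarrow> real" where "n a b = f (of_int a) (of_int b)"

lemma n_refl: "n (- a) b = n a b" "n a (- b) = n a b" by (auto simp: n_def refl1 refl2)
lemma n_sym: "n a b = n b a" by (auto simp: n_def sym)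
lemma n_mono: "\<bar>a\<bar> \<le> \<bar>a'\<bar> \<Longrightarrow> \<bar>b\<bar> \<le> \<bar>b'\<bar> \<Longrightarrow> n a b \<le> n a' b'"
  unfolding n_def by (intro mono) linarith+
lemma n_tri: "n (a + a') (b + b') \<le> n a b + n a' b'"
  using tri[of "of_int a" "of_int a'" "of_int b" "of_int b'"] by (simp add: n_def)
lemma n_axis: "0 \<le> a \<Longrightarrow> n a 0 = of_int a"
  using hom[of "of_int a" 1 0] by (simp add: n_def f10)
lemma n_unit: "n 1 0 = 1" "n 0 1 = 1" "n (-1) 0 = 1" "n 0 (-1) = 1"
  using f10 n_refl n_sym by (auto simp: n_def sym refl1 refl2)
lemma n_ge: "\<bar>a\<bar> \<le> n a b"
  using n_mono[of "\<bar>a\<bar>" a 0 b] n_axis[of "\<bar>a\<bar>"] by simp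
lemma n_submodular:
  "\<lbrakk>0 \<le> a; 0 \<le> b; 0 \<le> s; 0 \<le> t\<rbrakk> \<Longrightarrow> n a b + n (a + s) (b + t) \<le> n (a + s) b + n a (b + t)"
  unfolding n_def using submodular[of "of_int a" "of_int b" "of_int s" "of_int t"] by simp
lemma n_increment:
  "\<lbrakk>0 \<le> a; a \<le> A; 0 \<le> B; B \<le> b; 0 \<le> s\<rbrakk> \<Longrightarrow> n (a + s) b - n a b \<le> n (A + s) B - n A B"
  unfolding n_def
  using increment1[of "of_int a" "of_int A" "of_int B" "of_int b" "of_int s"] by simp
text \<open>This is \<open>increment1\<close> in rotated coordinates: a diagonal step raises the sum
  by 2 and keeps the difference.\<close>

lemma n_increment_diag:
  assumes "0 \<le> b" "b \<le> a" "a - b \<le> A - B" "0 \<le> A + B" "A + B \<le> a + b"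
  shows "n (A + 1) (B + 1) - n A B \<le> n (a + 1) (b + 1) - n a b"
proof -
  interpret r: absolute_norm2 "\<lambda>t s. f ((t + s) / 2) ((t - s) / 2)"
    by unfold_locales (use rot.tri rot.hom rot.refl1 rot.refl2 in auto)
  show ?thesis
    using r.increment1[of "of_int (A + B)" "of_int (a + b)" "of_int (a - b)" "of_int (A - B)" 2] assms
    by (simp add: n_def add_divide_distrib diff_divide_distrib algebra_simps)
qed
text \<open>With the sum fixed, the norm is monotone in the absolute difference of the
  coordinates.\<close>

lemma n_balance: "\<lbrakk>b + k \<le> a; 0 \<le> k\<rbrakk> \<Longrightarrow> n (a - k) (b + k) \<le> n a b"
proof -
  assume a: "b + k \<le> a" "0 \<le> k"
  have "\<bar>of_int (a - b - 2 * k)\<bar> \<le> \<bar>of_int (a - b) :: real\<bar>" using a by linarith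
  from rot.mono1[OF this, of "of_int (a + b)"] show ?thesis
    by (simp add: n_def add_divide_distrib diff_divide_distrib algebra_simps)
qed
text \<open>Scaled by (a - 1) / a, the vector (a, b) still dominates (a - 1, b - 1) because b \<le>
  a, and scaling by a factor below 1 strictly lowers a positive norm.\<close>

lemma n_shrink:
  assumes "1 \<le> b" "b \<le> a" shows "n (a - 1) (b - 1) < n a b"
proof -
  define t where "t = (of_int a - 1) / (of_int a :: real)"
  have t: "0 \<le> t" "t < 1" using assms by (auto simp: t_def)
  have 1: "of_int a - 1 = t * of_int a" using assms by (simp add: t_def)
  have "of_int b \<le> (of_int a :: real)" using assms by simp
  then have 2: "of_int b - 1 \<le> t * of_int b"
    using assms by (simp add: t_def field_simps)
  have "n (a - 1) (b - 1) \<le> f (t * of_int a) (t * of_int b)"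
    unfolding n_def using 1 2 assms by (intro mono) auto
  also have "\<dots> = t * n a b" by (simp add: hom t n_def)
  also have "\<dots> < n a b" using t n_ge[of a b] assms by simp
  finally show ?thesis .
qed
lemma n_step: "n (a + 1) b \<le> n a b + 1" "n a (b + 1) \<le> n a b + 1"
    "n (a - 1) b \<le> n a b + 1" "n a (b - 1) \<le> n a b + 1"
  using n_tri[of a 1 b 0] n_tri[of a 0 b 1] n_tri[of a "-1" b 0] n_tri[of a 0 b "-1"]
  by (auto simp: n_unit)

end

section \<open>Nearest points in a symmetric lattice set\<close>

text \<open>The last two assumptions extract from convexity and symmetry that I contains, with a
  point (a, b), the even points of its centred rectangle and the antidiagonal segment towards (b,
  a).\<close>

locale lattice_body = symmetric_norm2 +
  fixes I :: "(int \<times> int) set"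
  assumes fin: "finite I" and ne: "I \<noteq> {}"
    and ev: "(a, b) \<in> I \<Longrightarrow> even (a + b)"
    and rect: "\<lbrakk>(a, b) \<in> I; \<bar>a'\<bar> \<le> \<bar>a\<bar>; \<bar>b'\<bar> \<le> \<bar>b\<bar>; even (a' + b')\<rbrakk> \<Longrightarrow> (a', b') \<in> I"
    and anti: "\<lbrakk>(a, b) \<in> I; 0 \<le> k; k \<le> a - b\<rbrakk> \<Longrightarrow> (a - k, b + k) \<in> I"
begin

definition d :: "int \<Rightarrow> int \<Rightarrow> real" where
  "d x y = Min ((\<lambda>(a, b). n (x - a) (y - b)) ` I)"

lemma d_le: "(a, b) \<in> I \<Longrightarrow> d x y \<le> n (x - a) (y - b)"
  unfolding d_def using fin by (intro Min_le) auto

lemma d_attained: obtains a b where "(a, b) \<in> I" "d x y = n (x - a) (y - b)"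
proof -
  have "d x y \<in> (\<lambda>(a, b). n (x - a) (y - b)) ` I"
    unfolding d_def using fin ne by (intro Min_in) auto
  then show thesis using that by auto
qed

lemma I_refl: "(a, b) \<in> I \<Longrightarrow> (- a, b) \<in> I" "(a, b) \<in> I \<Longrightarrow> (a, - b) \<in> I"
  using rect[of a b "- a" b] rect[of a b a "- b"] ev[of a b] by auto

lemma I_swap: assumes "(a, b) \<in> I" shows "(b, a) \<in> I"
proof (cases "b \<le> a")
  case True then show ?thesis using anti[OF assms, of "a - b"] by simp
next
  case False
  have "(- a, - b) \<in> I" using assms I_refl by blast
  from anti[OF this, of "b - a"] False have "(- b, - a) \<in> I" by simp
  then show ?thesis using I_refl[of "- b" "- a"] I_refl[of b "- a"] by simp
qed

lemma d_refl: "d (- x) y = d x y" "d x (- y) = d x y"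
proof -
  have 1: "n (- x - - a) (y - b) = n (x - a) (y - b)"
    "n (x - a) (- y - - b) = n (x - a) (y - b)" for x y a b
    using n_refl(1)[of "x - a" "y - b"] n_refl(2)[of "x - a" "y - b"]
    by (simp_all add: algebra_simps)
  have le: "d (- x) y \<le> d x y" "d x (- y) \<le> d x y" for x y
  proof -
    obtain a b where ab: "(a, b) \<in> I" "d x y = n (x - a) (y - b)" by (rule d_attained)
    show "d (- x) y \<le> d x y" "d x (- y) \<le> d x y"
      using d_le[OF I_refl(1)[OF ab(1)], of "- x" y] d_le[OF I_refl(2)[OF ab(1)], of x "- y"]
      unfolding 1 ab(2) by auto
  qed
  show "d (- x) y = d x y" "d x (- y) = d x y"
    using le(1)[of x y] le(1)[of "- x" y] le(2)[of x y] le(2)[of x "- y"] by auto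
qed

lemma d_swap: "d x y = d y x"
proof -
  have le: "d y x \<le> d x y" for x y
  proof -
    obtain a b where ab: "(a, b) \<in> I" "d x y = n (x - a) (y - b)" by (rule d_attained)
    show ?thesis using d_le[OF I_swap[OF ab(1)], of y x] ab(2) n_sym[of "x - a" "y - b"] by simp
  qed
  show ?thesis using le[of x y] le[of y x] by simp
qed

lemma d_nonneg: "0 \<le> d x y"
proof -
  obtain a b where "d x y = n (x - a) (y - b)" by (rule d_attained)
  then show ?thesis using n_ge[of "x - a" "y - b"] by linarith
qed

lemma d_in: "(x, y) \<in> I \<Longrightarrow> d x y = 0"
  using d_le[of x y x y] d_nonneg[of x y] n_axis[of 0] by simp

lemma d_ge_1: "(x, y) \<notin> I \<Longrightarrow> 1 \<le> d x y"
proof -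
  assume "(x, y) \<notin> I"
  moreover obtain a b where ab: "(a, b) \<in> I" "d x y = n (x - a) (y - b)" by (rule d_attained)
  ultimately have "x - a \<noteq> 0 \<or> y - b \<noteq> 0" by auto
  then have "1 \<le> \<bar>x - a\<bar> \<or> 1 \<le> \<bar>y - b\<bar>" by linarith
  then show ?thesis using n_ge[of "x - a" "y - b"] n_ge[of "y - b" "x - a"] n_sym[of "x - a" "y - b"] ab
    by linarith
qed

lemma d_step: "d (x + 1) y \<le> d x y + 1" "d x (y + 1) \<le> d x y + 1"
  "d (x - 1) y \<le> d x y + 1" "d x (y - 1) \<le> d x y + 1"
proof -
  obtain a b where ab: "(a, b) \<in> I" "d x y = n (x - a) (y - b)" by (rule d_attained)
  show "d (x + 1) y \<le> d x y + 1" "d x (y + 1) \<le> d x y + 1"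
    "d (x - 1) y \<le> d x y + 1" "d x (y - 1) \<le> d x y + 1"
    using d_le[OF ab(1), of "x + 1" y] d_le[OF ab(1), of x "y + 1"]
      d_le[OF ab(1), of "x - 1" y] d_le[OF ab(1), of x "y - 1"] ab(2) n_step[of "x - a" "y - b"]
    by (simp_all add: algebra_simps)
qed

lemma odd_offset: "odd (x + y) \<Longrightarrow> even (a + b) \<Longrightarrow> odd (x - a + (y - b))" for x y a b :: int
  by presburger

lemma odd_eq_1: "odd p \<Longrightarrow> 0 < p \<Longrightarrow> \<not> 3 \<le> p \<Longrightarrow> p = 1" for p :: int
  by presburger

section \<open>The nearest point of I chosen for an odd point of the sector\<close>

definition Om :: "int \<Rightarrow> int \<Rightarrow> bool" where "Om x y \<longleftrightarrow> odd (x + y) \<and> 0 \<le> y \<and> y < x"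

definition J :: "int \<Rightarrow> int \<Rightarrow> (int \<times> int) set" where
  "J x y = {(a, b) \<in> I. b \<le> y \<and> y - b < x - a \<and> n (x - a) (y - b) = d x y}"

lemma J_iff: "(a, b) \<in> J x y \<longleftrightarrow> (a, b) \<in> I \<and> b \<le> y \<and> y - b < x - a \<and> n (x - a) (y - b) = d x y"
  by (auto simp: J_def)

lemma J_I: "\<lbrakk>(a, b) \<in> I; b \<le> y; y - b < x - a; n (x - a) (y - b) \<le> d x y\<rbrakk> \<Longrightarrow> (a, b) \<in> J x y"
  using d_le[of a b x y] by (auto simp: J_iff)

lemma J_nonempty: assumes "Om x y" shows "J x y \<noteq> {}"
proof -
  have o: "odd (x + y)" "0 \<le> y" "y < x" using assms by (auto simp: Om_def)
  obtain a0 b0 where ab0: "(a0, b0) \<in> I" "d x y = n (x - a0) (y - b0)" by (rule d_attained)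
  \<comment> \<open>A coordinate beyond the base point is reflected in it; since x and y are
    nonnegative this does not raise its absolute value, and \<open>rect\<close> applies.\<close>
  define a where "a = (if a0 \<le> x then a0 else 2 * x - a0)"
  define b where "b = (if b0 \<le> y then b0 else 2 * y - b0)"
  have ab: "(a, b) \<in> I"
    by (rule rect[OF ab0(1)]) (use o ev[OF ab0(1)] in \<open>auto simp: a_def b_def\<close>)
  have le: "a \<le> x" "b \<le> y" by (auto simp: a_def b_def)
  have "\<bar>x - a\<bar> = \<bar>x - a0\<bar>" "\<bar>y - b\<bar> = \<bar>y - b0\<bar>" by (auto simp: a_def b_def)
  then have "n (x - a) (y - b) = n (x - a0) (y - b0)"
    using n_mono[of "x - a" "x - a0" "y - b" "y - b0"] n_mono[of "x - a0" "x - a" "y - b0" "y - b"]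
    by simp
  then have d: "d x y = n (x - a) (y - b)" using ab0 by simp
  show ?thesis
  proof (cases "y - b < x - a")
    case True
    then have "(a, b) \<in> J x y" using J_I[OF ab le(2)] d by simp
    then show ?thesis by blast
  next
    case False
    have "x - a \<noteq> y - b" using odd_offset[OF o(1) ev[OF ab]] by presburger
    with False have k: "x - a < y - b" by simp
    \<comment> \<open>Moving by k along the antidiagonal exchanges the two entries of the
      offset.\<close>
    define k where "k = (y - b) - (x - a)"
    have "(a - k, b + k) \<in> I" by (rule anti[OF ab]) (use k o in \<open>auto simp: k_def\<close>)
    moreover have e: "x - (a - k) = y - b" "y - (b + k) = x - a" by (auto simp: k_def)
    moreover have "n (x - (a - k)) (y - (b + k)) \<le> d x y"
      unfolding e using d n_sym[of "y - b" "x - a"] by simp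
    ultimately have "(a - k, b + k) \<in> J x y"
      by (intro J_I) (use k le e in linarith)+
    then show ?thesis by blast
  qed
qed

lemma finite_J: "finite (J x y)"
  by (rule finite_subset[OF _ fin]) (auto simp: J_def)

text \<open>Ties between nearest points are broken lexicographically; this is what makes the chosen
  point \<open>(K, M)\<close> monotone in the base point.\<close>

definition K :: "int \<Rightarrow> int \<Rightarrow> int" where "K x y = Max (fst ` J x y)"
definition M :: "int \<Rightarrow> int \<Rightarrow> int" where "M x y = Max {b. (K x y, b) \<in> J x y}"
definition N :: "int \<Rightarrow> int \<Rightarrow> int" where "N x y = K x y - M x y"

lemma finite_M: "finite {b. (a, b) \<in> J x y}"
proof (rule finite_subset)
  show "{b. (a, b) \<in> J x y} \<subseteq> snd ` J x y" by force
qed (simp add: finite_J)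

lemma KM_J: assumes "Om x y" shows "(K x y, M x y) \<in> J x y"
proof -
  have "K x y \<in> fst ` J x y"
    unfolding K_def using J_nonempty[OF assms] finite_J by (intro Max_in) auto
  then have "{b. (K x y, b) \<in> J x y} \<noteq> {}" by auto
  then have "M x y \<in> {b. (K x y, b) \<in> J x y}"
    unfolding M_def using finite_M by (intro Max_in) auto
  then show ?thesis by simp
qed

lemma K_max: "(a, b) \<in> J x y \<Longrightarrow> a \<le> K x y"
  unfolding K_def using finite_J by (intro Max_ge) force+

lemma M_max: "(K x y, b) \<in> J x y \<Longrightarrow> b \<le> M x y"
  unfolding M_def using finite_M by (intro Max_ge) auto

context
  fixes x y assumes Om: "Om x y"
begin

lemma KM_I: "(K x y, M x y) \<in> I" and M_le: "M x y \<le> y" and KM_less: "y - M x y < x - K x y"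
  and d_KM: "d x y = n (x - K x y) (y - M x y)"
  using KM_J[OF Om] by (auto simp: J_iff)

lemma Om_D: "0 \<le> y" "y < x" "odd (x + y)" using Om by (auto simp: Om_def)

lemma even_N: "even (N x y)"
  using ev[OF KM_I] by (simp add: N_def)

lemma odd_PQ: "odd (x - K x y + (y - M x y))"
  by (rule odd_offset[OF Om_D(3) ev[OF KM_I]])

lemma column_top: assumes "(K x y, b) \<in> I" "b \<le> y" shows "b \<le> M x y"
proof (rule ccontr)
  assume c: "\<not> b \<le> M x y"
  have "n (x - K x y) (y - b) \<le> d x y" unfolding d_KM by (rule n_mono) (use c assms in auto)
  then have "(K x y, b) \<in> J x y" using c assms KM_less by (intro J_I) auto
  then show False using M_max c by blast
qed

text \<open>Otherwise the reflected row \<open>- M x y\<close>, or the highest row up to y of the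
  right parity, contains a higher point of column K. The value - 1 survives only for y = 0, where
  row 0 may have the wrong parity.\<close>

lemma M_ge: "- 1 \<le> M x y" "M x y = - 1 \<Longrightarrow> y = 0"
proof -
  have "- 1 \<le> M x y \<and> (M x y = - 1 \<longrightarrow> y = 0)"
  proof (rule ccontr)
    assume c: "\<not> ?thesis"
    define b where "b = (if - M x y \<le> y then - M x y else if even (y + M x y) then y else y - 1)"
    have "(K x y, b) \<in> I"
      by (rule rect[OF KM_I]) (use c Om_D ev[OF KM_I] in \<open>auto simp: b_def\<close>)
    moreover have "b \<le> y" "M x y < b" using c Om_D by (auto simp: b_def split: if_splits)
    ultimately show False using column_top by fastforce
  qed
  then show "- 1 \<le> M x y" "M x y = - 1 \<Longrightarrow> y = 0" by auto
qed

text \<open>If K < M, swapping and \<open>anti\<close> put (K + 1, M - 1) into I; its offset is more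
  balanced, hence no longer, which contradicts the maximality of K.\<close>

lemma N_nonneg: "0 \<le> N x y"
proof (rule ccontr)
  assume "\<not> ?thesis"
  then have c: "K x y < M x y" by (simp add: N_def)
  have "(M x y, K x y) \<in> I" using I_swap KM_I by blast
  from anti[OF this, of "M x y - K x y - 1"] c have I: "(K x y + 1, M x y - 1) \<in> I" by simp
  have "K x y + 1 \<noteq> M x y" using ev[OF KM_I] by presburger
  with c have s: "y - M x y + 3 \<le> x - K x y" using Om_D by simp
  have "n (x - (K x y + 1)) (y - (M x y - 1)) \<le> d x y"
    unfolding d_KM using n_balance[of "y - M x y" 1 "x - K x y"] s by (simp add: algebra_simps)
  then have "(K x y + 1, M x y - 1) \<in> J x y" using I s M_le by (intro J_I) auto
  then show False using K_max by fastforce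
qed

lemma K_nonneg: "0 \<le> K x y"
proof (rule ccontr)
  assume c: "\<not> ?thesis"
  then have KM: "K x y = - 1" "M x y = - 1" using N_nonneg M_ge by (auto simp: N_def)
  then have y: "y = 0" using M_ge by simp
  have "(1, -1) \<in> I" using KM_I I_refl(1)[of "-1" "-1"] KM by simp
  moreover have "n (x - 1) (y - (-1)) \<le> d x y" unfolding d_KM KM by (rule n_mono) (use Om_D in auto)
  moreover have "x \<noteq> 2" using Om_D(3) y by auto
  moreover have "(0, 0) \<in> I" using rect[OF KM_I, of 0 0] by simp
  ultimately have "x < 3"
    using J_I[of 1 "-1" y x] K_max[of 1 "-1" x y] y KM by fastforce
  with \<open>x \<noteq> 2\<close> Om_D y have x: "x = 1" by simp
  have "d x y \<le> n 1 0" using d_le[OF \<open>(0, 0) \<in> I\<close>, of x y] x y by simp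
  moreover have "n 2 1 \<ge> 2" using n_ge[of 2 1] by simp
  ultimately show False using d_KM KM x y n_unit by simp
qed

text \<open>The point (K + 1, M + 1) would be strictly nearer unless M = y. Then (K + 1, M - 1) is
  no farther as soon as the horizontal offset is at least 3, against the maximality of K; by parity
  only offset 1 remains.\<close>

lemma diagonal_step: assumes "(K x y + 1, M x y + 1) \<in> I" shows "K x y = x - 1 \<and> M x y = y"
proof -
  have q: "M x y = y"
  proof (rule ccontr)
    assume "M x y \<noteq> y"
    then have "1 \<le> y - M x y" using M_le by simp
    from n_shrink[OF this, of "x - K x y"] KM_less d_le[OF assms, of x y] show False
      unfolding d_KM by (simp add: algebra_simps)
  qed
  have I: "(K x y + 1, M x y - 1) \<in> I"
    by (rule rect[OF assms]) (use q Om_D ev[OF assms] in auto)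
  have "\<not> (x - K x y \<ge> 3)"
  proof
    assume p: "x - K x y \<ge> 3"
    have "n (x - (K x y + 1)) (y - (M x y - 1)) \<le> d x y"
      unfolding d_KM using n_balance[of "y - M x y" 1 "x - K x y"] p q by (simp add: algebra_simps)
    then have "(K x y + 1, M x y - 1) \<in> J x y" using I p q by (intro J_I) auto
    then show False using K_max by fastforce
  qed
  moreover have "odd (x - K x y)" using odd_PQ q by simp
  ultimately show ?thesis using q KM_less odd_eq_1[of "x - K x y"] by simp
qed

lemma N_le: "N x y \<le> x - y - 1" using KM_less by (simp add: N_def)

text \<open>This is the contradiction used in the monotonicity proofs: no point of I lies beyond the
  nearest point in both coordinates, unless the nearest point is adjacent to the base point.\<close>

lemma dominated: assumes "(a, b) \<in> I" "K x y < a" "M x y < b"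
  shows "K x y = x - 1 \<and> M x y = y"
proof (rule diagonal_step)
  show "(K x y + 1, M x y + 1) \<in> I"
    by (rule rect[OF assms(1)]) (use assms K_nonneg M_ge ev[OF KM_I] in auto)
qed

lemma adjacent: assumes "(x - 1, y) \<in> I" shows "K x y = x - 1" "M x y = y" "N x y = x - y - 1"
proof -
  have "1 \<le> d x y" using d_ge_1 ev Om_D by blast
  then have "(x - 1, y) \<in> J x y" using assms by (intro J_I) (auto simp: n_unit)
  then have "x - 1 \<le> K x y" using K_max by blast
  then show "K x y = x - 1" "M x y = y" "N x y = x - y - 1" using KM_less M_le by (auto simp: N_def)
qed

lemma N_max_adjacent: assumes "d x y \<le> 1" shows "(x - 1, y) \<in> I"
proof -
  have "x - K x y \<le> 1" using n_ge[of "x - K x y" "y - M x y"] assms d_KM by simp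
  then have "K x y = x - 1" "M x y = y" using KM_less M_le by auto
  then show ?thesis using KM_I by simp
qed

end

end

section \<open>Monotonicity of the nearest point\<close>

context lattice_body begin

lemma K_ge:
  "\<lbrakk>(a, b) \<in> I; b \<le> y; y - b < x - a; n (x - a) (y - b) \<le> d x y\<rbrakk> \<Longrightarrow> a \<le> K x y"
  using J_I K_max by blast

lemma Om_left_up: "Om x y \<Longrightarrow> y + 1 < x - 1 \<Longrightarrow> Om (x - 1) (y + 1)"
  by (auto simp: Om_def)

lemma Om_right: "Om x y \<Longrightarrow> Om (x + 2) y"
  by (auto simp: Om_def)

lemma Om_right_up: "Om x y \<Longrightarrow> Om (x + 1) (y + 1)"
  by (auto simp: Om_def)

text \<open>Were K larger at the second base point, its nearest point could not be higher as well,
  by \<open>dominated\<close>. Two exchanges then carry its optimality back to (x, y), against the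
  maximality of \<open>K x y\<close>. A larger N is excluded by column maximality or
  domination.\<close>

lemma KM_antidiag:
  assumes O: "Om x y" and O': "Om (x - 1) (y + 1)"
  shows K_antidiag: "K (x - 1) (y + 1) \<le> K x y" and N_antidiag: "N (x - 1) (y + 1) \<le> N x y"
proof -
  define p q p' q' where "p = x - K x y" "q = y - M x y"
    "p' = x - 1 - K (x - 1) (y + 1)" "q' = y + 1 - M (x - 1) (y + 1)"
  note defs = this
  have b: "0 \<le> q" "q < p" "0 \<le> q'" "q' < p'"
    using M_le[OF O] KM_less[OF O] M_le[OF O'] KM_less[OF O'] by (auto simp: defs)
  show K: "K (x - 1) (y + 1) \<le> K x y"
  proof (rule ccontr)
    assume c: "\<not> ?thesis"
    show False
    proof (cases "M x y < M (x - 1) (y + 1)")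
      case True
      from dominated[OF O KM_I[OF O'] _ this] c b show False by (auto simp: defs)
    next
      case False
      have "n p' q' \<le> n (p - 1) (q + 1)"
        using d_le[OF KM_I[OF O], of "x - 1" "y + 1"] d_KM[OF O']
        by (simp add: defs algebra_simps)
      moreover have "n (p' + 1) (q' - 1) - n p' (q' - 1) \<le> n (p - 1 + 1) q - n (p - 1) q"
        by (rule n_increment) (use b c False in \<open>auto simp: defs\<close>)
      moreover have "n (q + 1) (p - 1) - n q (p - 1) \<le> n (q' - 1 + 1) p' - n (q' - 1) p'"
        by (rule n_increment) (use b c False in \<open>auto simp: defs\<close>)
      ultimately have "n (p' + 1) (q' - 1) \<le> n p q"
        by (simp add: n_sym[of _ "p - 1"] n_sym[of _ p'])
      then have "K (x - 1) (y + 1) \<le> K x y"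
        by (intro K_ge[OF KM_I[OF O']])
          (use b c False M_le[OF O] d_KM[OF O] in \<open>auto simp: defs algebra_simps\<close>)
      with c show False by simp
    qed
  qed
  show "N (x - 1) (y + 1) \<le> N x y"
  proof (rule ccontr)
    assume "\<not> ?thesis"
    then have c: "M (x - 1) (y + 1) < M x y" using K by (simp add: N_def)
    show False
    proof (cases "K (x - 1) (y + 1) = K x y")
      case True
      then show False using column_top[OF O', of "M x y"] KM_I[OF O] M_le[OF O] c by simp
    next
      case False
      with K have "K (x - 1) (y + 1) < K x y" by simp
      from dominated[OF O' KM_I[OF O] this c] M_le[OF O] c show False by simp
    qed
  qed
qed

lemma KN_right:
  assumes O: "Om x y"
  shows K_right: "K x y \<le> K (x + 2) y" and N_right: "N x y \<le> N (x + 2) y"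
proof -
  have O2: "Om (x + 2) y" using Om_right[OF O] .
  define p q p' q' where "p = x - K x y" "q = y - M x y"
    "p' = x - K (x + 2) y" "q' = y - M (x + 2) y"
  note defs = this
  have b: "0 \<le> q" "q < p" "0 \<le> q'" "q' < p' + 2"
    using M_le[OF O] KM_less[OF O] M_le[OF O2] KM_less[OF O2] by (auto simp: defs)
  show K: "K x y \<le> K (x + 2) y"
  proof (rule ccontr)
    assume c: "\<not> ?thesis"
    show False
    proof (cases "M (x + 2) y < M x y")
      case True
      from dominated[OF O2 KM_I[OF O] _ this] c b show False by (auto simp: defs)
    next
      case False
      have "n p q \<le> n p' q'"
        using d_le[OF KM_I[OF O2], of x y] d_KM[OF O] by (simp add: defs)
      moreover have "n (p + 2) q - n p q \<le> n (p' + 2) q' - n p' q'"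
        by (rule n_increment) (use b c False in \<open>auto simp: defs\<close>)
      ultimately have "n (p + 2) q \<le> n (p' + 2) q'" by simp
      then have "K x y \<le> K (x + 2) y"
        by (intro K_ge[OF KM_I[OF O]])
          (use b c False d_KM[OF O2] in \<open>auto simp: defs algebra_simps\<close>)
      with c show False by simp
    qed
  qed
  show "N x y \<le> N (x + 2) y"
  proof (rule ccontr)
    assume "\<not> ?thesis"
    then have c: "M x y < M (x + 2) y" using K by (simp add: N_def)
    show False
    proof (cases "K (x + 2) y = K x y")
      case True
      then show False using column_top[OF O, of "M (x + 2) y"] KM_I[OF O2] M_le[OF O2] c by simp
    next
      case False
      with K have "K x y < K (x + 2) y" by simp
      from dominated[OF O KM_I[OF O2] this c] M_le[OF O2] c show False by simp
    qed
  qed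
qed

lemma N_diag:
  assumes O: "Om x y" shows "N (x + 1) (y + 1) \<le> N x y"
proof (cases "(x, y + 1) \<in> I")
  case True
  have O1: "Om (x + 1) (y + 1)" using Om_right_up[OF O] .
  have "(x - 1, y) \<in> I" by (rule rect[OF True]) (use O in \<open>auto simp: Om_def\<close>)
  then show ?thesis using adjacent(3)[OF O] adjacent(3)[OF O1] True by simp
next
  case False
  have O1: "Om (x + 1) (y + 1)" using Om_right_up[OF O] .
  define p q p' q' where "p = x - K x y" "q = y - M x y"
    "p' = x - K (x + 1) (y + 1)" "q' = y - M (x + 1) (y + 1)"
  note defs = this
  have b: "0 \<le> q" "q < p" "0 \<le> q' + 1" "q' < p'"
    using M_le[OF O] KM_less[OF O] M_le[OF O1] KM_less[OF O1] by (auto simp: defs)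
  show ?thesis
  proof (rule ccontr)
    assume c: "\<not> ?thesis"
    then have c': "p' - q' < p - q" by (simp add: N_def defs)
    have max: False if "K x y = x - 1" "M x y = y"
      using N_le[OF O1] c that by (simp add: N_def)
    \<comment> \<open>Both offsets are measured from (x, y), so p' + q' < p + q means that the
      second nearest point has the larger coordinate sum.\<close>
    consider "p < p'" | "p = p'" | "p' < p" "q' < q" | "p' < p" "q \<le> q'" "p + q \<le> p' + q'"
      | "p' < p" "q \<le> q'" "p' + q' < p + q" by linarith
    then show False
    proof cases
      case 1
      have "K (x + 1) (y + 1) < K x y" "M (x + 1) (y + 1) < M x y"
        using 1 c' by (auto simp: defs)
      from dominated[OF O1 KM_I[OF O] this] 1 b show False by (auto simp: defs)
    next
      case 2
      then show False
        using column_top[OF O1, of "M x y"] KM_I[OF O] M_le[OF O] c' by (simp add: defs)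
    next
      case 3
      then show False
        using dominated[OF O KM_I[OF O1]] max by (simp add: defs)
    next
      case 4
      have "n (p' + 1) (q' + 1) \<le> n (p + 1) (q + 1)"
        using d_le[OF KM_I[OF O], of "x + 1" "y + 1"] d_KM[OF O1] by (simp add: defs algebra_simps)
      moreover have "n (p + 1) (q + 1) - n p q \<le> n (p' + 1) (q' + 1) - n p' q'"
        by (rule n_increment_diag) (use b c' 4 in auto)
      ultimately have "n p' q' \<le> n p q" by simp
      then have "K (x + 1) (y + 1) \<le> K x y"
        by (intro K_ge[OF KM_I[OF O1]]) (use b 4 d_KM[OF O] in \<open>auto simp: defs\<close>)
      then show False using 4 by (simp add: defs)
    next
      case 5
      \<comment> \<open>The shift reaches the row just above \<open>M x y\<close>; as the coordinate
        sums of the two points differ by at least 2, the shifted point also lies in a column beyond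
        \<open>K x y\<close>.\<close>
      define k where "k = M x y + 1 - M (x + 1) (y + 1)"
      have "p' + q' + 1 \<noteq> p + q"
        using ev[OF KM_I[OF O]] ev[OF KM_I[OF O1]] unfolding defs by presburger
      moreover have "(K (x + 1) (y + 1) - k, M (x + 1) (y + 1) + k) \<in> I"
        by (rule anti[OF KM_I[OF O1]])
          (use 5 c' N_nonneg[OF O] in \<open>auto simp: defs k_def N_def\<close>)
      ultimately show False
        using dominated[OF O, of "K (x + 1) (y + 1) - k" "M (x + 1) (y + 1) + k"] max 5
        by (simp add: defs k_def)
    qed
  qed
qed

text \<open>A smaller K with the same N means a smaller M too, so one nearest point would be
  dominated by the other.\<close>

lemma antidiag_same_nearest:
  assumes O: "Om x y" and O': "Om (x - 1) (y + 1)" and eq: "N (x - 1) (y + 1) = N x y"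
  shows "K (x - 1) (y + 1) = K x y" "M (x - 1) (y + 1) = M x y"
proof -
  show K: "K (x - 1) (y + 1) = K x y"
  proof (rule ccontr)
    assume "\<not> ?thesis"
    with KM_antidiag(1)[OF O O'] have "K (x - 1) (y + 1) < K x y" by simp
    moreover from this eq have "M (x - 1) (y + 1) < M x y" by (simp add: N_def)
    ultimately show False using dominated[OF O' KM_I[OF O]] M_le[OF O] by simp
  qed
  show "M (x - 1) (y + 1) = M x y" using K eq by (simp add: N_def)
qed

text \<open>With a common nearest point the four distances are compared at the corners of a unit
  square of offsets, where submodularity applies.\<close>

lemma d_square:
  assumes O: "Om x y" and O': "Om (x - 1) (y + 1)" and eq: "N (x - 1) (y + 1) = N x y"
  shows "d (x - 1) y + d x (y + 1) \<le> d x y + d (x - 1) (y + 1)"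
proof -
  define p q where "p = x - K x y" "q = y - M x y"
  note defs = this
  have e: "K (x - 1) (y + 1) = K x y" "M (x - 1) (y + 1) = M x y"
    using antidiag_same_nearest[OF assms] by auto
  have "d (x - 1) y \<le> n (p - 1) q" "d x (y + 1) \<le> n p (q + 1)"
    using d_le[OF KM_I[OF O], of "x - 1" y] d_le[OF KM_I[OF O], of x "y + 1"]
    by (auto simp: defs algebra_simps)
  moreover have "d x y = n p q" "d (x - 1) (y + 1) = n (p - 1) (q + 1)"
    using d_KM[OF O] d_KM[OF O', unfolded e] by (auto simp: defs algebra_simps)
  moreover have "n (p - 1) q + n (p - 1 + 1) (q + 1) \<le> n (p - 1 + 1) q + n (p - 1) (q + 1)"
    by (rule n_submodular) (use M_le[OF O] KM_less[OF O] in \<open>auto simp: defs\<close>)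
  ultimately show ?thesis by simp
qed

text \<open>This treats a nearest point in the row of the base point. With p = x - K x y, balancing
  (p, 0) into (p - 1, 1) shows that columns left of K offer nothing better to either diagonal
  neighbour on the left. The jump is 2 rather than 1 by parity.\<close>

lemma
  assumes O: "Om x y" and q: "M x y = y" and p: "3 \<le> x - K x y"
  shows antidiag_level: "K (x - 1) (y + 1) = K x y" "M (x - 1) (y + 1) = y"
      "d (x - 1) (y + 1) = n (x - K x y - 1) 1" "Om (x - 1) (y + 1)"
    and N_jump: "1 \<le> y \<Longrightarrow> N x y + 2 \<le> N (x - 1) (y - 1)"
proof -
  have e: "even (K x y + y)" using ev[OF KM_I[OF O]] q by simp
  show O': "Om (x - 1) (y + 1)"
    by (rule Om_left_up[OF O]) (use N_nonneg[OF O] p q in \<open>simp add: N_def\<close>)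
  have le: "n (x - K x y - 1) 1 \<le> n p' q'" if "x - K x y \<le> p'" for p' q'
  proof -
    have "n (x - K x y - 1) (0 + 1) \<le> n (x - K x y) 0" by (rule n_balance) (use p in auto)
    also have "\<dots> \<le> n p' q'" by (rule n_mono) (use p that in auto)
    finally show ?thesis by simp
  qed
  show K: "K (x - 1) (y + 1) = K x y"
  proof (rule ccontr)
    assume "\<not> ?thesis"
    with KM_antidiag(1)[OF O O'] have c: "K (x - 1) (y + 1) < K x y" by simp
    have "n (x - K x y - 1) 1 \<le> d (x - 1) (y + 1)"
      unfolding d_KM[OF O'] by (rule le) (use c in auto)
    then have "K x y \<le> K (x - 1) (y + 1)"
      by (intro K_ge[OF KM_I[OF O]]) (use p q in \<open>auto simp: algebra_simps\<close>)
    with c show False by simp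
  qed
  have "y \<le> M (x - 1) (y + 1)"
    by (rule column_top[OF O']) (use K KM_I[OF O] q in auto)
  moreover have "M (x - 1) (y + 1) \<noteq> y + 1"
    using ev[OF KM_I[OF O']] e unfolding K by presburger
  ultimately show M: "M (x - 1) (y + 1) = y" using M_le[OF O'] by simp
  show "d (x - 1) (y + 1) = n (x - K x y - 1) 1"
    using d_KM[OF O'] K M by (simp add: algebra_simps)
  show "N x y + 2 \<le> N (x - 1) (y - 1)" if y: "1 \<le> y"
  proof (rule ccontr)
    assume c: "\<not> ?thesis"
    have Om: "Om (x - 1) (y - 1)" using O y by (auto simp: Om_def)
    have "N (x - 1) (y - 1) \<noteq> N x y + 1" using even_N[OF O] even_N[OF Om] by presburger
    with c have "K (x - 1) (y - 1) < K x y"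
      using M_le[OF Om] q by (simp add: N_def)
    moreover have "(K x y, y - 2) \<in> I" by (rule rect[OF KM_I[OF O]]) (use q y e in auto)
    then have "K x y \<le> K (x - 1) (y - 1)"
    proof (rule K_ge)
      have "n (x - K x y - 1) 1 \<le> d (x - 1) (y - 1)"
        unfolding d_KM[OF Om] by (rule le) (use \<open>K (x - 1) (y - 1) < K x y\<close> in auto)
      then show "n (x - 1 - K x y) (y - 1 - (y - 2)) \<le> d (x - 1) (y - 1)"
        by (simp add: algebra_simps)
    qed (use p in auto)
    ultimately show False by simp
  qed
qed

text \<open>For an offset with q < p, lengthening the short entry costs at most what shortening the
  long one saves. This is why a quarter of the values of two neighbours covers half the
  demand.\<close>

lemma
  assumes O: "Om x y"
  shows d_left_up: "d (x - 1) y + d x (y + 1) \<le> 2 * d x y"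
    and d_left_down: "d (x - 1) y + d x (y - 1) \<le> 2 * d x y"
    and d_down: "M x y \<noteq> y \<Longrightarrow> d x (y - 1) \<le> d x y"
    and d_left_le: "d (x - 1) y \<le> n (x - K x y - 1) (y - M x y)"
    and d_left_less: "d (x - 1) y < d x y"
proof -
  define p q where "p = x - K x y" "q = y - M x y"
  note defs = this
  have b: "0 \<le> q" "q < p" using M_le[OF O] KM_less[OF O] by (auto simp: defs)
  have do: "d x y = n p q" using d_KM[OF O] by (simp add: defs)
  have l: "d (x - 1) y \<le> n (p - 1) q" and u: "d x (y + 1) \<le> n p (q + 1)"
    and dn: "d x (y - 1) \<le> n p (q - 1)"
    using d_le[OF KM_I[OF O], of "x - 1" y] d_le[OF KM_I[OF O], of x "y + 1"]
      d_le[OF KM_I[OF O], of x "y - 1"] by (auto simp: defs algebra_simps)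
  have "n (q + 1) p - n q p \<le> n (p - 1 + 1) q - n (p - 1) q"
    by (rule n_increment) (use b in auto)
  then have *: "n (p - 1) q + n p (q + 1) \<le> 2 * n p q"
    by (simp add: n_sym[of "q + 1"] n_sym[of q])
  with l u do show "d (x - 1) y + d x (y + 1) \<le> 2 * d x y" by simp
  have "n p (q - 1) \<le> n p (q + 1)" by (rule n_mono) (use b in auto)
  with l dn do * show "d (x - 1) y + d x (y - 1) \<le> 2 * d x y" by simp
  show "d x (y - 1) \<le> d x y" if "M x y \<noteq> y"
  proof -
    have "n p (q - 1) \<le> n p q" by (rule n_mono) (use b that in \<open>auto simp: defs\<close>)
    then show ?thesis using dn do by simp
  qed
  show "d (x - 1) y \<le> n (x - K x y - 1) (y - M x y)" using l by (simp add: defs)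
  show "d (x - 1) y < d x y"
  proof -
    \<comment> \<open>(p - 1, q) is the combination of (p, q) and (0, q) with weight 1 / p on the
      latter; strictness comes from n 0 q = q < p \<le> n p q.\<close>
    define t where "t = 1 / (of_int p :: real)"
    have t: "0 \<le> t" "0 \<le> 1 - t" "t * of_int p = 1" using b by (auto simp: t_def)
    have "n (p - 1) q \<le> (1 - t) * n p q + t * n 0 q"
      using comb_le[OF t(2,1), of "of_int p" 0 "of_int q" "of_int q"] t(3)
      by (simp add: n_def algebra_simps)
    moreover have "n 0 q < n p q"
      using n_axis[OF b(1)] n_sym[of 0 q] n_ge[of p q] b by linarith
    moreover have "0 < t" using b by (simp add: t_def)
    ultimately have "n (p - 1) q < n p q"
      by (smt (verit) mult_strict_left_mono left_diff_distrib mult_cancel_right1)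
    then show ?thesis using l do by simp
  qed
qed

text \<open>The largest minorant of \<open>N div 2\<close> that changes by at most \<open>1\<close> between consecutive points
  of an antidiagonal.\<close>

definition kap :: "int \<Rightarrow> int \<Rightarrow> int" where
  "kap x y = Min ((\<lambda>i. N (x - i) (y + i) div 2 + i) ` {0..(x - y - 1) div 2})"

lemma kap_le: "0 \<le> i \<Longrightarrow> 2 * i \<le> x - y - 1 \<Longrightarrow> kap x y \<le> N (x - i) (y + i) div 2 + i"
  unfolding kap_def by (intro Min_le) auto

lemma kap_attained:
  assumes "y < x" obtains i where "0 \<le> i" "2 * i \<le> x - y - 1" "kap x y = N (x - i) (y + i) div 2 + i"
proof -
  have "kap x y \<in> (\<lambda>i. N (x - i) (y + i) div 2 + i) ` {0..(x - y - 1) div 2}"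
    unfolding kap_def by (intro Min_in) (use assms in auto)
  then show thesis using that by auto
qed

lemma Om_shift: "Om x y \<Longrightarrow> 0 \<le> i \<Longrightarrow> 2 * i \<le> x - y - 1 \<Longrightarrow> Om (x - i) (y + i)"
  by (auto simp: Om_def)

lemma kap_le_N: "Om x y \<Longrightarrow> 2 * kap x y \<le> N x y"
  using kap_le[of 0 x y] even_N[of x y] by (auto simp: Om_def)

lemma kap_nonneg: assumes "Om x y" shows "0 \<le> kap x y"
proof -
  obtain i where i: "0 \<le> i" "2 * i \<le> x - y - 1" "kap x y = N (x - i) (y + i) div 2 + i"
    by (rule kap_attained[of y x]) (use assms in \<open>auto simp: Om_def\<close>)
  then show ?thesis using N_nonneg[OF Om_shift[OF assms i(1,2)]] by simp
qed

lemma kap_upper: assumes "Om x y" shows "2 * kap x y \<le> x - y - 1"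
  using kap_le_N[OF assms] N_le[OF assms] by simp

context
  fixes x y assumes O: "Om x y" and O': "Om (x - 1) (y + 1)"
begin

lemma kap_antidiag_le: "kap x y \<le> kap (x - 1) (y + 1) + 1"
proof -
  obtain i where i: "0 \<le> i" "2 * i \<le> (x - 1) - (y + 1) - 1"
    "kap (x - 1) (y + 1) = N (x - 1 - i) (y + 1 + i) div 2 + i"
    by (rule kap_attained[of "y + 1" "x - 1"]) (use O' in \<open>auto simp: Om_def\<close>)
  then show ?thesis using kap_le[of "i + 1" x y] by (simp add: algebra_simps)
qed

text \<open>If the minimum is attained at i > 0, the same term has index i - 1 one step further on
  and is smaller by 1. So equality forces i = 0, that is, contact of \<open>kap\<close> with N /
  2.\<close>

lemma kap_antidiag_ge: "kap (x - 1) (y + 1) \<le> kap x y"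
  and kap_antidiag_eq: "kap (x - 1) (y + 1) = kap x y \<Longrightarrow> 2 * kap x y = N x y"
proof -
  obtain i where i: "0 \<le> i" "2 * i \<le> x - y - 1" "kap x y = N (x - i) (y + i) div 2 + i"
    by (rule kap_attained[of y x]) (use O in \<open>auto simp: Om_def\<close>)
  have *: "kap (x - 1) (y + 1) < kap x y" if "i \<noteq> 0"
    using kap_le[of "i - 1" "x - 1" "y + 1"] i that by (simp add: algebra_simps)
  have **: "2 * kap x y = N x y" "kap (x - 1) (y + 1) \<le> kap x y" if "i = 0"
    using i that even_N[OF O] kap_le_N[OF O'] KM_antidiag(2)[OF O O'] by auto
  show "kap (x - 1) (y + 1) \<le> kap x y" using * ** by (cases "i = 0") auto
  show "2 * kap x y = N x y" if "kap (x - 1) (y + 1) = kap x y"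
    using * ** that by (cases "i = 0") auto
qed

lemma kap_antidiag_eq_N:
  assumes "kap (x - 1) (y + 1) = kap x y" shows "N (x - 1) (y + 1) = N x y"
  using kap_antidiag_eq[OF assms] kap_le_N[OF O'] KM_antidiag(2)[OF O O'] assms by simp

lemma kap_square:
  assumes "kap (x - 1) (y + 1) = kap x y"
  shows "d (x - 1) y + d x (y + 1) \<le> d x y + d (x - 1) (y + 1)"
  by (rule d_square[OF O O' kap_antidiag_eq_N[OF assms]])

end

text \<open>Common terms compare by \<open>N_right\<close>; an index available only for x + 2
  already exceeds (x - y - 1) / 2, the upper bound of \<open>kap x y\<close>.\<close>

lemma kap_right: assumes "Om x y" shows "kap x y \<le> kap (x + 2) y"
proof -
  obtain i where i: "0 \<le> i" "2 * i \<le> x + 2 - y - 1" "kap (x + 2) y = N (x + 2 - i) (y + i) div 2 + i"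
    by (rule kap_attained[of y "x + 2"]) (use assms in \<open>auto simp: Om_def\<close>)
  show ?thesis
  proof (cases "2 * i \<le> x - y - 1")
    case True
    have "N (x - i) (y + i) div 2 \<le> N (x - i + 2) (y + i) div 2"
      using N_right[OF Om_shift[OF assms i(1) True]] by (intro zdiv_mono1) auto
    then show ?thesis using kap_le[OF i(1) True] i(3) by (simp add: algebra_simps)
  next
    case False
    have "0 \<le> N (x + 2 - i) (y + i) div 2"
      using N_nonneg[OF Om_shift[OF Om_right[OF assms] i(1,2)]] by simp
    then show ?thesis using kap_upper[OF assms] False i(3) by simp
  qed
qed

lemma kap_diag: assumes "Om x y" shows "kap (x + 1) (y + 1) \<le> kap x y"
proof -
  obtain i where i: "0 \<le> i" "2 * i \<le> x - y - 1" "kap x y = N (x - i) (y + i) div 2 + i"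
    by (rule kap_attained[of y x]) (use assms in \<open>auto simp: Om_def\<close>)
  have "N (x - i + 1) (y + i + 1) div 2 \<le> N (x - i) (y + i) div 2"
    using N_diag[OF Om_shift[OF assms i(1,2)]] by (intro zdiv_mono1) auto
  then show ?thesis using kap_le[of i "x + 1" "y + 1"] i by (simp add: algebra_simps)
qed

text \<open>By \<open>anti\<close> all odd points on the way to the diagonal have their left
  neighbour in I, so every term of the minimum equals (x - y - 1) / 2.\<close>

lemma kap_adjacent: assumes O: "Om x y" and a: "(x - 1, y) \<in> I" shows "2 * kap x y = x - y - 1"
proof -
  obtain i where i: "0 \<le> i" "2 * i \<le> x - y - 1" "kap x y = N (x - i) (y + i) div 2 + i"
    by (rule kap_attained[of y x]) (use O in \<open>auto simp: Om_def\<close>)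
  have "(x - 1 - i, y + i) \<in> I" by (rule anti[OF a]) (use i in auto)
  then have "N (x - i) (y + i) = x - i - (y + i) - 1"
    by (intro adjacent(3)[OF Om_shift[OF O i(1,2)]]) (simp add: algebra_simps)
  then have "kap x y = (x - i - (y + i) - 1) div 2 + i" using i by simp
  then show ?thesis using O unfolding Om_def by presburger
qed

end

section \<open>The flow in a fundamental sector\<close>

context lattice_body begin

lemma origin_I: "(0, 0) \<in> I"
proof -
  obtain a b where "(a, b) \<in> I" using ne by auto
  from rect[OF this, of 0 0] show ?thesis by simp
qed

lemma kap_right_iter: "Om x y \<Longrightarrow> kap x y \<le> kap (x + 2 * int m) y"
proof (induction m)
  case (Suc m)
  then show ?case using kap_right[of "x + 2 * int m" y] by (simp add: Om_def algebra_simps)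
qed simp

lemma axis_N_upper:
  assumes O: "Om x 0" and "(a, 0) \<notin> I" "(a - 1, 1) \<notin> I" "even a" "0 < a"
  shows "N x 0 \<le> a - 2"
proof -
  have M: "M x 0 = - 1 \<or> M x 0 = 0" using M_ge[OF O] M_le[OF O] by linarith
  have "K x 0 - M x 0 < a"
  proof (rule ccontr)
    assume c: "\<not> ?thesis"
    show False
    proof (cases "M x 0 = 0")
      case True
      have "(a, 0) \<in> I" by (rule rect[OF KM_I[OF O]]) (use True c assms in auto)
      then show False using assms by simp
    next
      case False
      have "(a - 1, 1) \<in> I" by (rule rect[OF KM_I[OF O]]) (use M False c assms in auto)
      then show False using assms by simp
    qed
  qed
  moreover have "even (K x 0 - M x 0)" using even_N[OF O] by (simp add: N_def)
  ultimately show ?thesis using \<open>even a\<close> unfolding N_def by presburger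
qed

text \<open>Here a is the last even position where I reaches the axis, in (a, 0) itself or in (a -
  1, 1) and its mirror image. Just beyond it \<open>kap\<close> already has the largest value that
  \<open>axis_N_upper\<close> permits.\<close>

lemma axis_kap_attained:
  assumes "0 \<le> a" "even a" and top: "(a, 0) \<in> I \<or> (a - 1, 1) \<in> I \<and> 0 < a"
    and "(a + 2, 0) \<notin> I" "(a + 1, 1) \<notin> I"
  shows "kap (a + 1) 0 = a div 2"
proof (cases "(a, 0) \<in> I")
  case True
  have O: "Om (a + 1) 0" using assms by (simp add: Om_def)
  show ?thesis using kap_adjacent[OF O] True by simp
next
  case False
  then have T: "(a - 1, 1) \<in> I" "2 \<le> a" using assms by (auto elim!: evenE)
  have O: "Om (a + 1) 0" using assms by (simp add: Om_def)
  have T': "(a - 1, - 1) \<in> I" using I_refl(2)[OF T(1)] .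
  have up: "N (a + 1) 0 \<le> a" using axis_N_upper[OF O, of "a + 2"] assms by (simp add: add.commute)
  have M: "M (a + 1) 0 = - 1 \<or> M (a + 1) 0 = 0" using M_ge[OF O] M_le[OF O] by linarith
  have ev: "even (K (a + 1) 0 + M (a + 1) 0)" using ev[OF KM_I[OF O]] .
  have K: "a - 1 \<le> K (a + 1) 0"
  proof (rule K_ge[OF T'])
    show "n (a + 1 - (a - 1)) (0 - - 1) \<le> d (a + 1) 0"
    proof (cases "M (a + 1) 0 = 0")
      case True
      have "K (a + 1) 0 \<noteq> a" using KM_I[OF O] True False by auto
      moreover have "even (K (a + 1) 0)" "K (a + 1) 0 \<le> a"
        using up True ev by (auto simp: N_def)
      ultimately have "K (a + 1) 0 \<le> a - 2" using assms(2)
        by (cases "K (a + 1) 0 = a - 1") auto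
      then have "n 3 0 \<le> d (a + 1) 0" unfolding d_KM[OF O] True by (intro n_mono) auto
      moreover have "n (3 - 1) (0 + 1) \<le> n 3 0" by (rule n_balance) auto
      ultimately show ?thesis by simp
    next
      case False
      then have "K (a + 1) 0 \<le> a - 1" "M (a + 1) 0 = - 1" using M up by (auto simp: N_def)
      then show ?thesis unfolding d_KM[OF O] using T by (intro n_mono) auto
    qed
  qed auto
  have N: "N (a + 1) 0 = a"
  proof (cases "M (a + 1) 0 = 0")
    case True
    then have "K (a + 1) 0 \<noteq> a - 1" using ev assms(2) by presburger
    then show ?thesis using up K True by (simp add: N_def)
  qed (use M K up in \<open>auto simp: N_def\<close>)
  obtain i where i: "0 \<le> i" "2 * i \<le> a + 1 - 0 - 1"
    "kap (a + 1) 0 = N (a + 1 - i) (0 + i) div 2 + i"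
    by (rule kap_attained[of 0 "a + 1"]) (use assms in auto)
  show ?thesis
  proof (cases "i = 0")
    case True then show ?thesis using i N by simp
  next
    case False
    have "(a - 1 - (i - 1), 1 + (i - 1)) \<in> I" by (rule anti[OF T(1)]) (use False i in auto)
    then have "N (a + 1 - i) (0 + i) = a + 1 - i - i - 1"
      using adjacent(3)[OF Om_shift[OF O i(1,2)]] by (simp add: algebra_simps)
    then show ?thesis using i assms(2) by presburger
  qed
qed

text \<open>Beyond the end of I, \<open>kap\<close> on the axis has reached its bound a / 2. This
  excludes different values to the left and to the right of an even axis point, which off the axis
  is a possible pattern.\<close>

lemma axis_kap:
  assumes x: "even x" "2 \<le> x" and no: "(x, 0) \<notin> I" "(x - 1, 1) \<notin> I"
  shows "kap (x + 1) 0 \<le> kap (x - 1) 0"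
proof -
  define S where "S = {a. 0 \<le> a \<and> even a \<and> ((a, 0) \<in> I \<or> (a - 1, 1) \<in> I \<and> 0 < a)}"
  have less: "a < x" if "a \<in> S" for a
  proof (rule ccontr)
    assume c: "\<not> a < x"
    from that consider "(a, 0) \<in> I" | "(a - 1, 1) \<in> I" by (auto simp: S_def)
    then show False
    proof cases
      case 1
      from rect[OF 1, of x 0] no x c show False by auto
    next
      case 2
      from rect[OF 2, of "x - 1" 1] no x c show False by auto
    qed
  qed
  have f: "finite S" by (rule finite_subset[of _ "{0..x}"]) (use less in \<open>fastforce simp: S_def\<close>)+
  have "0 \<in> S" using origin_I by (simp add: S_def)
  define a where "a = Max S"
  have a: "a \<in> S" unfolding a_def using f \<open>0 \<in> S\<close> by (intro Max_in) auto
  have "a + 2 \<notin> S" using Max_ge[OF f, of "a + 2"] by (auto simp: a_def)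
  then have no': "(a + 2, 0) \<notin> I" "(a + 1, 1) \<notin> I" using a by (auto simp: S_def add.commute)
  have eq: "kap (a + 1) 0 = a div 2"
    by (rule axis_kap_attained) (use a no' in \<open>auto simp: S_def\<close>)
  obtain m where m: "x - 1 = a + 1 + 2 * int m"
  proof -
    have "\<exists>m\<ge>0. x - 1 = a + 1 + 2 * m"
    proof -
    have "a < x" "even x" "even a" using less[OF a] x(1) a by (auto simp: S_def)
    then show ?thesis by (intro exI[of _ "(x - 2 - a) div 2"]) presburger
  qed
    then show thesis using that nonneg_int_cases by metis
  qed
  have "a div 2 \<le> kap (x - 1) 0"
    using kap_right_iter[of "a + 1" 0 m] eq a unfolding m by (simp add: Om_def S_def)
  moreover have O: "Om (x + 1) 0" using x by (simp add: Om_def)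
  have "2 * kap (x + 1) 0 \<le> a"
    using axis_N_upper[OF O, of "a + 2"] no' a kap_le_N[OF O] by (auto simp: S_def add.commute)
  ultimately show ?thesis by linarith
qed

section \<open>The half flows and their local bounds\<close>

definition w :: "real \<Rightarrow> int \<Rightarrow> int \<Rightarrow> real" where "w c x y = max 0 (c - d x y)"

lemma w_nonneg: "0 \<le> w c x y" by (simp add: w_def)

text \<open>Where \<open>kap\<close> does not fall, N agrees at both ends and
  \<open>kap_square\<close> holds; there the upper half can use the sharp rule, elsewhere it uses
  quarters.\<close>

definition used :: "int \<Rightarrow> int \<Rightarrow> bool" where
  "used x y \<longleftrightarrow> y + 1 < x - 1 \<and> kap (x - 1) (y + 1) = kap x y"

text \<open>The lower half uses quarters where \<open>kap\<close> rises across the diagonal step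
  down to the left, or where the left neighbour lies in I, whose load is not limited.\<close>

definition leftish :: "int \<Rightarrow> int \<Rightarrow> bool" where
  "leftish x y \<longleftrightarrow> kap (x - 1) (y - 1) = kap x y + 1 \<or> (x - 1, y) \<in> I"

text \<open>The flow out of an odd point \<open>(x, y)\<close> of the sector consists of two halves: \<open>Al\<close>, \<open>Au\<close>
  go left and up, \<open>Bl\<close>, \<open>Bd\<close> go left and down, and each half carries at least \<open>w c x y / 2\<close>.
  On the axis \<open>y = 0\<close> the second half is the mirror image of the first.\<close>

definition Al :: "real \<Rightarrow> int \<Rightarrow> int \<Rightarrow> real" where
  "Al c x y = (if used x y then max 0 (w c x y - w c x (y + 1)) / 2 else w c (x - 1) y / 4)"
definition Au :: "real \<Rightarrow> int \<Rightarrow> int \<Rightarrow> real" where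
  "Au c x y = (if used x y then min (w c x y) (w c x (y + 1)) / 2 else w c x (y + 1) / 4)"
definition Bl :: "real \<Rightarrow> int \<Rightarrow> int \<Rightarrow> real" where
  "Bl c x y = (if leftish x y then w c (x - 1) y / 4 else max 0 (w c x y - w c x (y - 1)) / 2)"
definition Bd :: "real \<Rightarrow> int \<Rightarrow> int \<Rightarrow> real" where
  "Bd c x y = (if leftish x y then w c x (y - 1) / 4 else min (w c x y) (w c x (y - 1)) / 2)"

lemma AB_nonneg: "0 \<le> Al c x y" "0 \<le> Au c x y" "0 \<le> Bl c x y" "0 \<le> Bd c x y"
  using w_nonneg by (auto simp: Al_def Au_def Bl_def Bd_def)

text \<open>The sharp rules add up to exactly w / 2 because max 0 (u - v) + min u v = u; the
  quarters suffice by \<open>d_left_up\<close> and \<open>d_left_down\<close>.\<close>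

lemma demand:
  assumes "Om x y"
  shows "w c x y / 2 \<le> Al c x y + Au c x y" "w c x y / 2 \<le> Bl c x y + Bd c x y"
proof -
  have "2 * w c x y \<le> w c (x - 1) y + w c x (y + 1)" "2 * w c x y \<le> w c (x - 1) y + w c x (y - 1)"
    using d_left_up[OF assms] d_left_down[OF assms] by (auto simp: w_def max_def)
  then show "w c x y / 2 \<le> Al c x y + Au c x y" "w c x y / 2 \<le> Bl c x y + Bd c x y"
    by (auto simp: Al_def Au_def Bl_def Bd_def max_def min_def)
qed

text \<open>An odd point has d \<ge> 1, so a positive w is at most c - 1; along an edge w drops by
  at most 1, and min 1 (c - 1) \<le> c / 2.\<close>

lemma w_step:
  assumes "Om x y" "0 \<le> c"
  shows "w c x y - w c x (y + 1) \<le> c / 2" "w c x y - w c x (y - 1) \<le> c / 2"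
    "w c x y \<le> c"
proof -
  have "(x, y) \<notin> I" using ev assms(1) by (auto simp: Om_def)
  then have "1 \<le> d x y" by (rule d_ge_1)
  then show "w c x y - w c x (y + 1) \<le> c / 2" "w c x y - w c x (y - 1) \<le> c / 2"
    "w c x y \<le> c"
    using d_step(2,4)[of x y] assms(2) by (auto simp: w_def max_def)
qed

lemma w_le: "0 \<le> c \<Longrightarrow> w c x y \<le> c"
  using d_nonneg[of x y] by (simp add: w_def)

lemma capacity:
  assumes "Om x y" "0 \<le> c"
  shows "Al c x y \<le> c / 4" "Bl c x y \<le> c / 4" "Au c x y \<le> c / 2" "Bd c x y \<le> c / 2"
  using w_step[OF assms] w_le[OF assms(2), of x "y + 1"] w_le[OF assms(2), of x "y - 1"]
    w_le[OF assms(2), of "x - 1" y] assms(2)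
  by (auto simp: Al_def Au_def Bl_def Bd_def max_def)

lemma Au_less: assumes "Om x y" "0 < c" shows "Au c x y < c / 2"
proof -
  have "(x, y) \<notin> I" using ev assms(1) by (auto simp: Om_def)
  then have "1 \<le> d x y" by (rule d_ge_1)
  then show ?thesis using w_le[of c x "y + 1"] assms(2) by (auto simp: Au_def w_def)
qed

lemma Au_le: "Au c x y \<le> w c x (y + 1) / 2"
  using w_nonneg[of c x "y + 1"] by (auto simp: Au_def)

lemma half_sum_le: "P + m \<le> W \<Longrightarrow> L = P / 2 \<Longrightarrow> B \<le> m / 2 \<Longrightarrow> 2 * (L + B) \<le> W" for W :: real
  by simp

text \<open>Read a as an even point, r and u as its right and upper neighbours and e as a corner
  next to r. Then the sharp flows from r leftwards and from u downwards together bring at most half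
  of w at a.\<close>

lemma exchange_le:
  assumes "d a b + d e1 e2 \<le> d r1 r2 + d u1 u2" "d a b \<le> d r1 r2"
  shows "max 0 (w c r1 r2 - w c e1 e2) + min (w c u1 u2) (w c a b) \<le> w c a b"
  using assms by (auto simp: w_def max_def min_def)

section \<open>Load of an even point of the sector\<close>

context
  fixes x y :: int
  assumes evn: "even (x + y)" and y0: "0 \<le> y" and xy: "y + 2 \<le> x" and no: "(x, y) \<notin> I"
begin

lemma nbrs_Om: "Om (x + 1) y" "Om x (y + 1)" "Om (x - 1) y" "1 \<le> y \<Longrightarrow> Om x (y - 1)"
  using evn y0 xy by (auto simp: Om_def)

lemma kap_nbrs:
  "kap x (y + 1) \<le> kap (x - 1) y" "kap (x - 1) y \<le> kap (x + 1) y"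
  "kap x (y + 1) \<le> kap (x + 1) y" "kap (x + 1) y \<le> kap x (y + 1) + 1"
  using kap_diag[OF nbrs_Om(3)] kap_right[OF nbrs_Om(3)]
    kap_antidiag_ge[OF nbrs_Om(1)] kap_antidiag_le[OF nbrs_Om(1)] nbrs_Om(2)
  by (simp_all add: add.commute)

lemma kap_nbrs_below:
  assumes "1 \<le> y"
  shows "kap (x + 1) y \<le> kap x (y - 1)" "kap (x - 1) y \<le> kap x (y - 1)"
    "kap x (y - 1) \<le> kap (x - 1) y + 1"
  using kap_diag[OF nbrs_Om(4)[OF assms]] kap_antidiag_ge[OF nbrs_Om(4)[OF assms]]
    kap_antidiag_le[OF nbrs_Om(4)[OF assms]] nbrs_Om(3)
  by (simp_all add: add.commute)

lemma used_right: "used (x + 1) y \<longleftrightarrow> kap x (y + 1) = kap (x + 1) y"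
  using xy by (simp add: used_def)

lemma used_below: "used x (y - 1) \<longleftrightarrow> kap (x - 1) y = kap x (y - 1)"
  using xy by (simp add: used_def)

lemma leftish_right: "leftish (x + 1) y \<longleftrightarrow> kap x (y - 1) = kap (x + 1) y + 1"
  using no by (simp add: leftish_def)

lemma Bd_above: 
  shows "kap (x - 1) y = kap x (y + 1) + 1 \<Longrightarrow> Bd c x (y + 1) = w c x y / 4"
    and "kap (x - 1) y \<noteq> kap x (y + 1) + 1 \<Longrightarrow> Bd c x (y + 1) \<le> min (w c x (y + 1)) (w c x y) / 2"
proof -
  show "kap (x - 1) y = kap x (y + 1) + 1 \<Longrightarrow> Bd c x (y + 1) = w c x y / 4"
    by (simp add: Bd_def leftish_def)
  assume a: "kap (x - 1) y \<noteq> kap x (y + 1) + 1"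
  show "Bd c x (y + 1) \<le> min (w c x (y + 1)) (w c x y) / 2"
  proof (cases "(x - 1, y + 1) \<in> I")
    case True
    have "d x (y + 1) \<le> 1" using d_le[OF True, of x "y + 1"] n_unit by simp
    then have "w c x y \<le> w c x (y + 1)" using d_ge_1[OF no] by (auto simp: w_def)
    then show ?thesis using True w_nonneg[of c x y] by (simp add: Bd_def leftish_def)
  qed (use a in \<open>simp add: Bd_def leftish_def\<close>)
qed

lemma d_right: "d x y < d (x + 1) y"
  using d_left_less[OF nbrs_Om(1)] by simp

lemma right_not_level:
  assumes "M (x + 1) y = y" shows "3 \<le> x + 1 - K (x + 1) y"
proof (rule ccontr)
  assume c: "\<not> ?thesis"
  have "odd (x + 1 - K (x + 1) y)" using odd_PQ[OF nbrs_Om(1)] assms by simp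
  then have "x + 1 - K (x + 1) y = 1"
    by (rule odd_eq_1) (use KM_less[OF nbrs_Om(1)] c assms in auto)
  then show False using KM_I[OF nbrs_Om(1)] no assms by simp
qed

lemma square_right:
  assumes "used (x + 1) y"
  shows "d x y + d (x + 1) (y + 1) \<le> d (x + 1) y + d x (y + 1)"
  using kap_square[OF nbrs_Om(1)] nbrs_Om(2) assms used_right by (simp add: add.commute)

text \<open>If the nearest point lies below row y, a step down does not increase the distance, so
  the sharp rule sends everything down.\<close>

lemma Bl_right_zero:
  assumes "M (x + 1) y \<noteq> y" "\<not> leftish (x + 1) y" shows "Bl c (x + 1) y = 0"
  using d_down[OF nbrs_Om(1)] assms by (auto simp: Bl_def w_def)

text \<open>A nearest point in row y would make N jump by 2 towards (x, y - 1), where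
  \<open>used\<close> gives 2 * kap = N. Then \<open>kap\<close> would be larger there than at (x +
  1, y), although \<open>used\<close> equates it with \<open>kap (x - 1) y\<close>, which is no
  larger.\<close>

lemma Bl_right_zero':
  assumes "1 \<le> y" "used x (y - 1)" "\<not> leftish (x + 1) y" shows "Bl c (x + 1) y = 0"
proof (rule Bl_right_zero)
  show "M (x + 1) y \<noteq> y"
  proof
    assume M: "M (x + 1) y = y"
    have "N (x + 1) y + 2 \<le> N x (y - 1)"
      using N_jump[OF nbrs_Om(1) M right_not_level[OF M] assms(1)] by simp
    moreover have "2 * kap x (y - 1) = N x (y - 1)"
      using kap_antidiag_eq[OF nbrs_Om(4)[OF assms(1)]] nbrs_Om(3) assms(2) used_below by simp
    ultimately have "kap (x + 1) y + 1 \<le> kap x (y - 1)"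
      using kap_le_N[OF nbrs_Om(1)] by simp
    then show False
      using kap_nbrs kap_nbrs_below[OF assms(1)] assms(2,3) used_below leftish_right by simp
  qed
qed (use assms in auto)

lemma load_used:
  assumes y: "1 \<le> y" and u: "used (x + 1) y"
  shows "Au c x (y - 1) + Bl c (x + 1) y \<le> w c x y / 2"
    and "Bd c x (y + 1) \<le> min (w c x (y + 1)) (w c x y) / 2"
proof -
  note k = kap_nbrs kap_nbrs_below[OF y]
  show "Bd c x (y + 1) \<le> min (w c x (y + 1)) (w c x y) / 2"
    by (rule Bd_above) (use k u used_right in auto)
  show "Au c x (y - 1) + Bl c (x + 1) y \<le> w c x y / 2"
  proof (cases "used x (y - 1)")
    case True
    then have "\<not> leftish (x + 1) y" using k used_below leftish_right by auto
    then show ?thesis using Bl_right_zero'[OF y True] Au_le[of c x "y - 1"] by simp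
  next
    case False
    then have "leftish (x + 1) y" using k u used_below used_right leftish_right by auto
    then show ?thesis using False by (simp add: Au_def Bl_def)
  qed
qed

lemma load_axis_used: "y = 0 \<Longrightarrow> used (x + 1) y \<Longrightarrow> Bd c x (y + 1) \<le> min (w c x (y + 1)) (w c x y) / 2"
  by (rule Bd_above) (use kap_nbrs used_right in auto)

text \<open>If \<open>kap\<close> is k above the point, its values to the left, to the right and
  below are one of five triples. For (k, k, k): \<open>Al\<close> + \<open>Bd\<close> \<le> w / 2,
  \<open>Au\<close> \<le> w / 2, \<open>Bl\<close> = 0. For (k, k, k + 1): the same bound, and
  \<open>Au\<close>, \<open>Bl\<close> are quarters. For (k, k + 1, k + 1): \<open>Al\<close>,
  \<open>Au\<close> are quarters and \<open>Bl\<close> + \<open>Bd\<close> \<le> w / 2. For (k + 1,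
  k + 1, k + 1): \<open>Al\<close>, \<open>Bd\<close> are quarters, \<open>Au\<close> \<le> w / 2,
  \<open>Bl\<close> = 0. For (k + 1, k + 1, k + 2): four quarters.\<close>

lemma load_interior:
  assumes y: "1 \<le> y"
  shows "Au c x (y - 1) + Al c (x + 1) y + Bl c (x + 1) y + Bd c x (y + 1) \<le> w c x y"
proof (cases "used (x + 1) y")
  case True
  have "max 0 (w c (x + 1) y - w c (x + 1) (y + 1)) + min (w c x (y + 1)) (w c x y) \<le> w c x y"
    by (rule exchange_le) (use square_right[OF True] d_right in auto)
  moreover have "Al c (x + 1) y = max 0 (w c (x + 1) y - w c (x + 1) (y + 1)) / 2"
    using True by (simp add: Al_def)
  ultimately have "2 * (Al c (x + 1) y + Bd c x (y + 1)) \<le> w c x y"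
    using load_used(2)[OF y True, of c] by (rule half_sum_le)
  then show ?thesis using load_used(1)[OF y True, of c] by simp
next
  case nu: False
  note k = kap_nbrs kap_nbrs_below[OF y]
  have Al: "Al c (x + 1) y = w c x y / 4" using nu by (simp add: Al_def)
  show ?thesis
  proof (cases "used x (y - 1)")
    case True
    then have "kap (x - 1) y = kap x (y + 1) + 1" "\<not> leftish (x + 1) y"
      using k nu used_right used_below leftish_right by auto
    then show ?thesis
      using Bd_above(1)[of c] Bl_right_zero'[OF y True] Al Au_le[of c x "y - 1"] by simp
  next
    case nu': False
    then have Au: "Au c x (y - 1) = w c x y / 4" by (simp add: Au_def)
    show ?thesis
    proof (cases "leftish (x + 1) y")
      case True
      then have "kap (x - 1) y = kap x (y + 1) + 1"
        using k nu nu' used_right used_below leftish_right by auto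
      then show ?thesis using Bd_above(1)[of c] Al Au True by (simp add: Bl_def)
    next
      case False
      then have Bd: "Bd c x (y + 1) \<le> min (w c x (y + 1)) (w c x y) / 2"
        using k nu nu' used_right used_below leftish_right by (intro Bd_above(2)) auto
      show ?thesis
      proof (cases "M (x + 1) y = y")
        case M: True
        \<comment> \<open>The exchange now runs over the lower corner (x + 1, y - 1): as the nearest
          point is in row y, steps up and down give offsets of equal norm, and submodularity yields
          the square inequality.\<close>
        define p where "p = x + 1 - K (x + 1) y"
        have p: "3 \<le> p" using right_not_level[OF M] by (simp add: p_def)
        note lv = antidiag_level[OF nbrs_Om(1) M right_not_level[OF M]]
        have "d x y \<le> n (p - 1) 0" using d_left_le[OF nbrs_Om(1)] M by (simp add: p_def)
        moreover have "d (x + 1) (y - 1) \<le> n p 1"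
          using d_le[OF KM_I[OF nbrs_Om(1)], of "x + 1" "y - 1"] M n_refl(2)[of p 1]
          by (simp add: p_def)
        moreover have "d (x + 1) y = n p 0" using d_KM[OF nbrs_Om(1)] M by (simp add: p_def)
        moreover have "d x (y + 1) = n (p - 1) 1" using lv(3) by (simp add: p_def)
        moreover have "n (p - 1) 0 + n (p - 1 + 1) (0 + 1) \<le> n (p - 1 + 1) 0 + n (p - 1) (0 + 1)"
          by (rule n_submodular) (use p in auto)
        ultimately have "d x y + d (x + 1) (y - 1) \<le> d (x + 1) y + d x (y + 1)" by simp
        then have "max 0 (w c (x + 1) y - w c (x + 1) (y - 1)) + min (w c x (y + 1)) (w c x y)
            \<le> w c x y"
          by (rule exchange_le) (use d_right in auto)
        moreover have "Bl c (x + 1) y = max 0 (w c (x + 1) y - w c (x + 1) (y - 1)) / 2"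
          using False by (simp add: Bl_def)
        ultimately have "2 * (Bl c (x + 1) y + Bd c x (y + 1)) \<le> w c x y"
          using Bd by (rule half_sum_le)
        then show ?thesis using Al Au by simp
      next
        case M: False
        then show ?thesis using Bl_right_zero[OF M False] Bd Al Au w_nonneg[of c x y] by simp
      qed
    qed
  qed
qed

text \<open>The point (x, 1) counts together with its mirror image, and both halves leaving (x + 1,
  0) are of type A; hence the factors 2.\<close>

lemma load_axis:
  assumes y: "y = 0"
  shows "2 * Al c (x + 1) y + 2 * Bd c x (y + 1) \<le> w c x y"
proof (cases "used (x + 1) y")
  case True
  have "max 0 (w c (x + 1) y - w c (x + 1) (y + 1)) + min (w c x (y + 1)) (w c x y) \<le> w c x y"
    by (rule exchange_le) (use square_right[OF True] d_right in auto)
  moreover have "Al c (x + 1) y = max 0 (w c (x + 1) y - w c (x + 1) (y + 1)) / 2"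
    using True by (simp add: Al_def)
  ultimately have "2 * (Al c (x + 1) y + Bd c x (y + 1)) \<le> w c x y"
    using load_axis_used[OF y True, of c] by (rule half_sum_le)
  then show ?thesis by simp
next
  case False
  have "Bd c x (y + 1) \<le> w c x y / 4"
  proof (cases "(x - 1, 1) \<in> I")
    case True then show ?thesis using y by (simp add: Bd_def leftish_def)
  next
    case nI: False
    have "kap (x + 1) 0 \<le> kap (x - 1) 0" by (rule axis_kap) (use evn xy no y nI in auto)
    then have "kap (x - 1) y = kap x (y + 1) + 1"
      using kap_nbrs False used_right y by auto
    then show ?thesis using Bd_above(1)[of c] by simp
  qed
  then show ?thesis using False by (simp add: Al_def)
qed

end

text \<open>These quarters arrive twice, as mirror images in the diagonal, and add up to w.
  \<open>Bl\<close> vanishes since a nearest point in row h would be (h, h) itself.\<close>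

lemma load_diag:
  assumes "1 \<le> h" and no: "(h, h) \<notin> I"
  shows "Au c h (h - 1) = w c h h / 4" "Al c (h + 1) h = w c h h / 4" "Bl c (h + 1) h = 0"
proof -
  have O: "Om (h + 1) h" "Om h (h - 1)" using assms by (auto simp: Om_def)
  show "Au c h (h - 1) = w c h h / 4" "Al c (h + 1) h = w c h h / 4"
    by (auto simp: Au_def Al_def used_def)
  have "M (h + 1) h \<noteq> h"
  proof
    assume M: "M (h + 1) h = h"
    then have "K (h + 1) h = h" using N_nonneg[OF O(1)] KM_less[OF O(1)] by (simp add: N_def)
    then show False using KM_I[OF O(1)] M no by simp
  qed
  moreover have "kap (h + 1) h = 0" "kap h (h - 1) = 0"
    using kap_nonneg[OF O(1)] kap_upper[OF O(1)] kap_nonneg[OF O(2)] kap_upper[OF O(2)] by auto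
  then have "\<not> leftish (h + 1) h" using no by (simp add: leftish_def)
  ultimately show "Bl c (h + 1) h = 0" using d_down[OF O(1)] by (auto simp: Bl_def w_def)
qed

end

section \<open>The flow on the lattice and the energy gain\<close>

text \<open>The representative of a lattice point, modulo the symmetries of the square, in the sector
  \<open>0 \<le> y \<le> x\<close>.\<close>

definition can :: "int \<times> int \<Rightarrow> int \<times> int" where
  "can p = (max \<bar>fst p\<bar> \<bar>snd p\<bar>, min \<bar>fst p\<bar> \<bar>snd p\<bar>)"

definition evenp :: "int \<times> int \<Rightarrow> bool" where "evenp p \<longleftrightarrow> even (fst p + snd p)"

definition nb :: "int \<times> int \<Rightarrow> (int \<times> int) set" where
  "nb p = {(fst p - 1, snd p), (fst p + 1, snd p), (fst p, snd p - 1), (fst p, snd p + 1)}"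

lemma finite_nb: "finite (nb p)" by (simp add: nb_def)

lemma nb_sym: "a \<in> nb b \<longleftrightarrow> b \<in> nb a"
  by (cases a; cases b) (auto simp: nb_def)

lemma nb_parity: "a \<in> nb b \<Longrightarrow> evenp a \<longleftrightarrow> \<not> evenp b"
  by (auto simp: nb_def evenp_def)

lemma sum_nb: "(\<Sum>v\<in>nb (x, y). h v) = h (x - 1, y) + h (x + 1, y) + h (x, y - 1) + (h (x, y + 1) :: real)"
  by (simp add: nb_def)

lemma can_cases:
  "can (x, y) = (x, y) \<or> can (x, y) = (- x, y) \<or> can (x, y) = (x, - y) \<or> can (x, y) = (- x, - y) \<or>
   can (x, y) = (y, x) \<or> can (x, y) = (- y, x) \<or> can (x, y) = (y, - x) \<or> can (x, y) = (- y, - x)"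
  by (auto simp: can_def max_def min_def abs_if)

lemma can_refl: "can (- x, y) = can (x, y)" "can (x, - y) = can (x, y)" "can (y, x) = can (x, y)"
  by (auto simp: can_def max.commute min.commute)

lemma can_parity: "evenp (can p) \<longleftrightarrow> evenp p"
  by (auto simp: can_def evenp_def max_def min_def abs_if)

lemma can_sector: "can p = (x, y) \<Longrightarrow> 0 \<le> y \<and> y \<le> x"
  unfolding can_def by (simp only: prod.inject) linarith

lemma can_id: "0 \<le> y \<Longrightarrow> y \<le> x \<Longrightarrow> can (x, y) = (x, y)"
  by (simp add: can_def)

text \<open>The sum is invariant under the reflections generating the symmetry group of the square,
  and \<open>can p\<close> is an image of p under that group.\<close>

lemma sum_nb_can: "(\<Sum>v\<in>nb p. h (can v)) = (\<Sum>v\<in>nb (can p). h (can v) :: real)"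
proof -
  define H where "H x y = (\<Sum>v\<in>nb (x, y). h (can v))" for x y
  have r: "can (- x - 1, y) = can (x + 1, y)" "can (1 - x, y) = can (x - 1, y)"
    "can (x, - y - 1) = can (x, y + 1)" "can (x, 1 - y) = can (x, y - 1)" for x y
    using can_refl(1)[of "x + 1" y] can_refl(1)[of "x - 1" y]
      can_refl(2)[of x "y + 1"] can_refl(2)[of x "y - 1"] by simp_all
  have H: "H (- x) y = H x y" "H x (- y) = H x y" "H y x = H x y" for x y
    subgoal by (simp add: H_def sum_nb r can_refl(1,2))
    subgoal by (simp add: H_def sum_nb r can_refl(1,2))
    subgoal
      using can_refl(3)[where x = x and y = "y - 1"] can_refl(3)[where x = x and y = "y + 1"]
        can_refl(3)[where x = "x - 1" and y = y] can_refl(3)[where x = "x + 1" and y = y]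
      by (simp add: H_def sum_nb)
    done
  obtain x y where p: "p = (x, y)" by force
  show ?thesis
    using can_cases[of x y] unfolding p
    by (elim disjE) (simp_all only: H_def[symmetric] H(1,2) H(3)[where x = x and y = y])
qed

lemma can_nb: assumes "v \<in> nb (can p)" shows "\<exists>a\<in>nb p. can a = can v"
proof (rule ccontr)
  assume c: "\<not> ?thesis"
  have "(\<Sum>a\<in>nb p. of_bool (can a = can v) :: real) = (\<Sum>a\<in>nb (can p). of_bool (can a = can v))"
    by (rule sum_nb_can)
  moreover have "(\<Sum>a\<in>nb p. of_bool (can a = can v) :: real) = 0"
    using c by (intro sum.neutral) auto
  moreover have "(\<Sum>a\<in>nb (can p). of_bool (can a = can v) :: real) \<ge> of_bool (can v = can v)"
    using assms finite_nb by (intro member_le_sum) auto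
  ultimately show False by simp
qed

lemma sum_nb_interior:
  assumes "can p = (x, y)" "1 \<le> y" "y < x"
  shows "(\<Sum>v\<in>nb p. h (can v)) = h (x - 1, y) + h (x + 1, y) + h (x, y - 1) + (h (x, y + 1) :: real)"
  using assms unfolding sum_nb_can[of h p] by (simp add: sum_nb can_id)

lemma sum_nb_axis:
  assumes "can p = (x, 0)" "1 \<le> x"
  shows "(\<Sum>v\<in>nb p. h (can v)) = h (x - 1, 0) + h (x + 1, 0) + 2 * (h (x, 1) :: real)"
  using assms can_refl(2)[of x 1] unfolding sum_nb_can[of h p] by (simp add: sum_nb can_id)

lemma sum_nb_diag:
  assumes "can p = (x, x)" "1 \<le> x"
  shows "(\<Sum>v\<in>nb p. h (can v)) = 2 * h (x, x - 1) + 2 * (h (x + 1, x) :: real)"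
  using assms can_refl(3)[of "x - 1" x] can_refl(3)[of x "x + 1"]
  unfolding sum_nb_can[of h p] by (simp add: sum_nb can_id)

section \<open>The flow and the duality gap on the whole lattice\<close>

context lattice_body begin

definition dd :: "int \<times> int \<Rightarrow> real" where "dd p = d (fst p) (snd p)"
definition ww :: "real \<Rightarrow> int \<times> int \<Rightarrow> real" where "ww c p = max 0 (c - dd p)"

lemma dd_can: "can p = (x, y) \<Longrightarrow> dd p = d x y"
  using can_cases[of "fst p" "snd p"] d_swap[of "fst p" "snd p"]
  by (auto simp: dd_def d_refl)

lemma ww_can: "can p = (x, y) \<Longrightarrow> ww c p = w c x y"
  by (simp add: ww_def w_def dd_can)

lemma I_can: assumes "can p = (x, y)" shows "(x, y) \<in> I \<longleftrightarrow> p \<in> I"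
proof -
  have d0: "(a, b) \<in> I \<longleftrightarrow> d a b = 0" for a b using d_in[of a b] d_ge_1[of a b] by fastforce
  show ?thesis using dd_can[OF assms] d0 by (cases p) (simp add: dd_def)
qed

lemma odd_can_Om: "\<not> evenp p \<Longrightarrow> can p = (x, y) \<Longrightarrow> Om x y"
  using can_parity[of p] can_sector[of p x y] unfolding Om_def evenp_def
  by (cases "x = y") auto

text \<open>\<open>F c p a\<close> is the flow from the odd point \<open>p\<close> to its neighbour \<open>a\<close>.\<close>

definition G :: "real \<Rightarrow> int \<times> int \<Rightarrow> int \<times> int \<Rightarrow> real" where
  "G c = (\<lambda>(x, y) v.
     if v = (x - 1, y) then if y = 0 then 2 * Al c x y else Al c x y + Bl c x y
     else if v = (x, y + 1) then Au c x y
     else if v = (x, y - 1) then Bd c x y else 0)"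

definition F :: "real \<Rightarrow> int \<times> int \<Rightarrow> int \<times> int \<Rightarrow> real" where
  "F c p a = G c (can p) (can a)"

lemma F_nonneg: "0 \<le> F c p a"
  by (auto simp: F_def G_def AB_nonneg add_nonneg_nonneg split: prod.split)

lemma F_cap:
  assumes "\<not> evenp p" "0 \<le> c" shows "F c p a \<le> c / 2"
proof -
  obtain x y where xy: "can p = (x, y)" by force
  show ?thesis
    using capacity[OF odd_can_Om[OF assms(1) xy] assms(2)] assms(2) by (auto simp: F_def G_def xy)
qed

lemma F_out:
  assumes xy: "can p = (x, y)"
  shows "y = 0 \<Longrightarrow> 1 \<le> x \<Longrightarrow> (\<Sum>a\<in>nb p. F c p a) = 2 * Al c x y + 2 * Au c x y"
    and "1 \<le> y \<Longrightarrow> y < x \<Longrightarrow> (\<Sum>a\<in>nb p. F c p a) = Al c x y + Au c x y + Bl c x y + Bd c x y"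
  unfolding F_def
  subgoal using sum_nb_axis[of p x "G c (can p)"] xy by (simp add: G_def)
  subgoal using sum_nb_interior[of p x y "G c (can p)"] xy by (simp add: G_def)
  done

lemma F_demand:
  assumes "\<not> evenp p" shows "ww c p \<le> (\<Sum>a\<in>nb p. F c p a)"
proof -
  obtain x y where xy: "can p = (x, y)" by force
  have O: "Om x y" by (rule odd_can_Om[OF assms xy])
  show ?thesis
    using demand[OF O, of c] F_out[OF xy, of c] O ww_can[OF xy, of c]
    by (cases "y = 0") (auto simp: Om_def)
qed

lemma F_load:
  assumes a: "evenp a" "a \<notin> I" shows "(\<Sum>p\<in>nb a. F c p a) \<le> ww c a"
proof -
  obtain x y where xy: "can a = (x, y)" by force
  have s: "0 \<le> y" "y \<le> x" "even (x + y)" "(x, y) \<notin> I"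
    using can_sector[OF xy] can_parity[of a] a I_can[OF xy] by (auto simp: xy evenp_def)
  have "(x, y) \<noteq> (0, 0)" using s origin_I by metis
  consider "y = x" "1 \<le> x" | "y = 0" "y + 2 \<le> x" | "1 \<le> y" "y + 2 \<le> x"
    using s \<open>(x, y) \<noteq> (0, 0)\<close> by (cases "y = x"; cases "y = x - 1"; cases "y = 0") auto
  then show ?thesis
  proof cases
    case 1
    then show ?thesis
      unfolding F_def using sum_nb_diag[of a x "\<lambda>p. G c p (can a)"] load_diag[of x c] s
      by (simp add: xy G_def ww_can[OF xy])
  next
    case 2
    then show ?thesis
      unfolding F_def using sum_nb_axis[of a x "\<lambda>p. G c p (can a)"] load_axis[of x y c] s
      by (simp add: xy G_def ww_can[OF xy])
  next
    case 3
    then show ?thesis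
      unfolding F_def using sum_nb_interior[of a x y "\<lambda>p. G c p (can a)"] load_interior[of x y c] s
      by (simp add: xy G_def ww_can[OF xy])
  qed
qed

text \<open>At distance 1 the left neighbour lies in I and \<open>kap\<close> is (x - y - 1) / 2, a
  value out of reach one step up the antidiagonal.\<close>

lemma used_d_gt_1: assumes O: "Om x y" and u: "used x y" shows "1 < d x y"
proof (rule ccontr)
  assume "\<not> ?thesis"
  then have a: "(x - 1, y) \<in> I" using N_max_adjacent[OF O] by simp
  have O': "Om (x - 1) (y + 1)" using O u by (auto simp: used_def Om_def)
  show False using kap_adjacent[OF O a] kap_upper[OF O'] u by (simp add: used_def)
qed

text \<open>With \<open>c = 4 / \<alpha>\<close>, the energy of a finite set \<open>X\<close> containing \<open>I\<close> is
  \<open>- \<alpha> * gain c X - 4 * card I\<close>.\<close>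

definition edges :: "(int \<times> int) set \<Rightarrow> ((int \<times> int) \<times> (int \<times> int)) set" where
  "edges X = (SIGMA p:{p \<in> X. \<not> evenp p}. nb p \<inter> X)"

definition gain :: "real \<Rightarrow> (int \<times> int) set \<Rightarrow> real" where
  "gain c X = (\<Sum>v\<in>X - I. c - dd v) - c / 2 * card (edges X)"

lemma I_even: "p \<in> I \<Longrightarrow> evenp p"
  using ev by (cases p) (auto simp: evenp_def)

context
  fixes X B :: "(int \<times> int) set"
  assumes fX: "finite X" and IX: "I \<subseteq> X" and fB: "finite B"
    and B_even: "\<And>v. v \<in> B \<Longrightarrow> evenp v \<and> v \<notin> I"
    and XB: "\<And>v. v \<in> X - I \<Longrightarrow> evenp v \<Longrightarrow> v \<in> B"
    and nbB: "\<And>p v. p \<in> X \<Longrightarrow> \<not> evenp p \<Longrightarrow> v \<in> nb p - X \<Longrightarrow> v \<in> B"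
begin

lemma gain_identity:
  "(\<Sum>v\<in>B. ww c v) - gain c X =
     (\<Sum>v\<in>{v \<in> X - I. evenp v}. ww c v - (c - dd v)) +
     (\<Sum>v\<in>B - X. ww c v - (\<Sum>p\<in>{p \<in> X. \<not> evenp p} \<inter> nb v. F c p v)) +
     (\<Sum>p\<in>{p \<in> X. \<not> evenp p}. (\<Sum>v\<in>nb p. F c p v) - (c - dd p)) +
     (\<Sum>(p, v)\<in>edges X. c / 2 - F c p v)"
proof -
  define D where "D = {p \<in> X. \<not> evenp p}"
  define A where "A = {v \<in> X - I. evenp v}"
  have fin: "finite D" "finite A" using fX by (auto simp: D_def A_def)
  have "X - I = A \<union> D" using I_even by (auto simp: A_def D_def)
  moreover have "A \<inter> D = {}" by (auto simp: A_def D_def)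
  ultimately have 1: "(\<Sum>v\<in>X - I. c - dd v) = (\<Sum>v\<in>A. c - dd v) + (\<Sum>v\<in>D. c - dd v)"
    using fin by (simp only: sum.union_disjoint)
  have B: "B = A \<union> (B - X)" using XB B_even unfolding A_def by blast
  have "(\<Sum>v\<in>A \<union> (B - X). ww c v) = (\<Sum>v\<in>A. ww c v) + (\<Sum>v\<in>B - X. ww c v)"
    using fin fB by (intro sum.union_disjoint) (auto simp: A_def)
  then have 2: "(\<Sum>v\<in>B. ww c v) = (\<Sum>v\<in>A. ww c v) + (\<Sum>v\<in>B - X. ww c v)"
    using B by simp
  have "(\<Sum>p\<in>D. \<Sum>v\<in>nb p. F c p v) = (\<Sum>p\<in>D. (\<Sum>v\<in>nb p \<inter> X. F c p v) + (\<Sum>v\<in>nb p - X. F c p v))"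
    by (intro sum.cong refl sum.Int_Diff finite_nb)
  also have "\<dots> = (\<Sum>p\<in>D. \<Sum>v\<in>nb p \<inter> X. F c p v) + (\<Sum>p\<in>D. \<Sum>v\<in>nb p - X. F c p v)"
    by (rule sum.distrib)
  also have "(\<Sum>p\<in>D. \<Sum>v\<in>nb p \<inter> X. F c p v) = (\<Sum>(p, v)\<in>edges X. F c p v)"
    unfolding edges_def D_def[symmetric] using fin finite_nb by (subst sum.Sigma) auto
  also have "(\<Sum>p\<in>D. \<Sum>v\<in>nb p - X. F c p v) = (\<Sum>p\<in>D. \<Sum>v\<in>{v \<in> B - X. v \<in> nb p}. F c p v)"
    by (intro sum.cong refl) (use nbB in \<open>auto simp: D_def\<close>)
  also have "\<dots> = (\<Sum>v\<in>B - X. \<Sum>p\<in>{p \<in> D. v \<in> nb p}. F c p v)"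
    using fin fB by (intro sum.swap_restrict) auto
  also have "\<dots> = (\<Sum>v\<in>B - X. \<Sum>p\<in>D \<inter> nb v. F c p v)"
    by (intro sum.cong refl) (use nb_sym in auto)
  finally have 3: "(\<Sum>p\<in>D. \<Sum>v\<in>nb p. F c p v) =
    (\<Sum>(p, v)\<in>edges X. F c p v) + (\<Sum>v\<in>B - X. \<Sum>p\<in>D \<inter> nb v. F c p v)" .
  have 4: "(\<Sum>(p, v)\<in>edges X. c / 2 - F c p v) = c / 2 * card (edges X) - (\<Sum>(p, v)\<in>edges X. F c p v)"
    by (simp add: sum_subtractf split_beta)
  show ?thesis
    unfolding gain_def D_def[symmetric] A_def[symmetric] 4 1 2 using 3
    by (simp add: sum_subtractf)
qed

lemma slack_nonneg:
  assumes "0 \<le> c"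
  shows "\<And>v. 0 \<le> ww c v - (c - dd v)"
    "\<And>v. v \<in> B - X \<Longrightarrow> 0 \<le> ww c v - (\<Sum>p\<in>{p \<in> X. \<not> evenp p} \<inter> nb v. F c p v)"
    "\<And>p. p \<in> {p \<in> X. \<not> evenp p} \<Longrightarrow> 0 \<le> (\<Sum>v\<in>nb p. F c p v) - (c - dd p)"
    "\<And>e. e \<in> edges X \<Longrightarrow> 0 \<le> c / 2 - F c (fst e) (snd e)"
proof -
  show "0 \<le> ww c v - (c - dd v)" for v by (simp add: ww_def)
  show "0 \<le> ww c v - (\<Sum>p\<in>{p \<in> X. \<not> evenp p} \<inter> nb v. F c p v)" if "v \<in> B - X" for v
  proof -
    have "(\<Sum>p\<in>{p \<in> X. \<not> evenp p} \<inter> nb v. F c p v) \<le> (\<Sum>p\<in>nb v. F c p v)"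
      by (rule sum_mono2) (auto simp: finite_nb F_nonneg)
    also have "\<dots> \<le> ww c v" using that B_even by (intro F_load) auto
    finally show ?thesis by simp
  qed
  show "0 \<le> (\<Sum>v\<in>nb p. F c p v) - (c - dd p)" if "p \<in> {p \<in> X. \<not> evenp p}" for p
    using F_demand[of p c] that by (simp add: ww_def)
  show "0 \<le> c / 2 - F c (fst e) (snd e)" if "e \<in> edges X" for e
    using F_cap[OF _ assms] that by (auto simp: edges_def)
qed

lemma gain_le: assumes "0 \<le> c" shows "gain c X \<le> (\<Sum>v\<in>B. ww c v)"
proof -
  have "0 \<le> (\<Sum>v\<in>B. ww c v) - gain c X"
    unfolding gain_identity split_beta
    by (intro add_nonneg_nonneg sum_nonneg slack_nonneg[OF assms])
  then show ?thesis by simp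
qed

text \<open>Complementary slackness: nonnegative slacks with vanishing sum vanish one by
  one.\<close>

lemma gain_eqD:
  assumes c: "0 \<le> c" and eq: "gain c X = (\<Sum>v\<in>B. ww c v)"
  shows "\<And>v. v \<in> X - I \<Longrightarrow> evenp v \<Longrightarrow> ww c v = c - dd v"
    "\<And>v. v \<in> B - X \<Longrightarrow> ww c v = (\<Sum>p\<in>{p \<in> X. \<not> evenp p} \<inter> nb v. F c p v)"
    "\<And>p. p \<in> X \<Longrightarrow> \<not> evenp p \<Longrightarrow> (\<Sum>v\<in>nb p. F c p v) = c - dd p"
    "\<And>p v. p \<in> X \<Longrightarrow> \<not> evenp p \<Longrightarrow> v \<in> nb p \<inter> X \<Longrightarrow> F c p v = c / 2"
proof -
  define s1 s2 s3 s4 where "s1 v = ww c v - (c - dd v)"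
    and "s2 v = ww c v - (\<Sum>p\<in>{p \<in> X. \<not> evenp p} \<inter> nb v. F c p v)"
    and "s3 p = (\<Sum>v\<in>nb p. F c p v) - (c - dd p)"
    and "s4 e = c / 2 - F c (fst e) (snd e)" for v p and e :: "(int \<times> int) \<times> (int \<times> int)"
  have nn: "\<And>v. v \<in> {v \<in> X - I. evenp v} \<Longrightarrow> 0 \<le> s1 v" "\<And>v. v \<in> B - X \<Longrightarrow> 0 \<le> s2 v"
    "\<And>p. p \<in> {p \<in> X. \<not> evenp p} \<Longrightarrow> 0 \<le> s3 p" "\<And>e. e \<in> edges X \<Longrightarrow> 0 \<le> s4 e"
    using slack_nonneg[OF c] by (auto simp: s1_def s2_def s3_def s4_def)
  have fe: "finite (edges X)" unfolding edges_def using fX finite_nb by (intro finite_SigmaI) auto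
  have "sum s1 {v \<in> X - I. evenp v} + sum s2 (B - X) + sum s3 {p \<in> X. \<not> evenp p} + sum s4 (edges X) = 0"
    using gain_identity[of c] eq unfolding s1_def s2_def s3_def s4_def split_beta by simp
  moreover have "0 \<le> sum s1 {v \<in> X - I. evenp v}" "0 \<le> sum s2 (B - X)"
    "0 \<le> sum s3 {p \<in> X. \<not> evenp p}" "0 \<le> sum s4 (edges X)"
    using nn by (auto intro!: sum_nonneg)
  ultimately have z: "sum s1 {v \<in> X - I. evenp v} = 0" "sum s2 (B - X) = 0"
    "sum s3 {p \<in> X. \<not> evenp p} = 0" "sum s4 (edges X) = 0" by linarith+
  have "\<forall>v\<in>{v \<in> X - I. evenp v}. s1 v = 0" "\<forall>v\<in>B - X. s2 v = 0"
    "\<forall>p\<in>{p \<in> X. \<not> evenp p}. s3 p = 0" "\<forall>e\<in>edges X. s4 e = 0"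
    using z nn fX fB fe by (subst sum_nonneg_eq_0_iff[symmetric]; simp)+
  then show "\<And>v. v \<in> X - I \<Longrightarrow> evenp v \<Longrightarrow> ww c v = c - dd v"
    "\<And>v. v \<in> B - X \<Longrightarrow> ww c v = (\<Sum>p\<in>{p \<in> X. \<not> evenp p} \<inter> nb v. F c p v)"
    "\<And>p. p \<in> X \<Longrightarrow> \<not> evenp p \<Longrightarrow> (\<Sum>v\<in>nb p. F c p v) = c - dd p"
    "\<And>p v. p \<in> X \<Longrightarrow> \<not> evenp p \<Longrightarrow> v \<in> nb p \<inter> X \<Longrightarrow> F c p v = c / 2"
    by (auto simp: s1_def s2_def s3_def s4_def edges_def)
qed

text \<open>Away from the values of \<open>dd\<close> on \<open>B\<close> both sides of the inequality are affine in \<open>c\<close>, so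
  equality propagates to a neighbourhood of \<open>c\<close>.\<close>

lemma gain_eq_nearby:
  assumes c: "0 < c" and eq: "gain c X = (\<Sum>v\<in>B. ww c v)" and nc: "\<And>v. v \<in> B \<Longrightarrow> dd v \<noteq> c"
  obtains c' where "c < c'" "gain c' X = (\<Sum>v\<in>B. ww c' v)"
proof -
  \<comment> \<open>Half the distance of c from 0 and from the values of \<open>dd\<close> on B:
    within it no sign of c - dd changes and the parameter stays positive.\<close>
  define \<delta> where "\<delta> = Min (insert c ((\<lambda>v. \<bar>dd v - c\<bar>) ` B)) / 2"
  have "0 < Min (insert c ((\<lambda>v. \<bar>dd v - c\<bar>) ` B))" using fB c nc by (subst Min_gr_iff) auto
  then have \<delta>: "0 < \<delta>" by (simp add: \<delta>_def)
  have "Min (insert c ((\<lambda>v. \<bar>dd v - c\<bar>) ` B)) \<le> c" using fB by simp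
  then have \<delta>c: "\<delta> < c" using c \<delta> by (simp add: \<delta>_def)
  have \<delta>B: "\<delta> < \<bar>dd v - c\<bar>" if "v \<in> B" for v
  proof -
    have "Min (insert c ((\<lambda>v. \<bar>dd v - c\<bar>) ` B)) \<le> \<bar>dd v - c\<bar>" using fB that by simp
    then show ?thesis using \<delta> by (simp add: \<delta>_def)
  qed
  define m where "m = real (card {v \<in> B. dd v < c})"
  have aff1: "(\<Sum>v\<in>B. ww (c + t) v) = (\<Sum>v\<in>B. ww c v) + t * m" if "\<bar>t\<bar> \<le> \<delta>" for t
  proof -
    have "(\<Sum>v\<in>B. ww (c + t) v) = (\<Sum>v\<in>B. ww c v + t * of_bool (dd v < c))"
    proof (rule sum.cong)
      fix v assume "v \<in> B"
      from \<delta>B[OF this] that show "ww (c + t) v = ww c v + t * of_bool (dd v < c)"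
        by (auto simp: ww_def max_def)
    qed simp
    also have "\<dots> = (\<Sum>v\<in>B. ww c v) + t * (\<Sum>v\<in>B. of_bool (dd v < c))"
      by (simp add: sum.distrib sum_distrib_left)
    also have "(\<Sum>v\<in>B. of_bool (dd v < c)) = m"
      using fB by (simp add: m_def sum.If_cases Int_def of_bool_def)
    finally show ?thesis .
  qed
  define s where "s = card (X - I) - card (edges X) / 2"
  have aff2: "gain (c + t) X = gain c X + t * s" for t
    by (simp add: gain_def s_def sum.distrib sum_subtractf algebra_simps add_divide_distrib)
  \<comment> \<open>Two affine functions that agree at c and are ordered on both sides of it have
    the same slope.\<close>
  have "t * s \<le> t * m" if "\<bar>t\<bar> \<le> \<delta>" for t
    using gain_le[of "c + t"] aff1[OF that] aff2[of t] eq that \<delta>c by (simp add: abs_le_iff)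
  from this[of \<delta>] this[of "- \<delta>"] \<delta> have "s = m" by (simp add: mult_le_cancel_left)
  then show thesis using that[of "c + \<delta>"] aff1[of \<delta>] aff2[of \<delta>] eq \<delta> by simp
qed

text \<open>All slacks vanish at c and at some c' > c. At the odd point q of X with the
  lexicographically largest representative (x, y) few sources of flow remain, and the forced flow
  values are incompatible for the two parameters.\<close>

lemma gain_eq_no_odd:
  assumes c: "0 < c" and eq: "gain c X = (\<Sum>v\<in>B. ww c v)" and nc: "\<And>v. v \<in> B \<Longrightarrow> dd v \<noteq> c"
    and p: "p \<in> X"
  shows "evenp p"
proof (rule ccontr)
  define Od where "Od = {p \<in> X. \<not> evenp p}"
  assume "\<not> evenp p"
  with p have "p \<in> Od" by (simp add: Od_def)
  moreover have "finite Od" using fX by (simp add: Od_def)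
  ultimately have Od: "Od \<noteq> {}" "finite Od" by auto
  obtain c' where c': "c < c'" "gain c' X = (\<Sum>v\<in>B. ww c' v)"
    by (rule gain_eq_nearby[OF c eq nc])
  define C where "C e \<longleftrightarrow> e = c \<or> e = c'" for e
  have Cpos: "C e \<Longrightarrow> 0 < e" for e using c c' by (auto simp: C_def)
  have CC: "C c" "C c'" by (auto simp: C_def)
  have gD: "C e \<Longrightarrow> gain e X = (\<Sum>v\<in>B. ww e v)" for e using eq c' by (auto simp: C_def)
  have load: "ww e v = (\<Sum>p\<in>Od \<inter> nb v. F e p v)" if "C e" "v \<in> B - X" for e v
    using gain_eqD(2)[OF less_imp_le[OF Cpos] gD] that by (simp add: Od_def)
  have out: "(\<Sum>v\<in>nb p. F e p v) = e - dd p" if "C e" "p \<in> Od" for e p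
    using gain_eqD(3)[OF less_imp_le[OF Cpos] gD] that by (simp add: Od_def)
  have cap: "F e p v = e / 2" if "C e" "p \<in> Od" "v \<in> nb p" "v \<in> X" for e p v
    using gain_eqD(4)[OF less_imp_le[OF Cpos] gD] that by (simp add: Od_def)
  define mx where "mx = Max ((fst \<circ> can) ` Od)"
  define Od' where "Od' = {p \<in> Od. fst (can p) = mx}"
  have "mx \<in> (fst \<circ> can) ` Od" unfolding mx_def using Od by (intro Max_in) auto
  then have Od': "Od' \<noteq> {}" "finite Od'" using Od by (auto simp: Od'_def)
  define my where "my = Max ((snd \<circ> can) ` Od')"
  have "my \<in> (snd \<circ> can) ` Od'" unfolding my_def using Od' by (intro Max_in) auto
  then obtain q where q: "q \<in> Od'" "snd (can q) = my" by auto
  have le_mx: "fst (can p) \<le> mx" if "p \<in> Od" for p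
    unfolding mx_def using Od that by (intro Max_ge) auto
  have le_my: "snd (can p) \<le> my" if "p \<in> Od'" for p
    unfolding my_def using Od' that by (intro Max_ge) auto
  obtain x y where xy: "can q = (x, y)" by force
  have qx: "q \<in> Od" "mx = x" "my = y" using q xy by (auto simp: Od'_def)
  have lex: "fst (can p) < x \<or> fst (can p) = x \<and> snd (can p) \<le> y" if "p \<in> Od" for p
    using le_mx[OF that] le_my[of p] that qx by (auto simp: Od'_def)
  have O: "Om x y" using odd_can_Om[OF _ xy] qx(1) by (simp add: Od_def)
  then have y: "0 \<le> y" "y < x" "odd (x + y)" by (auto simp: Om_def)
  have qX: "q \<in> X" "\<not> evenp q" using qx(1) by (auto simp: Od_def)
  have dq: "dd q = d x y" using dd_can[OF xy] .
  have dle: "d x y \<le> e" if "C e" for e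
  proof -
    have "0 \<le> (\<Sum>v\<in>nb q. F e q v)" by (intro sum_nonneg F_nonneg)
    then show ?thesis using out[OF that qx(1)] dq by simp
  qed
  have wq: "w e x y = e - d x y" if "C e" for e using dle[OF that] by (simp add: w_def)
  have toB: "v \<in> B" "v \<notin> I" if "v \<in> nb q" "v \<notin> X" for v
    using that nbB[OF qX] IX by auto

  \<comment> \<open>The edge upwards is never full, so the upper neighbour is outside X and must be
    saturated by the flow from X. Only points equivalent to q can send it anything, at most half its
    value in all, so that value is 0.\<close>
  have wu: "w e x (y + 1) = 0" if e: "C e" for e
  proof -
    obtain u where u: "u \<in> nb q" "can u = (x, y + 1)"
      using can_nb[of "(x, y + 1)" q] xy y by (auto simp: nb_def can_id)
    have "F e q u = Au e x y" by (simp add: F_def G_def xy u(2))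
    then have "u \<notin> X" using cap[OF e qx(1) u(1)] Au_less[OF O Cpos[OF e]] by auto
    then have uB: "u \<in> B - X" using toB u by auto
    define h where "h = (\<lambda>v. if fst v < x \<or> fst v = x \<and> snd v \<le> y then G e v (x, y + 1) else 0)"
    have "w e x (y + 1) = (\<Sum>p\<in>Od \<inter> nb u. F e p u)"
      using load[OF e uB] ww_can[OF u(2)] by simp
    also have "\<dots> = (\<Sum>p\<in>Od \<inter> nb u. h (can p))"
      by (intro sum.cong) (use lex in \<open>auto simp: F_def h_def u(2)\<close>)
    also have "\<dots> \<le> (\<Sum>p\<in>nb u. h (can p))"
      by (rule sum_mono2)
        (use F_nonneg in \<open>auto simp: finite_nb h_def G_def AB_nonneg add_nonneg_nonneg split: prod.split\<close>)
    also have "\<dots> \<le> w e x (y + 1) / 2"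
    proof (cases "y + 1 = x")
      case True
      then have "Au e x y = w e x (y + 1) / 4" by (simp add: Au_def used_def)
      moreover have "h (x, x - 1) = Au e x y" using True by (auto simp: h_def G_def)
      moreover have "h (x + 1, x) = 0" by (simp add: h_def)
      ultimately show ?thesis using sum_nb_diag[of u x h] u(2) y True by simp
    next
      case False
      have "h (x - 1, y + 1) = 0" "h (x + 1, y + 1) = 0" "h (x, 2 + y) = 0" "h (x, y) = Au e x y"
        by (auto simp: h_def G_def)
      then show ?thesis
        using sum_nb_interior[of u x "y + 1" h] u(2) y False Au_le[of e x y] by simp
    qed
    finally show ?thesis using w_nonneg[of e x "y + 1"] by simp
  qed
  have Au: "Au e x y = 0" if "C e" for e
    using wu[OF that] w_nonneg[of e x y] by (simp add: Au_def)
  have AB: "Al e x y = (e - d x y) / 2" "1 \<le> y \<Longrightarrow> Bl e x y + Bd e x y = (e - d x y) / 2"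
    if e: "C e" for e
    using demand[OF O, of e] wq[OF e] Au[OF e] out[OF e qx(1)] dq F_out[OF xy, of e] y
    by (cases "y = 0"; simp)+
  show False
  proof (cases "used x y")
    case False
    \<comment> \<open>The value of the left neighbour would grow at rate 2 in the parameter, but its
      slope is at most 1.\<close>
    then have wl: "w e (x - 1) y = 2 * (e - d x y)" if "C e" for e
      using AB(1)[OF that] by (simp add: Al_def)
    have "w c' (x - 1) y \<le> w c (x - 1) y + (c' - c)" using c' by (auto simp: w_def)
    then show False using wl[OF CC(1)] wl[OF CC(2)] c'(1) by simp
  next
    case u: True
    then have xy3: "y + 1 < x - 1" by (simp add: used_def)
    obtain a where a: "a \<in> nb q" "can a = (x - 1, y)"
      using can_nb[of "(x - 1, y)" q] xy y by (auto simp: nb_def can_id)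
    have dl: "d (x - 1) y < d x y" by (rule d_left_less[OF O])
    show False
    proof (cases "a \<in> X")
      case aX: True
      \<comment> \<open>A full edge carries e / 2. On the axis this reads e - d x y = e / 2 for two
        values of e; off the axis it makes \<open>Bl\<close> independent of e.\<close>
      have Fa: "(if y = 0 then 2 * Al e x y else Al e x y + Bl e x y) = e / 2" if "C e" for e
        using cap[OF that qx(1) a(1) aX] by (simp add: F_def G_def xy a(2))
      show False
      proof (cases "y = 0")
        case True
        then show False using Fa[OF CC(1)] Fa[OF CC(2)] AB(1)[OF CC(1)] AB(1)[OF CC(2)] c'(1) by simp
      next
        case y0: False
        then have Bl: "Bl e x y = d x y / 2" if "C e" for e
          using Fa[OF that] AB(1)[OF that] by (simp add: field_simps)
        show False
        proof (cases "leftish x y")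
          case True
          then have wl: "w e (x - 1) y = 2 * d x y" if "C e" for e
            using Bl[OF that] by (simp add: Bl_def)
          have "w e (x - 1) y = e - d (x - 1) y" if "C e" for e
            using dle[OF that] dl by (simp add: w_def)
          then show False using wl[OF CC(1)] wl[OF CC(2)] CC c'(1) by simp
        next
          case False
          have "max 0 (w c x y - w c x (y - 1)) \<le> 1" using d_step(4)[of x y] by (auto simp: w_def)
          then show False using Bl[OF CC(1)] False used_d_gt_1[OF O u] by (simp add: Bl_def)
        qed
      qed
    next
      case False
      define m where "m = min (w c (x - 1) (y + 1)) (w c (x - 1) y)"
      have aB: "a \<in> B - X" and aI: "(x - 1, y) \<notin> I"
        using toB[OF a(1) False] False I_can[OF a(2)] by auto
      have hyp: "even (x - 1 + y)" "y + 2 \<le> x - 1" using y xy3 by auto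
      have "w c (x - 1) y = (\<Sum>p\<in>Od \<inter> nb a. F c p a)"
        using load[OF CC(1) aB] ww_can[OF a(2)] by simp
      also have "\<dots> \<le> (\<Sum>p\<in>nb a. F c p a)"
        by (rule sum_mono2) (auto simp: finite_nb F_nonneg)
      finally have le_sum: "w c (x - 1) y \<le> (\<Sum>p\<in>nb a. F c p a)" .
      \<comment> \<open>Off the axis the saturated left neighbour gets (c - d x y) / 2 from
        \<open>Al\<close>, at most half its value from \<open>Au\<close> and \<open>Bl\<close>, and
        at most m / 2 from above; solving for its value gives the bound.\<close>
      have le: "w c (x - 1) y \<le> w c x y + m"
      proof (cases "y = 0")
        case True
        have "Bd c (x - 1) (y + 1) \<le> m / 2"
          unfolding m_def by (rule load_axis_used[OF hyp(1) y(1) hyp(2) aI True]) (use u in simp)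
        then show ?thesis
          using le_sum sum_nb_axis[of a "x - 1" "\<lambda>p. G c p (can a)"] a(2) True hyp AB(1)[OF CC(1)]
            wq[OF CC(1)] w_nonneg[of c "x - 1" y]
          unfolding F_def by (simp add: G_def)
      next
        case y0: False
        then have y1: "1 \<le> y" using y by simp
        have "used (x - 1 + 1) y" using u by simp
        note lu = load_used[OF hyp(1) y(1) hyp(2) aI y1 this, of c]
        have "(\<Sum>p\<in>nb a. F c p a) =
            Al c x y + Bl c x y + Au c (x - 1) (y - 1) + Bd c (x - 1) (y + 1)"
          using sum_nb_interior[of a "x - 1" y "\<lambda>p. G c p (can a)"] a(2) y0 y1 hyp
          unfolding F_def by (simp add: G_def)
        moreover have "Au c (x - 1) (y - 1) + Bl c x y \<le> w c (x - 1) y / 2"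
          "Bd c (x - 1) (y + 1) \<le> m / 2"
          using lu by (simp_all add: m_def)
        ultimately show ?thesis
          using le_sum AB(1)[OF CC(1)] wq[OF CC(1)] by argo
      qed
      have O': "Om (x - 1) (y + 1)" by (rule Om_left_up[OF O xy3])
      have sq: "d (x - 1) y + d x (y + 1) \<le> d x y + d (x - 1) (y + 1)"
        by (rule kap_square[OF O O']) (use u in \<open>simp add: used_def\<close>)
      \<comment> \<open>The second parameter is essential here: d x (y + 1) exceeds c strictly, so
        the square inequality contradicts \<open>le\<close>.\<close>
      have "c' \<le> d x (y + 1)" using wu[OF CC(2)] by (simp add: w_def)
      then show False
        using le sq dl dle[OF CC(1)] c'(1) by (auto simp: w_def m_def)
    qed
  qed
qed

end

section \<open>The optimal set\<close>

definition Ia :: "real \<Rightarrow> (int \<times> int) set" where "Ia c = {v. evenp v \<and> dd v < c}"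

lemma finite_Ia: "finite (Ia c)"
proof (rule finite_subset)
  let ?r = "\<lambda>(a, b). {a - \<lceil>c\<rceil>..a + \<lceil>c\<rceil>} \<times> {b - \<lceil>c\<rceil>..b + \<lceil>c\<rceil>}"
  show "Ia c \<subseteq> (\<Union>v\<in>I. ?r v)"
  proof
    fix v assume v: "v \<in> Ia c"
    obtain x y where xy: "v = (x, y)" by force
    obtain a b where ab: "(a, b) \<in> I" "d x y = n (x - a) (y - b)" by (rule d_attained)
    have "n (x - a) (y - b) < c" using v ab xy by (simp add: Ia_def dd_def)
    then have "real_of_int \<bar>x - a\<bar> < c" "real_of_int \<bar>y - b\<bar> < c"
      using n_ge[of "x - a" "y - b"] n_ge[of "y - b" "x - a"] n_sym[of "x - a" "y - b"]
      by linarith+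
    then have "\<bar>x - a\<bar> \<le> \<lceil>c\<rceil>" "\<bar>y - b\<bar> \<le> \<lceil>c\<rceil>" by linarith+
    then have "v \<in> ?r (a, b)" using xy by auto
    then show "v \<in> (\<Union>v\<in>I. ?r v)" using ab by blast
  qed
qed (use fin in auto)

lemma dd_I: "v \<in> I \<Longrightarrow> dd v = 0"
  using d_in by (cases v) (simp add: dd_def)

lemma I_subset_Ia: "0 < c \<Longrightarrow> I \<subseteq> Ia c"
  using I_even dd_I by (auto simp: Ia_def)

lemma gain_Ia: "gain c (Ia c) = (\<Sum>v\<in>Ia c - I. ww c v)"
proof -
  have "edges (Ia c) = {}" by (auto simp: edges_def Ia_def)
  then show ?thesis by (auto simp: gain_def ww_def Ia_def intro!: sum.cong)
qed

theorem gain_max: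
  assumes c: "0 < c" and nc: "\<And>v. evenp v \<Longrightarrow> dd v \<noteq> c"
    and X: "finite X" "I \<subseteq> X"
  shows "gain c X \<le> gain c (Ia c)" and "gain c X = gain c (Ia c) \<Longrightarrow> X = Ia c"
proof -
  \<comment> \<open>B has to contain the candidate set outside I and every even point outside I that
    flow from X can reach.\<close>
  define B where "B = (Ia c \<union> {v \<in> X \<union> (\<Union>p\<in>X. nb p). evenp v}) - I"
  have fB: "finite B" using finite_Ia X finite_nb by (auto simp: B_def)
  have Be: "evenp v \<and> v \<notin> I" if "v \<in> B" for v using that by (auto simp: B_def Ia_def)
  have XB: "v \<in> B" if "v \<in> X - I" "evenp v" for v using that by (auto simp: B_def)
  have nbB: "v \<in> B" if "p \<in> X" "\<not> evenp p" "v \<in> nb p - X" for p v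
    using that X nb_parity[of v p] by (auto simp: B_def)
  have B_Ia: "Ia c - I \<subseteq> B" "\<And>v. v \<in> B - (Ia c - I) \<Longrightarrow> c \<le> dd v"
    by (auto simp: B_def Ia_def not_less)
  note facts = X fB Be XB nbB
  have V: "(\<Sum>v\<in>B. ww c v) = gain c (Ia c)"
    unfolding gain_Ia
  proof (rule sum.mono_neutral_right[OF fB B_Ia(1)], intro ballI)
    show "ww c v = 0" if "v \<in> B - (Ia c - I)" for v using B_Ia(2)[OF that] by (simp add: ww_def)
  qed
  show "gain c X \<le> gain c (Ia c)"
    using gain_le[OF facts less_imp_le[OF c]] V by simp
  assume "gain c X = gain c (Ia c)"
  then have eq: "gain c X = (\<Sum>v\<in>B. ww c v)" using V by simp
  have ev: "evenp p" if "p \<in> X" for p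
    by (rule gain_eq_no_odd[OF facts c eq _ that]) (use Be nc in auto)
  have D1: "ww c v = c - dd v" if "v \<in> X - I" "evenp v" for v
    by (rule gain_eqD(1)[OF facts less_imp_le[OF c] eq]) (use that in auto)
  have D2: "ww c v = (\<Sum>p\<in>{p \<in> X. \<not> evenp p} \<inter> nb v. F c p v)" if "v \<in> B - X" for v
    by (rule gain_eqD(2)[OF facts less_imp_le[OF c] eq]) (use that in auto)
  show "X = Ia c"
  proof (intro set_eqI iffI)
    fix v assume v: "v \<in> X"
    show "v \<in> Ia c"
    proof (cases "v \<in> I")
      case True then show ?thesis using I_subset_Ia c by blast
    next
      case False
      then have "v \<in> X - I" using v by simp
      then have "ww c v = c - dd v" by (rule D1) (rule ev[OF v])
      then have "dd v \<le> c" by (simp add: ww_def)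
      then show ?thesis using nc[of v] ev v by (simp add: Ia_def)
    qed
  next
    fix v assume v: "v \<in> Ia c"
    show "v \<in> X"
    proof (rule ccontr)
      assume "v \<notin> X"
      then have "v \<in> B - X" using v X(2) by (auto simp: B_def)
      moreover have "{p \<in> X. \<not> evenp p} = {}" using ev by blast
      moreover from \<open>v \<in> B - X\<close> have "ww c v = (\<Sum>p\<in>{p \<in> X. \<not> evenp p} \<inter> nb v. F c p v)"
        by (rule D2)
      ultimately have "ww c v = 0" by (simp only: Int_empty_left sum.empty)
      then show False using v by (simp add: ww_def Ia_def)
    qed
  qed
qed

end

section \<open>Lattice convexity of sublevel sets of the distance\<close>

text \<open>The weights are moved along the affine dependency of the abscissae \<open>v\<close> that does not
  decrease the ordinate, until one of them vanishes.\<close>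

lemma chordI:
  fixes i j N :: nat and t :: real
  assumes "i < N" "j < N" "0 \<le> t" "t \<le> 1" "P i j t"
  shows "\<exists>i<N. \<exists>j<N. \<exists>t\<in>{0..1}. P i j t"
proof -
  have "t \<in> {0..1}" using assms by simp
  with assms show ?thesis by blast
qed

lemma chord_of_weights:
  fixes i j N :: nat and w u v :: "nat \<Rightarrow> real"
  assumes "i < N" "j < N" "0 \<le> w i" "0 \<le> w j" "w i + w j = 1"
    and "X = w i * v i + w j * v j" "Y = w i * u i + w j * u j"
  shows "\<exists>i<N. \<exists>j<N. \<exists>t\<in>{0..1}. t * v i + (1 - t) * v j = X \<and> Y \<le> t * u i + (1 - t) * u j"
proof -
  have "w j = 1 - w i" using assms(5) by linarith
  then have "w i * v i + (1 - w i) * v j = X \<and> Y \<le> w i * u i + (1 - w i) * u j"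
    using assms(6,7) by (simp only: order_refl)
  moreover have "w i \<le> 1" using assms(4,5) by linarith
  ultimately show ?thesis
    by (intro chordI[OF assms(1,2,3), where P = "\<lambda>i j t. t * v i + (1 - t) * v j = X \<and> Y \<le> t * u i + (1 - t) * u j"])
qed

lemma triangle_chord:
  fixes u v w :: "nat \<Rightarrow> real"
  assumes w: "\<And>k. k < 3 \<Longrightarrow> 0 \<le> w k" "w 0 + w 1 + w 2 = 1"
  shows "\<exists>i<3. \<exists>j<3. \<exists>t\<in>{0..1}. t * v i + (1 - t) * v j = w 0 * v 0 + w 1 * v 1 + w 2 * v 2 \<and>
    w 0 * u 0 + w 1 * u 1 + w 2 * u 2 \<le> t * u i + (1 - t) * u j"
proof -
  have two: "\<exists>i<3. \<exists>j<3. \<exists>t\<in>{0..1}. t * v i + (1 - t) * v j = w 0 * v 0 + w 1 * v 1 + w 2 * v 2 \<and>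
      w 0 * u 0 + w 1 * u 1 + w 2 * u 2 \<le> t * u i + (1 - t) * u j"
    if nn: "0 \<le> w 0" "0 \<le> w 1" "0 \<le> w 2" and s: "w 0 + w 1 + w 2 = 1"
      and z: "w 0 = 0 \<or> w 1 = 0 \<or> w 2 = 0"
    for w :: "nat \<Rightarrow> real"
    using z
  proof (elim disjE)
    assume "w 0 = 0"
    then show ?thesis using nn s by (intro chord_of_weights[where i = 1 and j = 2 and w = w]) simp_all
  next
    assume "w 1 = 0"
    then show ?thesis using nn s by (intro chord_of_weights[where i = 0 and j = 2 and w = w]) simp_all
  next
    assume "w 2 = 0"
    then show ?thesis using nn s by (intro chord_of_weights[where i = 0 and j = 1 and w = w]) simp_all
  qed
  \<comment> \<open>Cyclic differences sum to 0 and are orthogonal to v. They all vanish only if the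
    three abscissae coincide, and then the highest point suffices.\<close>
  define e where "e = (\<lambda>k::nat. if k = 0 then v 1 - v 2 else if k = 1 then v 2 - v 0 else v 0 - v 1)"
  define \<sigma> :: real where "\<sigma> = (if 0 \<le> e 0 * u 0 + e 1 * u 1 + e 2 * u 2 then 1 else - 1)"
  have \<sigma>: "\<sigma> \<noteq> 0" "0 \<le> \<sigma> * (e 0 * u 0 + e 1 * u 1 + e 2 * u 2)" by (auto simp: \<sigma>_def)
  define \<delta> where "\<delta> k = \<sigma> * e k" for k
  have sum\<delta>: "\<delta> 0 * a + \<delta> 1 * b + \<delta> 2 * c = \<sigma> * (e 0 * a + e 1 * b + e 2 * c)" for a b c
    by (simp add: \<delta>_def algebra_simps)
  have ev: "e 0 + e 1 + e 2 = 0" "e 0 * v 0 + e 1 * v 1 + e 2 * v 2 = 0"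
    by (simp_all add: e_def algebra_simps)
  have d0: "\<delta> 0 + \<delta> 1 + \<delta> 2 = 0" "\<delta> 0 * v 0 + \<delta> 1 * v 1 + \<delta> 2 * v 2 = 0"
    using sum\<delta>[of 1 1 1] sum\<delta>[of "v 0" "v 1" "v 2"] ev by simp_all
  have du: "0 \<le> \<delta> 0 * u 0 + \<delta> 1 * u 1 + \<delta> 2 * u 2" using \<sigma>(2) unfolding sum\<delta> .
  show ?thesis
  proof (cases "\<delta> 0 = 0 \<and> \<delta> 1 = 0 \<and> \<delta> 2 = 0")
    case True
    then have e: "e 0 = 0" "e 1 = 0" using \<sigma>(1) by (auto simp: \<delta>_def)
    have "v 2 = v 0" using e(2) by (simp add: e_def)
    moreover have "v 1 = v 2" using e(1) by (simp add: e_def)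
    ultimately have v: "v 1 = v 0" "v 2 = v 0" by argo+
    define m where "m = max (u 0) (max (u 1) (u 2))"
    have "u 0 = m \<or> u 1 = m \<or> u 2 = m" by (auto simp: m_def max_def)
    then have "(u 0 = m \<and> v 0 = v 0) \<or> (u 1 = m \<and> v 1 = v 0) \<or> (u 2 = m \<and> v 2 = v 0)"
      using v by simp
    moreover have "(0::nat) < 3" "(1::nat) < 3" "(2::nat) < 3" by auto
    ultimately obtain i where i: "i < 3" "u i = m" "v i = v 0" by blast
    have "w 0 * u 0 + w 1 * u 1 + w 2 * u 2 \<le> w 0 * m + w 1 * m + w 2 * m"
      using w(1) by (intro add_mono mult_left_mono) (auto simp: m_def)
    also have "\<dots> = (w 0 + w 1 + w 2) * m" by (simp add: algebra_simps)
    also have "\<dots> = m" using w(2) by simp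
    finally have "w 0 * u 0 + w 1 * u 1 + w 2 * u 2 \<le> m" .
    moreover have "w 0 * v 0 + w 1 * v 1 + w 2 * v 2 = v 0"
    proof -
      have "w 0 * v 0 + w 1 * v 1 + w 2 * v 2 = (w 0 + w 1 + w 2) * v 0"
        unfolding v by (simp add: algebra_simps)
      then show ?thesis using w(2) by simp
    qed
    ultimately show ?thesis
    proof -
      have "1 * v i + (1 - 1) * v i = w 0 * v 0 + w 1 * v 1 + w 2 * v 2 \<and>
          w 0 * u 0 + w 1 * u 1 + w 2 * u 2 \<le> 1 * u i + (1 - 1) * u i"
        using i \<open>w 0 * v 0 + w 1 * v 1 + w 2 * v 2 = v 0\<close> \<open>w 0 * u 0 + w 1 * u 1 + w 2 * u 2 \<le> m\<close>
        by simp
      moreover have "(1::real) \<in> {0..1}" by simp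
      ultimately show ?thesis using i(1) by blast
    qed
  next
    case False
    define L where "L = {k. k < 3 \<and> \<delta> k < 0}"
    have Lne: "L \<noteq> {}"
    proof
      assume L: "L = {}"
      have "0 \<le> \<delta> k" if "k < 3" for k
      proof (rule ccontr)
        assume "\<not> 0 \<le> \<delta> k"
        then have "k \<in> L" using that by (simp add: L_def)
        with L show False by simp
      qed
      from this[of 0] this[of 1] this[of 2] have "0 \<le> \<delta> 0" "0 \<le> \<delta> 1" "0 \<le> \<delta> 2" by simp_all
      with d0(1) False show False by linarith
    qed
    have fL: "finite L" by (simp add: L_def)
    \<comment> \<open>The largest step keeping all weights nonnegative; the weight attaining the
      minimum becomes 0.\<close>
    define t where "t = Min ((\<lambda>k. w k / - \<delta> k) ` L)"
    have "t \<in> (\<lambda>k. w k / - \<delta> k) ` L" unfolding t_def using fL Lne by (intro Min_in) auto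
    then obtain i where i: "i \<in> L" "t = w i / - \<delta> i" by auto
    have t0: "0 \<le> t" using i w(1) by (auto simp: L_def divide_nonneg_neg)
    define w' where "w' k = w k + t * \<delta> k" for k
    have w'i: "w' i = 0" using i by (simp add: w'_def L_def)
    have w': "0 \<le> w' k" if "k < 3" for k
    proof (cases "\<delta> k < 0")
      case True
      then have "t \<le> w k / - \<delta> k" unfolding t_def using fL that by (intro Min_le) (auto simp: L_def)
      then show ?thesis using True by (simp add: w'_def field_simps)
    qed (use t0 w(1)[OF that] in \<open>simp add: w'_def\<close>)
    have "w' 0 = 0 \<or> w' 1 = 0 \<or> w' 2 = 0"
    proof -
      have "i = 0 \<or> i = 1 \<or> i = 2" using i(1) unfolding L_def mem_Collect_eq by linarith
      then show ?thesis using w'i by blast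
    qed
    moreover have s: "w' 0 + w' 1 + w' 2 = 1"
    proof -
      have "w' 0 + w' 1 + w' 2 = w 0 + w 1 + w 2 + t * (\<delta> 0 + \<delta> 1 + \<delta> 2)"
        by (simp add: w'_def algebra_simps)
      then show ?thesis using w(2) d0 by simp
    qed
    moreover have "w' 0 * v 0 + w' 1 * v 1 + w' 2 * v 2 = w 0 * v 0 + w 1 * v 1 + w 2 * v 2"
    proof -
      have "w' 0 * v 0 + w' 1 * v 1 + w' 2 * v 2 =
          w 0 * v 0 + w 1 * v 1 + w 2 * v 2 + t * (\<delta> 0 * v 0 + \<delta> 1 * v 1 + \<delta> 2 * v 2)"
        by (simp add: w'_def algebra_simps)
      then show ?thesis using d0 by simp
    qed
    moreover have "w 0 * u 0 + w 1 * u 1 + w 2 * u 2 \<le> w' 0 * u 0 + w' 1 * u 1 + w' 2 * u 2"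
    proof -
      have "w' 0 * u 0 + w' 1 * u 1 + w' 2 * u 2 =
          w 0 * u 0 + w 1 * u 1 + w 2 * u 2 + t * (\<delta> 0 * u 0 + \<delta> 1 * u 1 + \<delta> 2 * u 2)"
        by (simp add: w'_def algebra_simps)
      then show ?thesis using du t0 by simp
    qed
    moreover have "0 \<le> w' 0" "0 \<le> w' 1" "0 \<le> w' 2" using w'[of 0] w'[of 1] w'[of 2] by simp_all
    from two[OF this s calculation(1)] obtain i j t where "i < 3" "j < 3" "t \<in> {0..1}"
      "t * v i + (1 - t) * v j = w' 0 * v 0 + w' 1 * v 1 + w' 2 * v 2"
      "w' 0 * u 0 + w' 1 * u 1 + w' 2 * u 2 \<le> t * u i + (1 - t) * u j" by blast
    ultimately have "t * v i + (1 - t) * v j = w 0 * v 0 + w 1 * v 1 + w 2 * v 2 \<and>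
      w 0 * u 0 + w 1 * u 1 + w 2 * u 2 \<le> t * u i + (1 - t) * u j" by linarith
    then show ?thesis using \<open>i < 3\<close> \<open>j < 3\<close> \<open>t \<in> {0..1}\<close> by blast
  qed
qed

text \<open>By induction the part of the combination lying in the hull of S is replaced by a chord
  of S, which leaves three points for \<open>triangle_chord\<close>.\<close>

lemma convex_hull_below_chord:
  fixes U V :: "'a::real_vector \<Rightarrow> real"
  assumes "finite S" "x \<in> convex hull S" and U: "linear U" and V: "linear V"
  shows "\<exists>s1\<in>S. \<exists>s2\<in>S. \<exists>t\<in>{0..1}. t * V s1 + (1 - t) * V s2 = V x \<and> U x \<le> t * U s1 + (1 - t) * U s2"
  using assms(1,2)
proof (induction S arbitrary: x rule: finite_induct)
  case (insert a S)
  show ?case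
  proof (cases "S = {}")
    case True
    then show ?thesis using insert.prems by (intro bexI[of _ a] bexI[of _ 0]) auto
  next
    case False
    from insert.prems obtain p q b where
      pq: "0 \<le> p" "0 \<le> q" "p + q = 1" "b \<in> convex hull S" "x = p *\<^sub>R a + q *\<^sub>R b"
      unfolding convex_hull_insert[OF False] by blast
    from insert.IH[OF pq(4)] obtain s1 s2 t where s: "s1 \<in> S" "s2 \<in> S" "t \<in> {0..1}"
      "t * V s1 + (1 - t) * V s2 = V b" "U b \<le> t * U s1 + (1 - t) * U s2" by blast
    define z where "z = (\<lambda>k::nat. if k = 0 then a else if k = 1 then s1 else s2)"
    define w where "w = (\<lambda>k::nat. if k = 0 then p else if k = 1 then q * t else q * (1 - t))"
    have "\<exists>i<3. \<exists>j<3. \<exists>t\<in>{0..1}. t * V (z i) + (1 - t) * V (z j) =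
        w 0 * V (z 0) + w 1 * V (z 1) + w 2 * V (z 2) \<and>
        w 0 * U (z 0) + w 1 * U (z 1) + w 2 * U (z 2) \<le> t * U (z i) + (1 - t) * U (z j)"
    proof (rule triangle_chord)
      show "0 \<le> w k" for k using pq s(3) by (simp add: w_def)
      have "p + q * t + q * (1 - t) = p + q" by (simp add: algebra_simps)
      then show "w 0 + w 1 + w 2 = 1" using pq(3) by (simp add: w_def)
    qed
    moreover have "w 0 * V (z 0) + w 1 * V (z 1) + w 2 * V (z 2) = V x"
    proof -
      have "V x = p * V a + q * V b" by (simp add: pq(5) linear_add[OF V] linear_scale[OF V])
      then show ?thesis unfolding s(4)[symmetric] by (simp add: w_def z_def algebra_simps)
    qed
    moreover have "U x \<le> w 0 * U (z 0) + w 1 * U (z 1) + w 2 * U (z 2)"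
    proof -
      have "U x = p * U a + q * U b" by (simp add: pq(5) linear_add[OF U] linear_scale[OF U])
      also have "\<dots> \<le> p * U a + q * (t * U s1 + (1 - t) * U s2)"
        using s(5) pq(2) by (intro add_left_mono mult_left_mono)
      also have "\<dots> = w 0 * U (z 0) + w 1 * U (z 1) + w 2 * U (z 2)"
        by (simp add: w_def z_def algebra_simps)
      finally show ?thesis .
    qed
    moreover have z: "z i \<in> insert a S" for i using s by (auto simp: z_def)
    ultimately obtain i j t where ij: "t \<in> {0..1}" "t * V (z i) + (1 - t) * V (z j) = V x"
      "U x \<le> t * U (z i) + (1 - t) * U (z j)" by fastforce
    then show ?thesis using z[of i] z[of j] by blast
  qed
qed simp

lemma segment_above_line:
  fixes A Z :: real
  assumes "UA \<ge> \<alpha> + \<beta> * A" "UZ \<ge> \<alpha> + \<beta> * Z" "A \<le> x" "x \<le> Z"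
  obtains t where "t \<in> {0..1}" "t * A + (1 - t) * Z = x" "\<alpha> + \<beta> * x \<le> t * UA + (1 - t) * UZ"
proof -
  define t where "t = (if A = Z then 0 else (Z - x) / (Z - A))"
  have t: "t \<in> {0..1}" "t * A + (1 - t) * Z = x"
  proof -
    show "t \<in> {0..1}" using assms(3,4) by (simp add: t_def divide_le_eq_1)
    have "t * (Z - A) = Z - x" using assms(3,4) by (simp add: t_def)
    then show "t * A + (1 - t) * Z = x" by (simp add: algebra_simps)
  qed
  have "\<alpha> + \<beta> * x = t * (\<alpha> + \<beta> * A) + (1 - t) * (\<alpha> + \<beta> * Z)"
    unfolding t(2)[symmetric] by (simp add: algebra_simps)
  also have "\<dots> \<le> t * UA + (1 - t) * UZ"
    using assms t(1) by (intro add_mono mult_left_mono) auto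
  finally show thesis using that t by blast
qed

text \<open>S is X clamped to the interval between - \<bar>T\<bar> and \<bar>T\<bar>, whose ends are
  even.\<close>

lemma split_even:
  fixes X T :: int and U :: real
  assumes "even X" "even T" "\<bar>X\<bar> \<le> \<bar>T\<bar> + U" "0 \<le> U"
  obtains S where "even S" "\<bar>S\<bar> \<le> \<bar>T\<bar>" "\<bar>X - S\<bar> \<le> U"
proof (cases "\<bar>X\<bar> \<le> \<bar>T\<bar>")
  case True then show thesis using that[of X] assms by simp
next
  case False
  show thesis
  proof (cases "0 \<le> X")
    case True
    show thesis by (rule that[of "\<bar>T\<bar>"]) (use assms False True in auto)
  next
    case neg: False
    show thesis by (rule that[of "- \<bar>T\<bar>"]) (use assms False neg in auto)
  qed
qed

section \<open>Sums of hull points and short vectors\<close>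

definition emb :: "int \<times> int \<Rightarrow> plane" where "emb p = (of_int (fst p), of_int (snd p))"

context lattice_body begin

context
  assumes lattice_convex: "\<And>p. evenp p \<Longrightarrow> emb p \<in> convex hull (emb ` I) \<Longrightarrow> p \<in> I"
begin

lemma convex_hull_antidiag_refl:
  assumes "(x, y) \<in> convex hull (emb ` I)" shows "(- y, - x) \<in> convex hull (emb ` I)"
proof -
  define g :: "plane \<Rightarrow> plane" where "g = (\<lambda>p. (- snd p, - fst p))"
  have "linear g" by (rule linearI) (auto simp: g_def)
  moreover have "g ` emb ` I \<subseteq> emb ` I"
  proof (clarsimp)
    fix a b assume "(a, b) \<in> I"
    then have "(- b, - a) \<in> I" using I_swap I_refl by blast
    then show "g (emb (a, b)) \<in> emb ` I" by (force simp: g_def emb_def)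
  qed
  ultimately have "g ` (convex hull (emb ` I)) \<subseteq> convex hull (emb ` I)"
    by (simp add: convex_hull_linear_image hull_mono)
  then show ?thesis using assms by (force simp: g_def)
qed

text \<open>Only the coordinate difference of (a, b) is split exactly between P and Z; the sums need
  only be large enough. Reflection in the antidiagonal keeps the difference and negates the sum, so
  both the hull and the norm ball allow the sum to be shrunk. D and S are the difference and sum of
  the point of I thus found.\<close>

lemma d_less_of_decomposition:
  assumes P: "(P1, P2) \<in> convex hull (emb ` I)" and Z: "f Z1 Z2 < c"
    and D: "even D" "P1 - P2 = of_int D" "of_int (a - b) = (P1 - P2) + (Z1 - Z2)"
    and S: "even S" "\<bar>of_int S\<bar> \<le> \<bar>P1 + P2\<bar>" "\<bar>of_int (a + b - S)\<bar> \<le> \<bar>Z1 + Z2\<bar>"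
    and even: "even (a + b)"
  shows "d a b < c"
proof -
  define p where "p = ((S + D) div 2, (S - D) div 2)"
  have p: "2 * fst p = S + D" "2 * snd p = S - D" using D S by (auto simp: p_def)
  have pr: "2 * real_of_int (fst p) = S + D" "2 * real_of_int (snd p) = S - D"
    using p by (metis of_int_add of_int_diff of_int_mult of_int_numeral)+
  have "evenp p" using p S(1) unfolding evenp_def by presburger
  moreover have "emb p \<in> convex hull (emb ` I)"
  proof -
    define r where "r = S / (P1 + P2)"
    have r: "r * (P1 + P2) = S" using S(2) by (cases "P1 + P2 = 0") (auto simp: r_def)
    have "\<bar>r\<bar> \<le> 1" using S(2) by (simp add: r_def abs_divide divide_le_eq_1)
    define t where "t = (1 + r) / 2"
    have t: "0 \<le> t" "t \<le> 1" "(2 * t - 1) * (P1 + P2) = S"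
    proof -
      show "0 \<le> t" "t \<le> 1" using \<open>\<bar>r\<bar> \<le> 1\<close> by (auto simp: t_def abs_le_iff)
      have "2 * t - 1 = r" unfolding t_def by argo
      then show "(2 * t - 1) * (P1 + P2) = S" using r by simp
    qed
    have "t *\<^sub>R (P1, P2) + (1 - t) *\<^sub>R (- P2, - P1) \<in> convex hull (emb ` I)"
      using P convex_hull_antidiag_refl[OF P] t
      by (intro convexD[OF convex_convex_hull]) auto
    moreover have "t *\<^sub>R (P1, P2) + (1 - t) *\<^sub>R (- P2, - P1) = emb p"
      using t(3) D(2) pr by (auto simp: emb_def algebra_simps)
    ultimately show ?thesis by simp
  qed
  ultimately have pI: "(fst p, snd p) \<in> I" using lattice_convex[of p] by simp
  have "d a b \<le> n (a - fst p) (b - snd p)" by (rule d_le[OF pI])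
  also have "\<dots> \<le> f Z1 Z2"
  proof -
    have "f ((of_int (a + b - S) + (Z1 - Z2)) / 2) ((of_int (a + b - S) - (Z1 - Z2)) / 2)
        \<le> f ((Z1 + Z2 + (Z1 - Z2)) / 2) ((Z1 + Z2 - (Z1 - Z2)) / 2)"
      using S(3) by (rule rot.mono2)
    moreover have "(of_int (a + b - S) + (Z1 - Z2)) / 2 = of_int (a - fst p)"
      "(of_int (a + b - S) - (Z1 - Z2)) / 2 = of_int (b - snd p)"
      "(Z1 + Z2 + (Z1 - Z2)) / 2 = Z1" "(Z1 + Z2 - (Z1 - Z2)) / 2 = Z2"
      using D(2,3) pr by (simp_all add: field_simps)
    ultimately show ?thesis unfolding n_def by (simp only:)
  qed
  finally show ?thesis using Z by simp
qed

text \<open>A point of the hull lies below a chord \<open>s1 s2\<close> of \<open>Ia c\<close>, where \<open>si = pi + qi\<close> with \<open>pi \<in> I\<close>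
  and \<open>qi\<close> shorter than \<open>c\<close>. As \<open>(p1 + q2) + (p2 + q1) = s1 + s2\<close>, one of \<open>p1 + q2\<close>, \<open>p2 + q1\<close> is
  not below the line \<open>s1 s2\<close>, and replacing one end of the chord by it makes the two summands
  \<open>p\<close> or the two summands \<open>q\<close> of the ends equal.\<close>

lemma Ia_convex:
  assumes even: "even (a + b)" and hull: "(of_int a, of_int b) \<in> convex hull (emb ` Ia c)"
  shows "d a b < c"
proof -
  \<comment> \<open>The sign gives U x = \<bar>a + b\<bar>, so that lying below a chord bounds an
    absolute value.\<close>
  define \<sigma> :: real where "\<sigma> = (if 0 \<le> a + b then 1 else - 1)"
  define U V :: "plane \<Rightarrow> real" where "U p = \<sigma> * (fst p + snd p)" and "V p = fst p - snd p" for p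
  have lin: "linear U" "linear V" by (auto simp: U_def V_def algebra_simps intro!: linearI)
  have Uadd: "U (p + q) = U p + U q" "V (p + q) = V p + V q" for p q
    using lin by (auto simp: linear_add)
  have Ucomb: "U (t *\<^sub>R p + (1 - t) *\<^sub>R q) = t * U p + (1 - t) * U q"
    "V (t *\<^sub>R p + (1 - t) *\<^sub>R q) = t * V p + (1 - t) * V q" for t p q
    using lin by (auto simp: linear_add linear_scale)
  define x :: plane where "x = (of_int a, of_int b)"
  have Ux: "U x = \<bar>of_int (a + b)\<bar>" by (auto simp: U_def \<sigma>_def x_def)
  have Vx: "V x = of_int (a - b)" by (simp add: V_def x_def)
  have absU: "U p \<le> \<bar>fst p + snd p\<bar>" for p by (auto simp: U_def \<sigma>_def)
  define \<Phi> where "\<Phi> p = f (fst p) (snd p)" for p :: plane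
  have \<Phi>comb: "\<Phi> (t *\<^sub>R p + (1 - t) *\<^sub>R q) < c" if "t \<in> {0..1}" "\<Phi> p < c" "\<Phi> q < c" for t p q
  proof -
    have "\<Phi> (t *\<^sub>R p + (1 - t) *\<^sub>R q) \<le> t * \<Phi> p + (1 - t) * \<Phi> q"
      using comb_le[of t "1 - t"] that(1) by (simp add: \<Phi>_def)
    also have "\<dots> < c" using that by (intro convex_bound_lt) auto
    finally show ?thesis .
  qed
  \<comment> \<open>If one summand is an even lattice point, both have an even integer as coordinate
    difference, because V x is one; \<open>split_even\<close> then distributes the sum.\<close>
  have fin: "d a b < c" if P: "P \<in> convex hull (emb ` I)" and Z: "\<Phi> Z < c"
    and i: "P \<in> emb ` Collect evenp \<or> Z \<in> emb ` Collect evenp"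
    and VU: "V (P + Z) = V x" "U x \<le> U (P + Z)" for P Z
  proof -
    have V: "V P + V Z = V x" and U: "U x \<le> U P + U Z" using VU by (simp_all add: Uadd)
    from i obtain p where p: "evenp p" "P = emb p \<or> Z = emb p" by blast
    have le: "\<bar>of_int (a + b)\<bar> \<le> \<bar>fst P + snd P\<bar> + \<bar>fst Z + snd Z\<bar>"
      using U absU[of P] absU[of Z] unfolding Ux by simp
    have ev: "even (fst p + snd p)" "even (fst p - snd p)" "even (a - b)"
      using p(1) even by (auto simp: evenp_def)
    from p(2) show ?thesis
    proof
      assume e: "P = emb p"
      obtain S where S: "even S" "\<bar>S\<bar> \<le> \<bar>fst p + snd p\<bar>"
        "\<bar>(a + b) - S\<bar> \<le> \<bar>fst Z + snd Z\<bar>"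
        by (rule split_even[OF even ev(1), of "\<bar>fst Z + snd Z\<bar>"]) (use le in \<open>auto simp: e emb_def\<close>)
      show ?thesis
        by (rule d_less_of_decomposition[of "fst P" "snd P" "fst Z" "snd Z" _ "fst p - snd p" _ _ S])
          (use P Z V S ev even Vx in \<open>auto simp: \<Phi>_def V_def e emb_def\<close>)
    next
      assume e: "Z = emb p"
      obtain S where S: "even S" "\<bar>S\<bar> \<le> \<bar>fst p + snd p\<bar>"
        "\<bar>(a + b) - S\<bar> \<le> \<bar>fst P + snd P\<bar>"
        by (rule split_even[OF even ev(1), of "\<bar>fst P + snd P\<bar>"]) (use le in \<open>auto simp: e emb_def\<close>)
      show ?thesis
        by (rule d_less_of_decomposition[of "fst P" "snd P" "fst Z" "snd Z" _ "a - b - (fst p - snd p)" _ _ "a + b - S"])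
          (use P Z V S ev even Vx in \<open>auto simp: \<Phi>_def V_def e emb_def\<close>)
    qed
  qed
  have dec: "\<exists>p q. p \<in> I \<and> evenp q \<and> s = emb p + emb q \<and> \<Phi> (emb q) < c" if "s \<in> emb ` Ia c" for s
  proof -
    from that obtain y z where s: "s = emb (y, z)" "evenp (y, z)" "d y z < c"
      by (auto simp: Ia_def dd_def)
    obtain a b where ab: "(a, b) \<in> I" "d y z = n (y - a) (z - b)" by (rule d_attained)
    show ?thesis
      using s ab ev[OF ab(1)]
      by (intro exI[of _ "(a, b)"] exI[of _ "(y - a, z - b)"])
        (auto simp: emb_def evenp_def \<Phi>_def n_def)
  qed
  have pe: "emb p \<in> emb ` Collect evenp" if "p \<in> I" for p using I_even[OF that] by simp
  have qe: "emb p \<in> emb ` Collect evenp" if "evenp p" for p using that by simp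
  have Ih: "emb p \<in> convex hull (emb ` I)" if "p \<in> I" for p using that by (simp add: hull_inc)
  have comb: "t *\<^sub>R emb p + (1 - t) *\<^sub>R emb q \<in> convex hull (emb ` I)"
    if "p \<in> I" "q \<in> I" "t \<in> {0..1}" for p q t
    using that Ih by (intro convexD[OF convex_convex_hull]) auto
  have main: "d a b < c"
    if s: "s1 \<in> emb ` Ia c" "s2 \<in> emb ` Ia c" "V s1 \<le> V s2" and t: "t \<in> {0..1}"
      "t * V s1 + (1 - t) * V s2 = V x" "U x \<le> t * U s1 + (1 - t) * U s2" for s1 s2 t
  proof -
    obtain p1 q1 where 1: "p1 \<in> I" "evenp q1" "s1 = emb p1 + emb q1" "\<Phi> (emb q1) < c"
      using dec[OF s(1)] by blast
    obtain p2 q2 where 2: "p2 \<in> I" "evenp q2" "s2 = emb p2 + emb q2" "\<Phi> (emb q2) < c"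
      using dec[OF s(2)] by blast
    show ?thesis
    proof (cases "V s1 = V s2")
      case True
      then have v: "V s1 = V x" "V s2 = V x" using t(2) by (auto simp: algebra_simps)
      have "U x \<le> U s1 \<or> U x \<le> U s2"
      proof (rule ccontr)
        assume "\<not> ?thesis"
        then have "t * U s1 + (1 - t) * U s2 < U x" using t(1) by (intro convex_bound_lt) auto
        then show False using t(3) by simp
      qed
      then show ?thesis
      proof
        assume "U x \<le> U s1"
        then show ?thesis
          by (intro fin[OF Ih[OF 1(1)] 1(4) disjI2[OF qe[OF 1(2)]]]) (use v in \<open>simp_all flip: 1(3)\<close>)
      next
        assume "U x \<le> U s2"
        then show ?thesis
          by (intro fin[OF Ih[OF 2(1)] 2(4) disjI2[OF qe[OF 2(2)]]]) (use v in \<open>simp_all flip: 2(3)\<close>)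
      qed
    next
      case False
      then have V12: "V s1 < V s2" using s(3) by simp
      define \<beta> where "\<beta> = (U s2 - U s1) / (V s2 - V s1)"
      define \<alpha> where "\<alpha> = U s1 - \<beta> * V s1"
      have "\<beta> * (V s2 - V s1) = U s2 - U s1" using V12 by (simp add: \<beta>_def)
      then have l: "U s1 = \<alpha> + \<beta> * V s1" "U s2 = \<alpha> + \<beta> * V s2" by (auto simp: \<alpha>_def algebra_simps)
      have "t * U s1 + (1 - t) * U s2 = \<alpha> + \<beta> * (t * V s1 + (1 - t) * V s2)"
        unfolding l by (simp add: algebra_simps)
      then have Ul: "U x \<le> \<alpha> + \<beta> * V x" using t by simp
      have x12: "V s1 \<le> V x" "V x \<le> V s2"
      proof -
        have "t * V s1 \<le> t * V s2" "(1 - t) * V s1 \<le> (1 - t) * V s2"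
          using t(1) s(3) by (auto intro: mult_left_mono)
        then show "V s1 \<le> V x" "V x \<le> V s2" using t(2) by (auto simp: algebra_simps)
      qed
      define A B where "A = emb p1 + emb q2" and "B = emb p2 + emb q1"
      have "U A + U B = U s1 + U s2" "V A + V B = V s1 + V s2"
        by (auto simp: A_def B_def 1 2 Uadd)
      then have UV: "U B = U s1 + U s2 - U A" "V B = V s1 + V s2 - V A" by linarith+
      have "(U A - (\<alpha> + \<beta> * V A)) + (U B - (\<alpha> + \<beta> * V B)) = 0"
        unfolding UV l by (simp add: algebra_simps)
      then consider "\<alpha> + \<beta> * V A \<le> U A" "V A \<le> V x" | "\<alpha> + \<beta> * V A \<le> U A" "V x \<le> V A"
        | "\<alpha> + \<beta> * V B \<le> U B" "V B \<le> V x" | "\<alpha> + \<beta> * V B \<le> U B" "V x \<le> V B" by linarith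
      then show ?thesis
      proof cases
        case c: 1
        obtain r where r: "r \<in> {0..1}" "r * V A + (1 - r) * V s2 = V x"
          "\<alpha> + \<beta> * V x \<le> r * U A + (1 - r) * U s2"
          by (rule segment_above_line[OF c(1) eq_refl[OF l(2)[symmetric]] c(2) x12(2)])
        have e: "r *\<^sub>R emb p1 + (1 - r) *\<^sub>R emb p2 + emb q2 = r *\<^sub>R A + (1 - r) *\<^sub>R s2"
          by (simp add: A_def 2(3) algebra_simps)
        show ?thesis
          by (rule fin[OF comb[OF 1(1) 2(1) r(1)] 2(4) disjI2[OF qe[OF 2(2)]]])
            (unfold e Ucomb, rule r(2), rule order_trans[OF Ul r(3)])
      next
        case c: 2
        obtain r where r: "r \<in> {0..1}" "r * V s1 + (1 - r) * V A = V x"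
          "\<alpha> + \<beta> * V x \<le> r * U s1 + (1 - r) * U A"
          by (rule segment_above_line[OF eq_refl[OF l(1)[symmetric]] c(1) x12(1) c(2)])
        have e: "emb p1 + (r *\<^sub>R emb q1 + (1 - r) *\<^sub>R emb q2) = r *\<^sub>R s1 + (1 - r) *\<^sub>R A"
          by (simp add: A_def 1(3) algebra_simps)
        show ?thesis
          by (rule fin[OF Ih[OF 1(1)] \<Phi>comb[OF r(1) 1(4) 2(4)] disjI1[OF pe[OF 1(1)]]])
            (unfold e Ucomb, rule r(2), rule order_trans[OF Ul r(3)])
      next
        case c: 3
        obtain r where r: "r \<in> {0..1}" "r * V B + (1 - r) * V s2 = V x"
          "\<alpha> + \<beta> * V x \<le> r * U B + (1 - r) * U s2"
          by (rule segment_above_line[OF c(1) eq_refl[OF l(2)[symmetric]] c(2) x12(2)])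
        have e: "emb p2 + (r *\<^sub>R emb q1 + (1 - r) *\<^sub>R emb q2) = r *\<^sub>R B + (1 - r) *\<^sub>R s2"
          by (simp add: B_def 2(3) algebra_simps)
        show ?thesis
          by (rule fin[OF Ih[OF 2(1)] \<Phi>comb[OF r(1) 1(4) 2(4)] disjI1[OF pe[OF 2(1)]]])
            (unfold e Ucomb, rule r(2), rule order_trans[OF Ul r(3)])
      next
        case c: 4
        obtain r where r: "r \<in> {0..1}" "r * V s1 + (1 - r) * V B = V x"
          "\<alpha> + \<beta> * V x \<le> r * U s1 + (1 - r) * U B"
          by (rule segment_above_line[OF eq_refl[OF l(1)[symmetric]] c(1) x12(1) c(2)])
        have e: "r *\<^sub>R emb p1 + (1 - r) *\<^sub>R emb p2 + emb q1 = r *\<^sub>R s1 + (1 - r) *\<^sub>R B"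
          by (simp add: B_def 1(3) algebra_simps)
        show ?thesis
          by (rule fin[OF comb[OF 1(1) 2(1) r(1)] 1(4) disjI2[OF qe[OF 1(2)]]])
            (unfold e Ucomb, rule r(2), rule order_trans[OF Ul r(3)])
      qed
    qed
  qed
  obtain s1 s2 t where st: "s1 \<in> emb ` Ia c" "s2 \<in> emb ` Ia c" "t \<in> {0..1}"
    "t * V s1 + (1 - t) * V s2 = V x" "U x \<le> t * U s1 + (1 - t) * U s2"
    using convex_hull_below_chord[OF _ hull lin] finite_Ia unfolding x_def by blast
  show ?thesis
  proof (cases "V s1 \<le> V s2")
    case True then show ?thesis using main st by blast
  next
    case False
    show ?thesis
      by (rule main[OF st(2,1), of "1 - t"]) (use False st in auto)
  qed
qed

end
end

section \<open>Length of the boundary of a union of cells\<close>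

definition cu :: "(int \<times> int) set \<Rightarrow> plane set" where "cu X = cell_union (emb ` X)"

definition bd :: "(int \<times> int) set \<Rightarrow> ((int \<times> int) \<times> (int \<times> int)) set" where
  "bd X = (SIGMA v:X. nb v - X)"

lemma unit_square_iff:
  "x \<in> unit_square (emb i) \<longleftrightarrow> \<bar>fst x - of_int (fst i)\<bar> \<le> 1/2 \<and> \<bar>snd x - of_int (snd i)\<bar> \<le> 1/2"
proof
  assume "x \<in> unit_square (emb i)"
  then show "\<bar>fst x - of_int (fst i)\<bar> \<le> 1/2 \<and> \<bar>snd x - of_int (snd i)\<bar> \<le> 1/2"
    by (auto simp: unit_square_def emb_def abs_le_iff)
next
  assume "\<bar>fst x - of_int (fst i)\<bar> \<le> 1/2 \<and> \<bar>snd x - of_int (snd i)\<bar> \<le> 1/2"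
  then have "x - emb i \<in> {-1/2..1/2} \<times> {-1/2..1/2}"
    unfolding abs_le_iff by (auto simp: emb_def mem_Times_iff)
  then show "x \<in> unit_square (emb i)" unfolding unit_square_def
    by (intro image_eqI[of _ _ "x - emb i"]) auto
qed

lemma cu_iff: "x \<in> cu X \<longleftrightarrow> (\<exists>i\<in>X. x \<in> unit_square (emb i))"
  by (auto simp: cu_def cell_union_def)

text \<open>Either s is interior to one interval, or it is the common end of two; the remaining
  intervals stay at positive distance.\<close>

lemma near_cells:
  fixes s :: real
  shows "\<exists>e>0. \<forall>s'. \<forall>a :: int. \<bar>s' - s\<bar> < e \<longrightarrow> \<bar>s' - a\<bar> \<le> 1/2 \<longrightarrow> \<bar>s - a\<bar> \<le> 1/2"
proof -
  define m where "m = \<lfloor>s + 1/2\<rfloor>"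
  have m: "of_int m \<le> s + 1/2" "s + 1/2 < of_int m + 1" by (simp_all add: m_def)
  show ?thesis
  proof (cases "of_int m = s + 1/2")
    case True
    have "\<bar>s - a\<bar> \<le> 1/2" if "\<bar>s' - s\<bar> < 1/2" "\<bar>s' - a\<bar> \<le> 1/2" for s' :: real and a :: int
    proof -
      have "real_of_int a < of_int m + 1" "of_int m - 2 < real_of_int a" using that True by linarith+
      then have "a = m \<or> a = m - 1" by linarith
      then show ?thesis using True by auto
    qed
    then show ?thesis by (intro exI[of _ "1/2"]) auto
  next
    case False
    define e where "e = min (s + 1/2 - of_int m) (of_int m + 1 - (s + 1/2))"
    have "\<bar>s - a\<bar> \<le> 1/2" if "\<bar>s' - s\<bar> < e" "\<bar>s' - a\<bar> \<le> 1/2" for s' :: real and a :: int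
    proof -
      have "real_of_int a < of_int m + 1" "of_int m - 1 < real_of_int a"
        using that unfolding e_def by linarith+
      then have "a = m" by linarith
      then show ?thesis using m by linarith
    qed
    moreover have "0 < e" using m False by (simp add: e_def)
    ultimately show ?thesis by blast
  qed
qed

lemma near_squares:
  "\<exists>e>0. \<forall>y i. dist y x < e \<longrightarrow> y \<in> unit_square (emb i) \<longrightarrow> x \<in> unit_square (emb i)"
proof -
  obtain e1 where e1: "0 < e1" "\<And>s' a. \<bar>s' - fst x\<bar> < e1 \<Longrightarrow> \<bar>s' - real_of_int a\<bar> \<le> 1/2 \<Longrightarrow> \<bar>fst x - a\<bar> \<le> 1/2"
    using near_cells[of "fst x"] by blast
  obtain e2 where e2: "0 < e2" "\<And>s' a. \<bar>s' - snd x\<bar> < e2 \<Longrightarrow> \<bar>s' - real_of_int a\<bar> \<le> 1/2 \<Longrightarrow> \<bar>snd x - a\<bar> \<le> 1/2"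
    using near_cells[of "snd x"] by blast
  have "x \<in> unit_square (emb i)" if "dist y x < min e1 e2" "y \<in> unit_square (emb i)" for y i
  proof -
    have "\<bar>fst y - fst x\<bar> < e1" "\<bar>snd y - snd x\<bar> < e2"
      using that(1) dist_fst_le[of y x] dist_snd_le[of y x] by (auto simp: dist_real_def)
    then show ?thesis using that(2) e1(2) e2(2) unfolding unit_square_iff by blast
  qed
  then show ?thesis using e1(1) e2(1) by (intro exI[of _ "min e1 e2"]) auto
qed

lemma in_some_square: "\<exists>i. x \<in> unit_square (emb i)"
proof -
  have "\<bar>s - of_int \<lfloor>s + 1/2\<rfloor>\<bar> \<le> 1/2" for s :: real by linarith
  then show ?thesis unfolding unit_square_iff
    by (intro exI[of _ "(\<lfloor>fst x + 1/2\<rfloor>, \<lfloor>snd x + 1/2\<rfloor>)"]) auto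
qed

lemma closed_cu: "closed (cu X)"
proof -
  have "\<exists>e>0. \<forall>y. dist y x < e \<longrightarrow> y \<in> - cu X" if "x \<in> - cu X" for x
    using near_squares[of x] that unfolding cu_iff Compl_iff by blast
  then show ?thesis by (simp add: closed_def open_dist)
qed

lemma unit_square_int: "emb j \<in> unit_square (emb i) \<longleftrightarrow> j = i"
proof
  assume "emb j \<in> unit_square (emb i)"
  then have "\<bar>real_of_int (fst j - fst i)\<bar> \<le> 1/2" "\<bar>real_of_int (snd j - snd i)\<bar> \<le> 1/2"
    unfolding unit_square_iff by (auto simp: emb_def)
  then have "fst j - fst i = 0" "snd j - snd i = 0" by linarith+
  then show "j = i" by (simp add: prod_eq_iff)
qed (simp add: unit_square_iff, simp add: emb_def)

lemma emb_inj: "emb i = emb j \<longleftrightarrow> i = j"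
  by (auto simp: emb_def prod_eq_iff)

lemma lattice_emb: "lattice = range emb"
proof
  show "lattice \<subseteq> range emb"
  proof
    fix x :: plane assume "x \<in> lattice"
    then obtain a b :: int where "x = (of_int a, of_int b)"
      by (auto simp: lattice_def elim!: Ints_cases)
    then show "x \<in> range emb" by (intro image_eqI[of _ _ "(a, b)"]) (auto simp: emb_def)
  qed
qed (auto simp: lattice_def emb_def)

lemma even_lattice_emb: "even_lattice = emb ` Collect evenp"
proof
  show "even_lattice \<subseteq> emb ` Collect evenp"
  proof
    fix x assume "x \<in> even_lattice"
    then obtain a b :: int where "x = (of_int a, of_int b)" "even (a + b)"
      by (auto simp: even_lattice_def)
    then show "x \<in> emb ` Collect evenp"
      by (intro image_eqI[of _ _ "(a, b)"]) (auto simp: emb_def evenp_def)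
  qed
qed (auto simp: even_lattice_def emb_def evenp_def)

lemma centers_cu: "centers (cu X) = emb ` X"
  by (auto simp: centers_def lattice_emb cu_iff unit_square_int)

lemma admissible_iff: "E \<in> admissible_sets \<longleftrightarrow> (\<exists>X. E = cu X)"
proof
  assume "E \<in> admissible_sets"
  then obtain J where J: "E = cell_union J" "J \<subseteq> lattice" by (auto simp: admissible_sets_def)
  then have "J = emb ` {p. emb p \<in> J}" by (auto simp: lattice_emb)
  then show "\<exists>X. E = cu X" using J unfolding cu_def by metis
qed (auto simp: admissible_sets_def cu_def lattice_emb)

lemma cu_subset_iff: "cu X \<subseteq> cu Y \<longleftrightarrow> X \<subseteq> Y"
proof
  assume "cu X \<subseteq> cu Y"
  then have "centers (cu X) \<subseteq> centers (cu Y)" by (auto simp: centers_def)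
  then show "X \<subseteq> Y" unfolding centers_cu by (auto simp: emb_inj)
qed (use cu_iff in blast)

text \<open>The common side of the cells of two neighbours \<open>v\<close> and \<open>a\<close>, parametrized by arc length.\<close>

definition side :: "int \<times> int \<Rightarrow> int \<times> int \<Rightarrow> real \<Rightarrow> plane" where
  "side v a t = ((of_int (fst v) + of_int (fst a)) / 2 + t * of_int (snd v - snd a),
                 (of_int (snd v) + of_int (snd a)) / 2 + t * of_int (fst a - fst v))"

lemma nb_cases:
  assumes "a \<in> nb v"
  obtains "fst a = fst v - 1" "snd a = snd v" | "fst a = fst v + 1" "snd a = snd v"
    | "fst a = fst v" "snd a = snd v - 1" | "fst a = fst v" "snd a = snd v + 1"
  using assms by (auto simp: nb_def)

lemma dist_side: assumes "a \<in> nb v" shows "dist (side v a t) (side v a t') = \<bar>t - t'\<bar>"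
  using assms
  by (cases rule: nb_cases) (auto simp: side_def dist_Pair_Pair dist_real_def)

lemma side_squares:
  assumes "a \<in> nb v" "\<bar>t\<bar> < 1/2"
  shows "side v a t \<in> unit_square (emb i) \<longleftrightarrow> i = v \<or> i = a"
proof -
  have *: "\<bar>real_of_int x + 1/2 - of_int y\<bar> \<le> 1/2 \<longleftrightarrow> y = x \<or> y = x + 1"
    "\<bar>real_of_int x - 1/2 - of_int y\<bar> \<le> 1/2 \<longleftrightarrow> y = x \<or> y = x - 1"
    "\<bar>real_of_int x + t - of_int y\<bar> \<le> 1/2 \<longleftrightarrow> y = x"
    "\<bar>real_of_int x - t - of_int y\<bar> \<le> 1/2 \<longleftrightarrow> y = x" for x y :: int
    subgoal by (rule iffI, linarith, auto)
    subgoal by (rule iffI, linarith, auto)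
    subgoal using assms(2) by (intro iffI; (linarith | simp))
    subgoal using assms(2) by (intro iffI; (linarith | simp))
    done
  show ?thesis
    using assms(1)
  proof (cases rule: nb_cases)
    case 1
    have e: "side v a t = (of_int (fst v) - 1/2, of_int (snd v) - t)"
      unfolding side_def 1 by (simp add: field_simps)
    show ?thesis unfolding e unit_square_iff fst_conv snd_conv * using 1 by (auto simp: prod_eq_iff)
  next
    case 2
    have e: "side v a t = (of_int (fst v) + 1/2, of_int (snd v) + t)"
      unfolding side_def 2 by (simp add: field_simps)
    show ?thesis unfolding e unit_square_iff fst_conv snd_conv * using 2 by (auto simp: prod_eq_iff)
  next
    case 3
    have e: "side v a t = (of_int (fst v) + t, of_int (snd v) - 1/2)"
      unfolding side_def 3 by (simp add: field_simps)
    show ?thesis unfolding e unit_square_iff fst_conv snd_conv * using 3 by (auto simp: prod_eq_iff)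
  next
    case 4
    have e: "side v a t = (of_int (fst v) - t, of_int (snd v) + 1/2)"
      unfolding side_def 4 by (simp add: field_simps)
    show ?thesis unfolding e unit_square_iff fst_conv snd_conv * using 4 by (auto simp: prod_eq_iff)
  qed
qed

lemma side_beyond:
  assumes "a \<in> nb v" "\<bar>t\<bar> < 1/2" "0 < r" "r < 1/2"
  shows "side v a t + r *\<^sub>R (emb a - emb v) \<in> unit_square (emb i) \<longleftrightarrow> i = a"
    and "norm (r *\<^sub>R (emb a - emb v)) = r"
proof -
  have *: "\<bar>real_of_int x + 1/2 + r - of_int y\<bar> \<le> 1/2 \<longleftrightarrow> y = x + 1"
    "\<bar>real_of_int x - 1/2 - r - of_int y\<bar> \<le> 1/2 \<longleftrightarrow> y = x - 1"
    "\<bar>real_of_int x + t - of_int y\<bar> \<le> 1/2 \<longleftrightarrow> y = x"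
    "\<bar>real_of_int x - t - of_int y\<bar> \<le> 1/2 \<longleftrightarrow> y = x" for x y :: int
    subgoal using assms(3,4) by (intro iffI; (linarith | simp))
    subgoal using assms(3,4) by (intro iffI; (linarith | simp))
    subgoal using assms(2) by (intro iffI; (linarith | simp))
    subgoal using assms(2) by (intro iffI; (linarith | simp))
    done
  show "side v a t + r *\<^sub>R (emb a - emb v) \<in> unit_square (emb i) \<longleftrightarrow> i = a"
    using assms(1)
  proof (cases rule: nb_cases)
    case 1
    have e: "side v a t + r *\<^sub>R (emb a - emb v) = (of_int (fst v) - 1/2 - r, of_int (snd v) - t)"
      unfolding side_def emb_def 1 by (simp add: field_simps 1)
    show ?thesis unfolding e unit_square_iff fst_conv snd_conv * using 1 by (auto simp: prod_eq_iff)
  next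
    case 2
    have e: "side v a t + r *\<^sub>R (emb a - emb v) = (of_int (fst v) + 1/2 + r, of_int (snd v) + t)"
      unfolding side_def emb_def 2 by (simp add: field_simps 2)
    show ?thesis unfolding e unit_square_iff fst_conv snd_conv * using 2 by (auto simp: prod_eq_iff)
  next
    case 3
    have e: "side v a t + r *\<^sub>R (emb a - emb v) = (of_int (fst v) + t, of_int (snd v) - 1/2 - r)"
      unfolding side_def emb_def 3 by (simp add: field_simps 3)
    show ?thesis unfolding e unit_square_iff fst_conv snd_conv * using 3 by (auto simp: prod_eq_iff)
  next
    case 4
    have e: "side v a t + r *\<^sub>R (emb a - emb v) = (of_int (fst v) - t, of_int (snd v) + 1/2 + r)"
      unfolding side_def emb_def 4 by (simp add: field_simps 4)
    show ?thesis unfolding e unit_square_iff fst_conv snd_conv * using 4 by (auto simp: prod_eq_iff)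
  qed
  show "norm (r *\<^sub>R (emb a - emb v)) = r"
    using assms(1) by (cases rule: nb_cases) (use assms(3) in \<open>auto simp: emb_def norm_Pair\<close>)
qed

lemma side_frontier:
  assumes va: "(v, a) \<in> bd X" and t: "\<bar>t\<bar> < 1/2" shows "side v a t \<in> frontier (cu X)"
proof -
  have a: "v \<in> X" "a \<notin> X" "a \<in> nb v" using va by (auto simp: bd_def)
  have "side v a t \<in> cu X" using side_squares[OF a(3) t] a by (auto simp: cu_iff)
  moreover have "side v a t \<notin> interior (cu X)"
  proof
    assume "side v a t \<in> interior (cu X)"
    then obtain e where e: "0 < e" "ball (side v a t) e \<subseteq> cu X" by (auto simp: mem_interior)
    define r where "r = min (e / 2) (1 / 4)"
    have r: "0 < r" "r < 1/2" "r < e" using e by (auto simp: r_def)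
    have "side v a t + r *\<^sub>R (emb a - emb v) \<in> ball (side v a t) e"
      using side_beyond(2)[OF a(3) t r(1,2)] r(3) by (simp add: dist_norm)
    then have "side v a t + r *\<^sub>R (emb a - emb v) \<in> cu X" using e(2) by blast
    then show False unfolding cu_iff side_beyond(1)[OF a(3) t r(1,2)] using a(2) by blast
  qed
  ultimately show ?thesis using closed_cu[of X] by (simp add: frontier_def)
qed

lemma frontier_cu_subset: "frontier (cu X) \<subseteq> (\<Union>(v, a)\<in>bd X. side v a ` {-1/2..1/2})"
proof
  fix x assume x: "x \<in> frontier (cu X)"
  have "x \<in> cu X" using x closed_cu[of X] by (simp add: frontier_def)
  then obtain v where v: "v \<in> X" "x \<in> unit_square (emb v)" by (auto simp: cu_iff)
  have "\<exists>i. i \<notin> X \<and> x \<in> unit_square (emb i)"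
  proof (rule ccontr)
    assume c: "\<not> ?thesis"
    obtain e where e: "0 < e" "\<And>y i. dist y x < e \<Longrightarrow> y \<in> unit_square (emb i) \<Longrightarrow> x \<in> unit_square (emb i)"
      using near_squares[of x] by blast
    have "ball x e \<subseteq> cu X"
    proof
      fix y assume "y \<in> ball x e"
      moreover obtain i where "y \<in> unit_square (emb i)" using in_some_square by blast
      ultimately show "y \<in> cu X" using e(2)[of y i] c unfolding cu_iff by (metis dist_commute mem_ball)
    qed
    then have "x \<in> interior (cu X)" using e(1) by (auto simp: mem_interior)
    then show False using x by (simp add: frontier_def)
  qed
  then obtain i where i: "i \<notin> X" "x \<in> unit_square (emb i)" by blast
  \<comment> \<open>The cell in the column of v and the row of i contains x as well; along v, j, i
    membership in X changes across a common side.\<close>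
  define j where "j = (fst v, snd i)"
  have j: "x \<in> unit_square (emb j)" using v i by (simp add: unit_square_iff j_def)
  have near: "\<bar>p - q\<bar> \<le> 1" if "\<bar>s - real_of_int p\<bar> \<le> 1/2" "\<bar>s - of_int q\<bar> \<le> 1/2" for p q :: int and s
  proof -
    have "real_of_int \<bar>p - q\<bar> \<le> 1" using that by linarith
    then show ?thesis by linarith
  qed
  have d: "\<bar>fst v - fst i\<bar> \<le> 1" "\<bar>snd v - snd i\<bar> \<le> 1"
    using v i near unfolding unit_square_iff by blast+
  have "\<exists>v' a. (v', a) \<in> bd X \<and> x \<in> unit_square (emb v') \<and> x \<in> unit_square (emb a)"
  proof (cases "j \<in> X")
    case True
    then have "fst v \<noteq> fst i" using i(1) unfolding j_def by (metis prod.collapse)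
    then have "fst i = fst v - 1 \<or> fst i = fst v + 1" using d by linarith
    then have "i \<in> nb j" by (auto simp: nb_def j_def prod_eq_iff)
    then have "(j, i) \<in> bd X" using True i by (simp add: bd_def)
    then show ?thesis using i j by blast
  next
    case False
    then have "snd v \<noteq> snd i" using v(1) unfolding j_def by (metis prod.collapse)
    then have "snd i = snd v - 1 \<or> snd i = snd v + 1" using d by linarith
    then have "j \<in> nb v" by (auto simp: nb_def j_def prod_eq_iff)
    then have "(v, j) \<in> bd X" using False v by (simp add: bd_def)
    then show ?thesis using v j by blast
  qed
  then obtain v a where va: "(v, a) \<in> bd X" "x \<in> unit_square (emb v)" "x \<in> unit_square (emb a)" by blast
  have "a \<in> nb v" using va by (auto simp: bd_def)
  have u: "\<bar>fst x - of_int (fst v)\<bar> \<le> 1/2" "\<bar>snd x - of_int (snd v)\<bar> \<le> 1/2"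
    "\<bar>fst x - of_int (fst a)\<bar> \<le> 1/2" "\<bar>snd x - of_int (snd a)\<bar> \<le> 1/2"
    using va(2,3) unfolding unit_square_iff by auto
  from \<open>a \<in> nb v\<close> have "\<exists>t. x = side v a t \<and> \<bar>t\<bar> \<le> 1/2"
  proof (cases rule: nb_cases)
    case 1
    then have "real_of_int (fst a) = of_int (fst v) - 1" by simp
    then have "fst x = of_int (fst v) - 1/2" using u by linarith
    moreover have "side v a (of_int (snd v) - snd x) = (of_int (fst v) - 1/2, snd x)"
      unfolding side_def 1 by (simp add: field_simps)
    ultimately have "x = side v a (of_int (snd v) - snd x)" by (simp add: prod_eq_iff)
    moreover have "\<bar>of_int (snd v) - snd x\<bar> \<le> 1/2" using u by linarith
    ultimately show ?thesis by blast
  next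
    case 2
    then have "real_of_int (fst a) = of_int (fst v) + 1" by simp
    then have "fst x = of_int (fst v) + 1/2" using u by linarith
    moreover have "side v a (snd x - of_int (snd v)) = (of_int (fst v) + 1/2, snd x)"
      unfolding side_def 2 by (simp add: field_simps)
    ultimately have "x = side v a (snd x - of_int (snd v))" by (simp add: prod_eq_iff)
    moreover have "\<bar>snd x - of_int (snd v)\<bar> \<le> 1/2" using u by linarith
    ultimately show ?thesis by blast
  next
    case 3
    then have "real_of_int (snd a) = of_int (snd v) - 1" by simp
    then have "snd x = of_int (snd v) - 1/2" using u by linarith
    moreover have "side v a (fst x - of_int (fst v)) = (fst x, of_int (snd v) - 1/2)"
      unfolding side_def 3 by (simp add: field_simps)
    ultimately have "x = side v a (fst x - of_int (fst v))" by (simp add: prod_eq_iff)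
    moreover have "\<bar>fst x - of_int (fst v)\<bar> \<le> 1/2" using u by linarith
    ultimately show ?thesis by blast
  next
    case 4
    then have "real_of_int (snd a) = of_int (snd v) + 1" by simp
    then have "snd x = of_int (snd v) + 1/2" using u by linarith
    moreover have "side v a (of_int (fst v) - fst x) = (fst x, of_int (snd v) + 1/2)"
      unfolding side_def 4 by (simp add: field_simps)
    ultimately have "x = side v a (of_int (fst v) - fst x)" by (simp add: prod_eq_iff)
    moreover have "\<bar>of_int (fst v) - fst x\<bar> \<le> 1/2" using u by linarith
    ultimately show ?thesis by blast
  qed
  then obtain t where t: "x = side v a t" "\<bar>t\<bar> \<le> 1/2" by blast
  have "t \<in> {-1/2..1/2}" using t(2) unfolding abs_le_iff by simp
  then have "x \<in> side v a ` {-1/2..1/2}" using t(1) by blast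
  then show "x \<in> (\<Union>(v, a)\<in>bd X. side v a ` {-1/2..1/2})" using va(1) by blast
qed

section \<open>Hausdorff measure of the boundary\<close>

lemma hausdorff1_delta_le_sum:
  fixes A :: "'a::metric_space set"
  assumes J: "finite J" and cover: "A \<subseteq> (\<Union>j\<in>J. U j)" and \<delta>: "0 \<le> \<delta>"
    and U: "\<And>j. j \<in> J \<Longrightarrow> bounded (U j)" "\<And>j. j \<in> J \<Longrightarrow> diameter (U j) \<le> \<delta>"
  shows "hausdorff1_delta \<delta> A \<le> (\<Sum>j\<in>J. ennreal (diameter (U j)))"
proof -
  obtain h where h: "bij_betw h {0..<card J} J" using ex_bij_betw_nat_finite[OF J] by blast
  define V where "V k = (if k < card J then U (h k) else {})" for k
  have hJ: "h k \<in> J" if "k < card J" for k using h that by (auto simp: bij_betw_def)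
  have "A \<subseteq> (\<Union>k. V k)"
  proof
    fix x assume "x \<in> A"
    then obtain j where j: "j \<in> J" "x \<in> U j" using cover by blast
    then have "j \<in> h ` {0..<card J}" using h by (simp add: bij_betw_def)
    then obtain k where "k < card J" "j = h k" by auto
    then show "x \<in> (\<Union>k. V k)" using j by (auto simp: V_def)
  qed
  moreover have "bounded (V k) \<and> diameter (V k) \<le> \<delta>" for k
    using U hJ \<delta> by (auto simp: V_def)
  ultimately have "hausdorff1_delta \<delta> A \<le> (\<Sum>k. ennreal (diameter (V k)))"
    unfolding hausdorff1_delta_def by (intro INF_lower) auto
  also have "\<dots> = (\<Sum>k\<in>{0..<card J}. ennreal (diameter (V k)))"
    by (rule suminf_finite) (auto simp: V_def)
  also have "\<dots> = (\<Sum>k\<in>{0..<card J}. ennreal (diameter (U (h k))))"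
    by (intro sum.cong) (auto simp: V_def)
  also have "\<dots> = (\<Sum>j\<in>J. ennreal (diameter (U j)))"
    by (rule sum.reindex_bij_betw[OF h])
  finally show ?thesis .
qed

lemma finite_bd: "finite X \<Longrightarrow> finite (bd X)"
  unfolding bd_def by (intro finite_SigmaI) (auto simp: finite_nb)

text \<open>Each side is cut into m pieces of length 1 / m \<le> \<delta>, which leaves the total
  length unchanged.\<close>

lemma hausdorff1_frontier_le:
  assumes X: "finite X" shows "hausdorff1 (frontier (cu X)) \<le> of_nat (card (bd X))"
  unfolding hausdorff1_def
proof (rule SUP_least)
  fix \<delta> :: real assume "\<delta> \<in> {0<..}"
  then have \<delta>: "0 < \<delta>" by simp
  obtain m0 :: nat where m0: "inverse (of_nat (Suc m0)) < \<delta>" using reals_Archimedean[OF \<delta>] by blast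
  define m where "m = Suc m0"
  have m: "0 < m" "1 / real m \<le> \<delta>" using m0 by (auto simp: m_def inverse_eq_divide)
  define U where "U = (\<lambda>((v, a), k). side v a ` {-1/2 + real k / m..-1/2 + (real k + 1) / m})"
  have dU: "dist x y \<le> 1 / m" if va: "(v, a) \<in> bd X" and xy: "x \<in> U ((v, a), k)" "y \<in> U ((v, a), k)"
    for v a k x y
  proof -
    obtain t t' where t: "x = side v a t" "y = side v a t'" "-1/2 + real k / m \<le> t"
        "t \<le> -1/2 + (real k + 1) / m" "-1/2 + real k / m \<le> t'" "t' \<le> -1/2 + (real k + 1) / m"
      using xy by (auto simp: U_def)
    have "\<bar>t - t'\<bar> \<le> 1 / m" using t(3-) by (simp add: add_divide_distrib abs_le_iff)
    then show ?thesis using t va dist_side[of a v t t'] by (auto simp: bd_def)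
  qed
  have dm: "diameter (U j) \<le> 1 / m" if "j \<in> bd X \<times> {..<m}" for j
    using that m dU by (cases j) (auto intro!: diameter_le simp: dist_norm)
  have "hausdorff1_delta \<delta> (frontier (cu X)) \<le> (\<Sum>j\<in>bd X \<times> {..<m}. ennreal (diameter (U j)))"
  proof (rule hausdorff1_delta_le_sum)
    show "finite (bd X \<times> {..<m})" using finite_bd[OF X] by simp
    show "bounded (U j)" if "j \<in> bd X \<times> {..<m}" for j
    proof (cases j)
      case (Pair e k)
      then have "\<forall>x\<in>U j. \<forall>y\<in>U j. dist x y \<le> 1 / m" using that dU by (cases e) auto
      then show ?thesis unfolding bounded_two_points by blast
    qed
    show "diameter (U j) \<le> \<delta>" if "j \<in> bd X \<times> {..<m}" for j using dm[OF that] m by simp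
    show "frontier (cu X) \<subseteq> (\<Union>j\<in>bd X \<times> {..<m}. U j)"
    proof
      fix x assume "x \<in> frontier (cu X)"
      then obtain v a t where va: "(v, a) \<in> bd X" "x = side v a t" "-1/2 \<le> t" "t \<le> 1/2"
        using frontier_cu_subset[of X] by fastforce
      define r where "r = (t + 1/2) * m"
      have r: "0 \<le> r" "r \<le> m" using va m by (auto simp: r_def mult_le_cancel_right1)
      \<comment> \<open>The end point r = m belongs to the last piece, as there is no piece of index
        m.\<close>
      define k where "k = (if r = m then m - 1 else nat \<lfloor>r\<rfloor>)"
      have k: "k < m" "real k \<le> r" "r \<le> real k + 1"
        using r m by (auto simp: k_def of_nat_diff) linarith+
      have "t = -1/2 + r / m" using m by (simp add: r_def)
      moreover have "real k / m \<le> r / m" "r / m \<le> (real k + 1) / m"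
        using k by (auto intro: divide_right_mono)
      ultimately have "x \<in> U ((v, a), k)" using va by (auto simp: U_def)
      then show "x \<in> (\<Union>j\<in>bd X \<times> {..<m}. U j)" using va(1) k(1) by blast
    qed
  qed (use \<delta> in simp)
  also have "\<dots> \<le> (\<Sum>j\<in>bd X \<times> {..<m}. ennreal (1 / m))"
    using dm by (intro sum_mono ennreal_leI)
  also have "\<dots> = of_nat (card (bd X) * m) * ennreal (1 / m)"
    by (simp add: card_cartesian_product)
  also have "\<dots> = ennreal (real (card (bd X) * m) * (1 / m))"
    unfolding ennreal_of_nat_eq_real_of_nat by (rule ennreal_mult[symmetric]) auto
  also have "real (card (bd X) * m) * (1 / m) = real (card (bd X))" using m by simp
  also have "ennreal (real (card (bd X))) = of_nat (card (bd X))"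
    by (simp add: ennreal_of_nat_eq_real_of_nat)
  finally show "hausdorff1_delta \<delta> (frontier (cu X)) \<le> of_nat (card (bd X))" .
qed

text \<open>The parameters sent into \<open>U n\<close> span an interval no longer than its
  diameter, and Lebesgue measure is subadditive. Sets missing the segment are charged 0, so that one
  set need not pay for several segments.\<close>

lemma segment_cover_le:
  fixes g :: "real \<Rightarrow> 'a::metric_space"
  assumes h: "0 \<le> h" and g: "\<And>t t'. dist (g t) (g t') = \<bar>t - t'\<bar>"
    and cover: "g ` {-h..h} \<subseteq> (\<Union>n. U n)" and bdd: "\<And>n::nat. bounded (U n)"
  shows "ennreal (2 * h) \<le> (\<Sum>n. ennreal (if U n \<inter> g ` {-h..h} = {} then 0 else diameter (U n)))"
proof -
  define A where "A n = {t \<in> {-h..h}. g t \<in> U n}" for n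
  define S where "S n = (if A n = {} then {} else {Inf (A n)..Sup (A n)})" for n
  have bA: "bdd_below (A n)" "bdd_above (A n)" for n
    by (auto simp: A_def intro!: bdd_belowI[of _ "-h"] bdd_aboveI[of _ h])
  have "{-h..h} \<subseteq> (\<Union>n. S n)"
  proof
    fix t assume t: "t \<in> {-h..h}"
    then obtain n where "g t \<in> U n" using cover by blast
    then have "t \<in> A n" using t by (simp add: A_def)
    then have "t \<in> S n" using bA[of n] by (auto simp: S_def intro: cInf_lower cSup_upper)
    then show "t \<in> (\<Union>n. S n)" by blast
  qed
  then have "emeasure lborel {-h..h} \<le> emeasure lborel (\<Union>n. S n)"
    by (intro emeasure_mono) (auto simp: S_def)
  also have "\<dots> \<le> (\<Sum>n. emeasure lborel (S n))"
    by (intro emeasure_subadditive_countably) (auto simp: S_def)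
  also have "\<dots> \<le> (\<Sum>n. ennreal (if U n \<inter> g ` {-h..h} = {} then 0 else diameter (U n)))"
  proof (intro suminf_le summableI)
    fix n
    show "emeasure lborel (S n) \<le> ennreal (if U n \<inter> g ` {-h..h} = {} then 0 else diameter (U n))"
    proof (cases "A n = {}")
      case False
      then have ne: "U n \<inter> g ` {-h..h} \<noteq> {}" by (auto simp: A_def)
      have le: "t - t' \<le> diameter (U n)" if "t \<in> A n" "t' \<in> A n" for t t'
      proof -
        have "dist (g t) (g t') \<le> diameter (U n)"
          using that bdd by (intro diameter_bounded_bound) (auto simp: A_def)
        then show ?thesis using g[of t t'] by simp
      qed
      have "Sup (A n) \<le> diameter (U n) + t'" if "t' \<in> A n" for t'
        using le[OF _ that] by (intro cSup_least[OF False]) (simp add: algebra_simps)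
      then have "Sup (A n) - diameter (U n) \<le> Inf (A n)"
        by (intro cInf_greatest[OF False]) (simp add: algebra_simps)
      moreover have "Inf (A n) \<le> Sup (A n)" using False bA by (intro cInf_le_cSup)
      ultimately show ?thesis using False ne by (simp add: S_def ennreal_leI)
    qed (simp add: S_def)
  qed
  finally show ?thesis using h by simp
qed

text \<open>Sides shortened to length z < 1 are disjoint compact sets, hence at positive distances;
  sets of small diameter meet at most one of them, so the lengths add. Then z tends to 1. Working
  with finite T also covers infinite X.\<close>

lemma card_le_hausdorff1_frontier:
  assumes T: "finite T" "T \<subseteq> bd X"
  shows "of_nat (card T) \<le> hausdorff1 (frontier (cu X))"
proof -
  have main: "ennreal (z * card T) \<le> hausdorff1 (frontier (cu X))" if z: "0 < z" "z < 1" for z :: real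
  proof -
    define S where "S = (\<lambda>(v, a). side v a ` {-(z/2)..z/2})"
    have Sdisj: "S e \<inter> S e' = {}" if e: "e \<in> T" "e' \<in> T" "e \<noteq> e'" for e e'
    proof (rule ccontr)
      assume "S e \<inter> S e' \<noteq> {}"
      then obtain x where x: "x \<in> S e" "x \<in> S e'" by blast
      obtain v a v' a' where va: "e = (v, a)" "e' = (v', a')" by (cases e; cases e')
      have b: "v \<in> X" "a \<notin> X" "a \<in> nb v" "v' \<in> X" "a' \<notin> X" "a' \<in> nb v'"
        using e T va by (auto simp: bd_def)
      obtain t where t1: "x = side v a t" "t \<in> {-(z/2)..z/2}" using x(1) unfolding S_def va by auto
      obtain t' where t2: "x = side v' a' t'" "t' \<in> {-(z/2)..z/2}" using x(2) unfolding S_def va by auto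
      have t: "x = side v a t" "x = side v' a' t'" "\<bar>t\<bar> < 1/2" "\<bar>t'\<bar> < 1/2"
        using z t1 t2 by (auto simp: abs_less_iff)
      have "i = v \<or> i = a \<longleftrightarrow> i = v' \<or> i = a'" for i
        using side_squares[OF b(3) t(3), of i] side_squares[OF b(6) t(4), of i] t(1,2) by simp
      then have "v = v'" "a = a'" using b by metis+
      then show False using e va by simp
    qed
    have compS: "compact (S e)" if "e \<in> T" for e
    proof -
      obtain v a where e: "e = (v, a)" by (cases e)
      have "continuous_on {-(z/2)..z/2} (side v a)"
        unfolding side_def by (intro continuous_intros)
      then show ?thesis unfolding S_def e by (auto intro: compact_continuous_image)
    qed
    define P where "P = {(e, e'). e \<in> T \<and> e' \<in> T \<and> e \<noteq> e'}"
    have fP: "finite P" by (rule finite_subset[of _ "T \<times> T"]) (use T in \<open>auto simp: P_def\<close>)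
    have "\<exists>r>0. \<forall>x\<in>S (fst p). \<forall>y\<in>S (snd p). r \<le> dist x y" if "p \<in> P" for p
    proof -
      have "fst p \<in> T" "snd p \<in> T" "fst p \<noteq> snd p" using that by (auto simp: P_def)
      then show ?thesis
        using separate_compact_closed[OF compS compact_imp_closed[OF compS] Sdisj] by blast
    qed
    then obtain r where r: "\<And>p. p \<in> P \<Longrightarrow> 0 < r p"
      "\<And>p x y. p \<in> P \<Longrightarrow> x \<in> S (fst p) \<Longrightarrow> y \<in> S (snd p) \<Longrightarrow> r p \<le> dist x y" by metis
    define \<delta> where "\<delta> = Min (insert 1 (r ` P)) / 2"
    have "0 < Min (insert 1 (r ` P))" using fP r(1) by (subst Min_gr_iff) auto
    then have \<delta>: "0 < \<delta>" by (simp add: \<delta>_def)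
    have \<delta>r: "\<delta> < r p" if "p \<in> P" for p
    proof -
      have "Min (insert 1 (r ` P)) \<le> r p" using fP that by simp
      then show ?thesis using \<delta> by (simp add: \<delta>_def)
    qed
    have SX: "S e \<subseteq> frontier (cu X)" if "e \<in> T" for e
    proof -
      obtain v a where e: "e = (v, a)" by (cases e)
      then have "(v, a) \<in> bd X" using that T by auto
      then show ?thesis using z by (auto simp: S_def e intro!: side_frontier simp: abs_less_iff)
    qed
    have "ennreal (z * card T) \<le> hausdorff1_delta \<delta> (frontier (cu X))"
      unfolding hausdorff1_delta_def
    proof (rule INF_greatest, clarify)
      fix U :: "nat \<Rightarrow> plane set"
      assume cov: "frontier (cu X) \<subseteq> (\<Union>n. U n)" and U: "\<forall>n. bounded (U n) \<and> diameter (U n) \<le> \<delta>"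
      define D where "D e n = ennreal (if U n \<inter> S e = {} then 0 else diameter (U n))" for e n
      have one: "(\<Sum>e\<in>T. D e n) \<le> ennreal (diameter (U n))" for n
      proof (cases "\<exists>e\<in>T. U n \<inter> S e \<noteq> {}")
        case True
        then obtain e x where e: "e \<in> T" "x \<in> U n" "x \<in> S e" by blast
        have "U n \<inter> S e' = {}" if "e' \<in> T - {e}" for e'
        proof (rule ccontr)
          assume "U n \<inter> S e' \<noteq> {}"
          then obtain y where y: "y \<in> U n" "y \<in> S e'" by blast
          have p: "(e, e') \<in> P" using that e by (auto simp: P_def)
          have "dist x y \<le> \<delta>" using diameter_bounded_bound[of "U n" x y] U e y by (meson order_trans)
          then show False using r(2)[OF p, of x y] e y \<delta>r[OF p] by simp
        qed
        then have "(\<Sum>e\<in>T. D e n) = D e n"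
          using T e by (subst sum.remove[of T e]) (auto simp: D_def intro!: sum.neutral)
        also have "\<dots> \<le> ennreal (diameter (U n))" by (simp add: D_def)
        finally show ?thesis .
      qed (simp add: D_def)
      have each: "ennreal z \<le> (\<Sum>n. D e n)" if "e \<in> T" for e
      proof -
        obtain v a where e: "e = (v, a)" by (cases e)
        have "a \<in> nb v" using that T e by (auto simp: bd_def)
        then show ?thesis
          using segment_cover_le[of "z / 2" "side v a" U] z dist_side SX[OF that] cov U
          unfolding D_def S_def e by auto
      qed
      have "ennreal (z * card T) = (\<Sum>e\<in>T. ennreal z)"
        using z by (simp add: ennreal_mult'' ennreal_of_nat_eq_real_of_nat mult.commute)
      also have "\<dots> \<le> (\<Sum>e\<in>T. \<Sum>n. D e n)" using each by (rule sum_mono)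
      also have "\<dots> = (\<Sum>n. \<Sum>e\<in>T. D e n)" by (rule suminf_sum[symmetric]) simp
      also have "\<dots> \<le> (\<Sum>n. ennreal (diameter (U n)))"
        by (intro suminf_le one summableI)
      finally show "ennreal (z * card T) \<le> (\<Sum>n. ennreal (diameter (U n)))" .
    qed
    also have "\<dots> \<le> hausdorff1 (frontier (cu X))"
      unfolding hausdorff1_def using \<delta> by (intro SUP_upper) auto
    finally show ?thesis .
  qed
  show ?thesis
  proof (cases "hausdorff1 (frontier (cu X))")
    case (real r)
    have "z * real (card T) \<le> r" if "0 < z" "z < 1" for z
      using main[OF that] real that by (simp add: ennreal_le_iff)
    then have "real (card T) \<le> r" by (rule field_le_mult_one_interval)
    then show ?thesis using real by (simp add: ennreal_of_nat_eq_real_of_nat ennreal_leI)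
  qed simp
qed

lemma hausdorff1_frontier: "finite X \<Longrightarrow> hausdorff1 (frontier (cu X)) = of_nat (card (bd X))"
  using hausdorff1_frontier_le card_le_hausdorff1_frontier[of "bd X" X] finite_bd
  by (intro antisym) auto

section \<open>The minimization problem\<close>

lemma finite_perimeter_cu: "finite X \<Longrightarrow> finite_perimeter (cu X)"
  by (simp add: finite_perimeter_def hausdorff1_frontier of_nat_less_top)

text \<open>Even points are never adjacent, so every cell contributes its right side to the
  boundary.\<close>

lemma finite_of_finite_perimeter:
  assumes ev: "\<And>v. v \<in> X \<Longrightarrow> evenp v" and per: "finite_perimeter (cu X)"
  shows "finite X"
proof (rule ccontr)
  assume inf: "infinite X"
  obtain r where r: "hausdorff1 (frontier (cu X)) = ennreal r" "0 \<le> r"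
    using per by (cases "hausdorff1 (frontier (cu X))") (auto simp: finite_perimeter_def)
  obtain n :: nat where n: "r < n" using reals_Archimedean2 by blast
  obtain S where S: "S \<subseteq> X" "finite S" "card S = n"
    using infinite_arbitrarily_large[OF inf] by blast
  define T where "T = (\<lambda>v. (v, (fst v + 1, snd v))) ` S"
  have "T \<subseteq> bd X"
  proof
    fix e assume "e \<in> T"
    then obtain v where v: "v \<in> S" "e = (v, (fst v + 1, snd v))" by (auto simp: T_def)
    then have "evenp v" using S ev by blast
    then have "(fst v + 1, snd v) \<notin> X" using ev[of "(fst v + 1, snd v)"] by (auto simp: evenp_def)
    then show "e \<in> bd X" using v S by (auto simp: bd_def nb_def)
  qed
  moreover have "card T = n" unfolding T_def using S by (subst card_image) (auto intro: inj_onI)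
  ultimately have "of_nat n \<le> ennreal r"
    using card_le_hausdorff1_frontier[of T X] S r by (simp add: T_def)
  then show False using n r by (simp add: ennreal_of_nat_eq_real_of_nat ennreal_le_iff)
qed

lemma energy_infinity:
  assumes "finite_perimeter E'" "0 < \<alpha>"
    and "(\<Sum>\<^sub>\<infinity>i \<in> sym_diff (centers E') (centers E). boundary_dist \<phi> i E) = \<infinity>"
  shows "energy \<phi> \<alpha> E' E = \<infinity>"
proof -
  obtain r where "hausdorff1 (frontier E') = ennreal r" "0 \<le> r"
    using assms(1) by (cases "hausdorff1 (frontier E')") (auto simp: finite_perimeter_def)
  then show ?thesis using assms(2,3) by (simp add: energy_def enn2ereal_ennreal)
qed

text \<open>The distance from the empty set is \<infinity>, which makes the energy of every nonempty
  competitor infinite. The case is separate because \<open>lattice_body\<close> asks for a nonempty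
  I.\<close>

lemma is_solution_empty:
  assumes "0 < \<alpha>" shows "is_solution \<phi> \<alpha> {} E' \<longleftrightarrow> E' = {}"
proof -
  have e: "energy \<phi> \<alpha> {} {} = 0"
    using hausdorff1_frontier[of "{}"]
    by (simp add: energy_def centers_def cu_def cell_union_def bd_def zero_ennreal.rep_eq)
  have ne: "energy \<phi> \<alpha> E' {} = \<infinity>" if E': "E' \<in> admissible_sets" "finite_perimeter E'" "E' \<noteq> {}" for E'
  proof (rule energy_infinity[OF E'(2) assms])
    obtain X where X: "E' = cu X" using E'(1) admissible_iff by blast
    have "X \<noteq> {}" using E'(3) by (auto simp: X cu_def cell_union_def)
    have b: "boundary_dist \<phi> i {} = \<infinity>" for i
      by (simp add: boundary_dist_def dist_phi_def centers_def top_ereal_def)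
    have "(\<Sum>\<^sub>\<infinity>i \<in> emb ` X. (\<infinity> :: ereal)) = \<infinity>"
    proof (cases "finite X")
      case True
      then show ?thesis using \<open>X \<noteq> {}\<close> by (simp add: infsum_finite sum_Pinfty)
    next
      case False
      then have "infinite (emb ` X)" by (simp add: finite_image_iff inj_on_def emb_inj)
      then show ?thesis by (intro infsum_superconst_infinite_ereal[of _ 1]) auto
    qed
    then show "(\<Sum>\<^sub>\<infinity>i \<in> sym_diff (centers E') (centers {}). boundary_dist \<phi> i {}) = \<infinity>"
      by (simp add: b X centers_cu, simp add: centers_def)
  qed
  have "({} :: plane set) = cu {}" by (simp add: cu_def cell_union_def)
  then have a: "{} \<in> admissible_sets" "finite_perimeter {}"
    using finite_perimeter_cu[of "{}"] admissible_iff by auto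
  have less: "energy \<phi> \<alpha> {} {} < energy \<phi> \<alpha> E' {}"
    if "E' \<in> admissible_sets" "finite_perimeter E'" "E' \<noteq> {}" for E'
    using ne[OF that] e by simp
  show ?thesis
  proof
    assume s: "is_solution \<phi> \<alpha> {} E'"
    show "E' = {}"
    proof (rule ccontr)
      assume "E' \<noteq> {}"
      then have "energy \<phi> \<alpha> {} {} < energy \<phi> \<alpha> E' {}"
        using s less by (simp add: is_solution_def is_arg_min_def)
      then show False using s a unfolding is_solution_def is_arg_min_def by blast
    qed
  next
    assume E': "E' = {}"
    show "is_solution \<phi> \<alpha> {} E'"
      unfolding is_solution_def is_arg_min_def E' using a less by (metis empty_subsetI less_asym)
  qed
qed

context lattice_body begin

text \<open>A side of a cell is either boundary or shared. A shared side is counted from both cells,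
  while \<open>edges\<close> lists it once, from the odd to the even point.\<close>

lemma card_bd:
  assumes X: "finite X" shows "card (bd X) + 2 * card (edges X) = 4 * card X"
proof -
  have nb4: "card (nb v) = 4" for v by (simp add: nb_def)
  define A where "A = (SIGMA v:X. nb v \<inter> X)"
  have fA: "finite A" "finite (bd X)" "finite (edges X)"
    using X finite_nb by (auto simp: A_def bd_def edges_def intro!: finite_SigmaI)
  have "card (SIGMA v:X. nb v) = 4 * card X"
    using X by (subst card_SigmaI) (auto simp: finite_nb nb4)
  moreover have "(SIGMA v:X. nb v) = bd X \<union> A" "bd X \<inter> A = {}" by (auto simp: bd_def A_def)
  ultimately have 1: "card (bd X) + card A = 4 * card X" using fA by (simp add: card_Un_disjoint)
  have m: "(v, a) \<in> A \<longleftrightarrow> v \<in> X \<and> a \<in> X \<and> a \<in> nb v"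
    "(v, a) \<in> edges X \<longleftrightarrow> v \<in> X \<and> a \<in> X \<and> a \<in> nb v \<and> \<not> evenp v"
    "(v, a) \<in> prod.swap ` edges X \<longleftrightarrow> v \<in> X \<and> a \<in> X \<and> a \<in> nb v \<and> evenp v" for v a
  proof -
    show "(v, a) \<in> A \<longleftrightarrow> v \<in> X \<and> a \<in> X \<and> a \<in> nb v" unfolding A_def by blast
    show e: "(v, a) \<in> edges X \<longleftrightarrow> v \<in> X \<and> a \<in> X \<and> a \<in> nb v \<and> \<not> evenp v" for v a
      unfolding edges_def by blast
    have "(v, a) \<in> prod.swap ` edges X \<longleftrightarrow> (a, v) \<in> edges X"
      by (auto intro!: image_eqI[of _ _ "(a, v)"])
    then show "(v, a) \<in> prod.swap ` edges X \<longleftrightarrow> v \<in> X \<and> a \<in> X \<and> a \<in> nb v \<and> evenp v"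
      unfolding e using nb_parity[of a v] nb_sym[of a v] by blast
  qed
  have "A = edges X \<union> prod.swap ` edges X" unfolding set_eq_iff split_paired_All Un_iff m by blast
  moreover have "edges X \<inter> prod.swap ` edges X = {}"
    unfolding set_eq_iff split_paired_All Int_iff m by blast
  moreover have "card (prod.swap ` edges X) = card (edges X)"
    by (rule card_image) (auto intro: inj_onI)
  ultimately have "card A = 2 * card (edges X)" using fA by (simp add: card_Un_disjoint)
  with 1 show ?thesis by simp
qed

abbreviation \<phi>f :: "plane \<Rightarrow> real" where "\<phi>f \<equiv> \<lambda>p. f (fst p) (snd p)"

lemma dist_phi_dd: "dist_phi \<phi>f (emb v) (emb ` I) = ereal (dd v)"
proof -
  have e: "\<phi>f (emb v - emb p) = n (fst v - fst p) (snd v - snd p)" for p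
    by (simp add: emb_def n_def)
  show ?thesis unfolding dist_phi_def
  proof (rule antisym)
    obtain a b where ab: "(a, b) \<in> I" "dd v = n (fst v - a) (snd v - b)"
      unfolding dd_def by (rule d_attained)
    show "(INF y\<in>emb ` I. ereal (\<phi>f (emb v - y))) \<le> ereal (dd v)"
      by (rule INF_lower2[of "emb (a, b)"]) (use ab e[of "(a, b)"] in auto)
    show "ereal (dd v) \<le> (INF y\<in>emb ` I. ereal (\<phi>f (emb v - y)))"
    proof (rule INF_greatest)
      fix y assume "y \<in> emb ` I"
      then obtain p where p: "p \<in> I" "y = emb p" by blast
      then show "ereal (dd v) \<le> ereal (\<phi>f (emb v - y))"
        using d_le[of "fst p" "snd p" "fst v" "snd v"] e[of p] by (simp add: dd_def)
    qed
  qed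
qed

lemma boundary_dist_dd: "v \<notin> I \<Longrightarrow> boundary_dist \<phi>f (emb v) (cu I) = ereal (dd v)"
  by (simp add: boundary_dist_def centers_cu dist_phi_dd image_iff emb_inj)

lemma sym_diff_emb: "I \<subseteq> X \<Longrightarrow> sym_diff (emb ` X) (emb ` I) = emb ` (X - I)"
  by (auto simp: emb_inj)

text \<open>Since \<alpha> * c = 4, the four sides of a cell become the term c of the gain, and the
  two sides lost by a pair of neighbours become c / 2.\<close>

lemma energy_cu:
  assumes X: "finite X" "I \<subseteq> X" and \<alpha>: "0 < \<alpha>"
  shows "energy \<phi>f \<alpha> (cu X) (cu I) = ereal (- \<alpha> * gain (4 / \<alpha>) X - 4 * card I)"
proof -
  have "(\<Sum>\<^sub>\<infinity>i \<in> emb ` (X - I). boundary_dist \<phi>f i (cu I)) = (\<Sum>i \<in> emb ` (X - I). boundary_dist \<phi>f i (cu I))"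
    using X by (intro infsum_finite) auto
  also have "\<dots> = (\<Sum>v \<in> X - I. boundary_dist \<phi>f (emb v) (cu I))"
    by (subst sum.reindex) (auto simp: inj_on_def emb_inj)
  also have "\<dots> = (\<Sum>v \<in> X - I. ereal (dd v))"
    by (intro sum.cong) (auto simp: boundary_dist_dd)
  also have "\<dots> = ereal (\<Sum>v \<in> X - I. dd v)" by simp
  finally have s: "(\<Sum>\<^sub>\<infinity>i \<in> sym_diff (centers (cu X)) (centers (cu I)). boundary_dist \<phi>f i (cu I)) =
      ereal (\<Sum>v \<in> X - I. dd v)"
    unfolding centers_cu sym_diff_emb[OF X(2)] .
  have h: "enn2ereal (hausdorff1 (frontier (cu X))) = ereal (real (card (bd X)))"
    using X by (simp add: hausdorff1_frontier ennreal_of_nat_eq_real_of_nat enn2ereal_ennreal)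
  have c: "card X = card (X - I) + card I"
    using X fin by (metis card_Diff_subset card_mono le_add_diff_inverse2)
  have b: "real (card (bd X)) = 4 * real (card (X - I)) + 4 * real (card I) - 2 * real (card (edges X))"
    using card_bd[OF X(1)] unfolding c by simp
  have "- real (card (bd X)) + \<alpha> * (\<Sum>v \<in> X - I. dd v) = - \<alpha> * gain (4 / \<alpha>) X - 4 * card I"
    unfolding b gain_def using \<alpha> by (simp add: sum_subtractf algebra_simps)
  then show ?thesis unfolding energy_def s h by simp
qed

text \<open>Outside I the distances are at least 1, so the sum over infinitely many points
  diverges.\<close>

lemma energy_cu_infinite:
  assumes X: "infinite X" "I \<subseteq> X" and \<alpha>: "0 < \<alpha>" and per: "finite_perimeter (cu X)"
  shows "energy \<phi>f \<alpha> (cu X) (cu I) = \<infinity>"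
proof (rule energy_infinity[OF per \<alpha>])
  have "infinite (emb ` (X - I))"
    using X fin by (subst finite_image_iff) (auto simp: inj_on_def emb_inj)
  moreover have "1 \<le> boundary_dist \<phi>f (emb v) (cu I)" if "v \<in> X - I" for v
    using that d_ge_1[of "fst v" "snd v"] by (simp add: boundary_dist_dd dd_def one_ereal_def)
  ultimately show "(\<Sum>\<^sub>\<infinity>i \<in> sym_diff (centers (cu X)) (centers (cu I)). boundary_dist \<phi>f i (cu I)) = \<infinity>"
    unfolding centers_cu sym_diff_emb[OF X(2)]
    by (intro infsum_superconst_infinite_ereal[of _ 1]) auto
qed

lemma is_solution_iff:
  assumes \<alpha>: "0 < \<alpha>" and nc: "\<And>v. evenp v \<Longrightarrow> dd v \<noteq> 4 / \<alpha>"
  shows "is_solution \<phi>f \<alpha> (cu I) E' \<longleftrightarrow> E' = cu (Ia (4 / \<alpha>))"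
proof -
  let ?c = "4 / \<alpha>"
  let ?P = "\<lambda>E'. E' \<in> admissible_sets \<and> finite_perimeter E' \<and> cu I \<subseteq> E'"
  let ?e = "\<lambda>E'. energy \<phi>f \<alpha> E' (cu I)"
  have c: "0 < ?c" using \<alpha> by simp
  have Ia: "?P (cu (Ia ?c))"
    using I_subset_Ia[OF c] finite_perimeter_cu[OF finite_Ia] by (auto simp: admissible_iff cu_subset_iff)
  have eIa: "?e (cu (Ia ?c)) = ereal (- \<alpha> * gain ?c (Ia ?c) - 4 * card I)"
    by (rule energy_cu[OF finite_Ia I_subset_Ia[OF c] \<alpha>])
  have less: "?e (cu (Ia ?c)) < ?e E'" if P: "?P E'" and ne: "E' \<noteq> cu (Ia ?c)" for E'
  proof -
    obtain X where X: "E' = cu X" "I \<subseteq> X" using P by (auto simp: admissible_iff cu_subset_iff)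
    show ?thesis
    proof (cases "finite X")
      case True
      have "gain ?c X < gain ?c (Ia ?c)"
        using gain_max[OF c nc True X(2)] ne X(1) by fastforce
      then show ?thesis unfolding eIa X(1) energy_cu[OF True X(2) \<alpha>] using \<alpha> by simp
    next
      case False
      then show ?thesis using energy_cu_infinite[OF False X(2) \<alpha>] P X(1) eIa by simp
    qed
  qed
  show ?thesis
  proof
    assume "is_solution \<phi>f \<alpha> (cu I) E'"
    then show "E' = cu (Ia ?c)" using Ia less[of E'] by (auto simp: is_solution_def is_arg_min_def)
  next
    assume "E' = cu (Ia ?c)"
    then show "is_solution \<phi>f \<alpha> (cu I) E'"
      using Ia less unfolding is_solution_def is_arg_min_def by (metis less_asym less_irrefl)
  qed
qed

end

section \<open>Closure properties from convexity and symmetry\<close>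

lemma convex_refl_mem:
  fixes C :: "plane set"
  assumes C: "convex C" and p: "p \<in> C" "q \<in> C" and m: "p + q = 2 *\<^sub>R r" "p - q = 2 *\<^sub>R s" and t: "\<bar>t\<bar> \<le> 1"
  shows "r + t *\<^sub>R s \<in> C"
proof -
  have "((1 + t) / 2) *\<^sub>R p + ((1 - t) / 2) *\<^sub>R q \<in> C"
    using t by (intro convexD[OF C p]) (auto simp: abs_le_iff add_divide_distrib[symmetric])
  moreover have "((1 + t) / 2) *\<^sub>R p + ((1 - t) / 2) *\<^sub>R q = (1/2) *\<^sub>R (p + q) + (t / 2) *\<^sub>R (p - q)"
    by (simp add: algebra_simps add_divide_distrib diff_divide_distrib)
  ultimately show ?thesis by (simp add: m)
qed

lemma convex_symmetric_coordinate:
  fixes C :: "plane set"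
  assumes C: "convex C"
  shows "(x, y) \<in> C \<Longrightarrow> (- x, y) \<in> C \<Longrightarrow> \<bar>x'\<bar> \<le> \<bar>x\<bar> \<Longrightarrow> (x', y) \<in> C"
    and "(x, y) \<in> C \<Longrightarrow> (x, - y) \<in> C \<Longrightarrow> \<bar>y'\<bar> \<le> \<bar>y\<bar> \<Longrightarrow> (x, y') \<in> C"
proof -
  have q: "\<bar>s / t\<bar> \<le> 1" "s / t * t = s" if "\<bar>s\<bar> \<le> \<bar>t\<bar>" for s t :: real
    using that by (auto simp: abs_divide divide_le_eq_1)
  show "(x', y) \<in> C" if "(x, y) \<in> C" "(- x, y) \<in> C" "\<bar>x'\<bar> \<le> \<bar>x\<bar>"
    using convex_refl_mem[OF C that(1,2), of "(0, y)" "(x, 0)" "x' / x"] q[OF that(3)] by simp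
  show "(x, y') \<in> C" if "(x, y) \<in> C" "(x, - y) \<in> C" "\<bar>y'\<bar> \<le> \<bar>y\<bar>"
    using convex_refl_mem[OF C that(1,2), of "(x, 0)" "(0, y)" "y' / y"] q[OF that(3)] by simp
qed

theorem proposition30:
  fixes \<phi> :: "real \<times> real \<Rightarrow> real" and \<alpha> :: real and E :: "(real \<times> real) set"
  assumes "is_norm \<phi>" and "symmetric_norm \<phi>" and "absolute_norm \<phi>" and "normalized_norm \<phi>"
    and "\<forall>h :: nat. \<phi> (real h, real h + 1) - \<phi> (real h, real h) \<ge> 1 / 2"
    and "\<alpha> > 0" and "\<alpha> \<notin> Lambda_phi \<phi>"
    and "E \<in> even_convex_sets" and "finite_perimeter E"
    and N: "\<forall>i \<in> eff_boundary E. nondegenerate E i"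
    and M: "\<forall>ls ls'. edge_precedes E ls ls' \<longrightarrow>
              signed_angle (edge_normal ls') (edge_normal ls) < 0"
    and Sym: "dihedral_symmetric E"
  shows "(\<exists>!E\<alpha>. is_solution \<phi> \<alpha> E E\<alpha>) \<and>
    (\<forall>E\<alpha>. is_solution \<phi> \<alpha> E E\<alpha> \<longrightarrow>
       centers E\<alpha> = {i \<in> even_lattice. dist_phi \<phi> i (centers E) < ereal (4 / \<alpha>)} \<and>
       E\<alpha> \<in> even_convex_sets)"
proof (cases "E = {}")
  case True
  have "dist_phi \<phi> i {} = \<infinity>" for i by (simp add: dist_phi_def top_ereal_def)
  then show ?thesis
    using is_solution_empty[OF \<open>\<alpha> > 0\<close>, of \<phi>] True \<open>E \<in> even_convex_sets\<close>
    by (auto simp: centers_def)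
next
  case False
  obtain I where E: "E = cu I"
    using \<open>E \<in> even_convex_sets\<close> admissible_iff by (auto simp: even_convex_sets_def)
  have cE: "centers E = emb ` I" by (simp add: E centers_cu)
  have even_I: "evenp p" if "p \<in> I" for p
  proof -
    have "emb p \<in> emb ` Collect evenp"
      using that \<open>E \<in> even_convex_sets\<close> by (auto simp: even_convex_sets_def cE even_lattice_emb)
    then show ?thesis by (auto simp: emb_inj)
  qed
  have hull_I: "p \<in> I" if "evenp p" "emb p \<in> convex hull (emb ` I)" for p
  proof -
    have "emb p \<in> (convex hull (emb ` I)) \<inter> even_lattice" using that by (auto simp: even_lattice_emb)
    also have "\<dots> = emb ` I"
      using \<open>E \<in> even_convex_sets\<close> unfolding even_convex_sets_def mem_Collect_eq cE by blast
    finally have "emb p \<in> emb ` I" .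
    then show ?thesis by (auto simp: emb_inj)
  qed
  have I_iff: "p \<in> I \<longleftrightarrow> emb p \<in> E" for p by (auto simp: E cu_iff unit_square_int)
  have sym: "(- a, b) \<in> I" "(a, - b) \<in> I" "(b, a) \<in> I" if "(a, b) \<in> I" for a b
  proof -
    have p: "(of_int a, of_int b) \<in> E" using that by (simp add: I_iff emb_def)
    have "(\<lambda>(x1, x2). (- x1, x2)) ` E = E" "(\<lambda>(x1, x2). (x1, - x2)) ` E = E"
      "(\<lambda>(x1, x2). (x2, x1)) ` E = E" using Sym by (auto simp: dihedral_symmetric_def)
    from this[THEN equalityD1] p show "(- a, b) \<in> I" "(a, - b) \<in> I" "(b, a) \<in> I"
      by (force simp: I_iff emb_def)+
  qed
  have hI: "(of_int a, of_int b) \<in> convex hull (emb ` I)" if "(a, b) \<in> I" for a b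
    using that by (intro hull_inc) (force simp: emb_def)
  interpret lattice_body "\<lambda>x y. \<phi> (x, y)" I
  proof
    show "\<phi> (x + x', y + y') \<le> \<phi> (x, y) + \<phi> (x', y')" for x x' y y'
      using \<open>is_norm \<phi>\<close> unfolding is_norm_def by (metis add_Pair)
    show "\<phi> (t * x, t * y) = t * \<phi> (x, y)" if "0 \<le> t" for t x y
      using \<open>is_norm \<phi>\<close> that unfolding is_norm_def by (metis abs_of_nonneg real_scaleR_def scaleR_Pair)
    show "\<phi> (- x, y) = \<phi> (x, y)" "\<phi> (x, - y) = \<phi> (x, y)" for x y
      using \<open>absolute_norm \<phi>\<close> unfolding absolute_norm_def by (metis abs_minus_cancel fst_conv snd_conv)+
    show "\<phi> (x, y) = \<phi> (y, x)" for x y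
      using \<open>symmetric_norm \<phi>\<close> by (simp add: symmetric_norm_def)
    show "\<phi> (1, 0) = 1" using \<open>normalized_norm \<phi>\<close> by (simp add: normalized_norm_def)
    show "finite I"
      by (rule finite_of_finite_perimeter[OF even_I]) (use \<open>finite_perimeter E\<close> E in auto)
    show "I \<noteq> {}" using False by (auto simp: E cu_def cell_union_def)
    show "even (a + b)" if "(a, b) \<in> I" for a b using even_I[OF that] by (simp add: evenp_def)
    show "(a', b') \<in> I"
      if "(a, b) \<in> I" "\<bar>a'\<bar> \<le> \<bar>a\<bar>" "\<bar>b'\<bar> \<le> \<bar>b\<bar>" "even (a' + b')" for a b a' b'
    proof (rule hull_I)
      \<comment> \<open>The four sign variants of (a, b) lie in the hull, which therefore contains
        the rectangle spanned by them.\<close>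
      have C: "convex (convex hull (emb ` I))" by (rule convex_convex_hull)
      have "\<bar>real_of_int a'\<bar> \<le> \<bar>real_of_int a\<bar>" "\<bar>real_of_int b'\<bar> \<le> \<bar>real_of_int b\<bar>"
        using that(2,3) by linarith+
      moreover have "(- of_int a, of_int b) \<in> convex hull (emb ` I)"
        "(of_int a, - of_int b) \<in> convex hull (emb ` I)" "(- of_int a, - of_int b) \<in> convex hull (emb ` I)"
        using hI[OF sym(1)[OF that(1)]] hI[OF sym(2)[OF that(1)]]
          hI[OF sym(1)[OF sym(2)[OF that(1)]]] by simp_all
      ultimately show "emb (a', b') \<in> convex hull (emb ` I)"
        using convex_symmetric_coordinate[OF C] hI[OF that(1)] unfolding emb_def fst_conv snd_conv by meson
    qed (use that in \<open>simp add: evenp_def\<close>)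
    show "(a - k, b + k) \<in> I" if "(a, b) \<in> I" "0 \<le> k" "k \<le> a - b" for a b k
    proof (cases "a = b")
      case True then show ?thesis using that by simp
    next
      case False
      then have ab: "0 < a - b" using that by simp
      \<comment> \<open>The parameter at which the segment from (b, a) to (a, b) passes through (a -
        k, b + k), with t = 1 at (a, b).\<close>
      define t where "t = (of_int (a - b) - 2 * of_int k) / (of_int (a - b) :: real)"
      have t: "\<bar>t\<bar> \<le> 1" "t * of_int (a - b) = of_int (a - b) - 2 * of_int k"
        using ab that by (auto simp: t_def abs_le_iff field_simps)
      show ?thesis
      proof (rule hull_I)
        show "evenp (a - k, b + k)" using even_I[OF that(1)] by (simp add: evenp_def)
        have "((of_int a + of_int b) / 2, (of_int a + of_int b) / 2) +
            t *\<^sub>R ((of_int a - of_int b) / 2, (of_int b - of_int a) / 2) \<in> convex hull (emb ` I)"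
          by (rule convex_refl_mem[OF convex_convex_hull hI[OF that(1)] hI[OF sym(3)[OF that(1)]] _ _ t(1)])
            (auto simp: field_simps)
        moreover have "((of_int a + of_int b) / 2, (of_int a + of_int b) / 2) +
            t *\<^sub>R ((of_int a - of_int b) / 2, (of_int b - of_int a) / 2) = emb (a - k, b + k)"
          using t(2) by (simp add: emb_def field_simps)
        ultimately show "emb (a - k, b + k) \<in> convex hull (emb ` I)" by simp
      qed
    qed
  qed
  let ?c = "4 / \<alpha>"
  \<comment> \<open>The distance of an even point from I is the norm of an even lattice vector, and
    \<alpha> \<notin> \<open>Lambda_phi \<phi>\<close> excludes the value 4 / \<alpha> for
    it.\<close>
  have nc: "dd v \<noteq> ?c" if "evenp v" for v
  proof
    assume "dd v = ?c"
    moreover obtain a b where ab: "(a, b) \<in> I" "dd v = n (fst v - a) (snd v - b)"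
      unfolding dd_def by (rule d_attained)
    ultimately have c: "\<phi> (emb (fst v - a, snd v - b)) = ?c" by (simp add: n_def emb_def)
    have "emb (fst v - a, snd v - b) \<in> even_lattice"
      using that ev[OF ab(1)] by (auto simp: even_lattice_emb evenp_def)
    moreover have "emb (fst v - a, snd v - b) \<noteq> (0, 0)"
    proof
      assume "emb (fst v - a, snd v - b) = (0, 0)"
      then have "\<phi> 0 = ?c" using c by (simp add: zero_prod_def)
      then show False using \<open>is_norm \<phi>\<close> \<open>\<alpha> > 0\<close> unfolding is_norm_def by (metis divide_pos_pos less_irrefl zero_less_numeral)
    qed
    moreover have "\<alpha> = 4 / \<phi> (emb (fst v - a, snd v - b))" using c \<open>\<alpha> > 0\<close> by simp
    ultimately have "\<alpha> \<in> Lambda_phi \<phi>" unfolding Lambda_phi_def by blast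
    then show False using \<open>\<alpha> \<notin> Lambda_phi \<phi>\<close> by simp
  qed
  have sol: "is_solution \<phi> \<alpha> E E' \<longleftrightarrow> E' = cu (Ia ?c)" for E'
    using is_solution_iff[OF \<open>\<alpha> > 0\<close> nc] by (simp add: E)
  have "emb ` Ia ?c = {i \<in> even_lattice. dist_phi \<phi> i (centers E) < ereal ?c}"
    using dist_phi_dd by (auto simp: even_lattice_emb cE Ia_def)
  moreover have "cu (Ia ?c) \<in> even_convex_sets"
  proof -
    have "emb ` Ia ?c \<subseteq> even_lattice" by (auto simp: even_lattice_emb Ia_def)
    moreover have "(convex hull (emb ` Ia ?c)) \<inter> even_lattice \<subseteq> emb ` Ia ?c"
    proof
      fix x assume x: "x \<in> (convex hull (emb ` Ia ?c)) \<inter> even_lattice"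
      then obtain v where v: "x = emb v" "evenp v" by (auto simp: even_lattice_emb)
      then have "d (fst v) (snd v) < ?c"
        using x Ia_convex[OF hull_I, of "fst v" "snd v" ?c] by (simp add: emb_def evenp_def)
      then show "x \<in> emb ` Ia ?c" using v by (simp add: Ia_def dd_def)
    qed
    ultimately show ?thesis
      using hull_subset[of "emb ` Ia ?c" convex] admissible_iff
      unfolding even_convex_sets_def mem_Collect_eq centers_cu by blast
  qed
  ultimately show ?thesis by (auto simp: sol centers_cu)
qed

end
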